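(* Let $K$ be a finite group. Then there exists a countable $\aleph_0$-categorical homogeneous structure $M$ with the strong small index property and no algebraicity such that $K \cong Out(Aut(M))$.
   Context: A countable structure is homogeneous if every isomorphism between finite substructures extends to an automorphism. For $G = Aut(M)$ and $A \subseteq M$, $G_{(A)}$ and $G_{\{A\}}$ are the pointwise and setwise stabilizers. $M$ has the strong small index property if every subgroup of $Aut(M)$ of index less than $2^{\aleph_0}$ lies between $G_{(A)}$ and $G_{\{A\}}$ for some finite $A \subseteq M$. $acl_M(A)$ is the set of elements whose orbit under $G_{(A)}$ is finite; no algebraicity means $acl_M(A) = A$ for all $A \subseteq M$. $Out(H) = Aut(H)/Inn(H)$ is the outer automorphism group of a group $H$.
   Formalization: No algebraicity is stated as acl_M(A) = A for finite A only; for arbitrary A ⊆ M it fails for every nonempty M, since for A = M minus a point b the pointwise stabilizer is trivial and b lies in acl_M(A). *)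

theory Defs
  imports
    "HOL-Library.Countable_Set"
    "HOL-Library.Equipollence"
    "HOL-Algebra.Bij"
    "HOL-Algebra.Coset"
    "HOL-Algebra.Group_Action"
begin

section \<open>First-order languages and structures\<close>

text \<open>The symbols of a language are the elements of the domains of the two arity maps;
  constants are function symbols of arity 0.\<close>

record ('f, 'r) lang =
  fun_arity :: "'f \<Rightarrow> nat option"
  rel_arity :: "'r \<Rightarrow> nat option"

record ('f, 'r, 'a) struct =
  univ :: "'a set"
  fun_int :: "'f \<Rightarrow> 'a list \<Rightarrow> 'a"
  rel_int :: "'r \<Rightarrow> 'a list \<Rightarrow> bool"

text \<open>Values of the interpretations on symbols outside the language, on lists of the wrong
  length, or on lists not contained in the universe are irrelevant everywhere below.\<close>

definition is_struct :: "('f, 'r) lang \<Rightarrow> ('f, 'r, 'a) struct \<Rightarrow> bool" where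
  "is_struct L M \<longleftrightarrow> univ M \<noteq> {} \<and>
     (\<forall>f xs. fun_arity L f = Some (length xs) \<and> set xs \<subseteq> univ M \<longrightarrow> fun_int M f xs \<in> univ M)"

definition struct_iso ::
  "('f, 'r) lang \<Rightarrow> ('f, 'r, 'a) struct \<Rightarrow> ('f, 'r, 'b) struct \<Rightarrow> ('a \<Rightarrow> 'b) \<Rightarrow> bool" where
  "struct_iso L M N h \<longleftrightarrow> bij_betw h (univ M) (univ N) \<and>
     (\<forall>f xs. fun_arity L f = Some (length xs) \<and> set xs \<subseteq> univ M \<longrightarrow>
        h (fun_int M f xs) = fun_int N f (map h xs)) \<and>
     (\<forall>r xs. rel_arity L r = Some (length xs) \<and> set xs \<subseteq> univ M \<longrightarrow>
        (rel_int M r xs \<longleftrightarrow> rel_int N r (map h xs)))"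

definition induced :: "('f, 'r, 'a) struct \<Rightarrow> 'a set \<Rightarrow> ('f, 'r, 'a) struct" where
  "induced M A = M\<lparr>univ := A\<rparr>"

text \<open>\<open>A\<close> is the universe of a substructure of \<open>M\<close> (closed under the functions and constants).\<close>

definition substruct :: "('f, 'r) lang \<Rightarrow> ('f, 'r, 'a) struct \<Rightarrow> 'a set \<Rightarrow> bool" where
  "substruct L M A \<longleftrightarrow> A \<subseteq> univ M \<and> is_struct L (induced M A)"


section \<open>First-order logic and \<open>\<aleph>\<^sub>0\<close>-categoricity\<close>

datatype 'f fo_term = Var nat | Fun 'f "'f fo_term list"

datatype ('f, 'r) fo_form =
    Eq "'f fo_term" "'f fo_term"
  | Rel 'r "'f fo_term list"
  | Neg "('f, 'r) fo_form"
  | Conj "('f, 'r) fo_form" "('f, 'r) fo_form"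
  | All nat "('f, 'r) fo_form"

fun wf_term :: "('f, 'r) lang \<Rightarrow> 'f fo_term \<Rightarrow> bool" where
  "wf_term L (Var x) \<longleftrightarrow> True"
| "wf_term L (Fun f ts) \<longleftrightarrow> fun_arity L f = Some (length ts) \<and> list_all (wf_term L) ts"

primrec wf_form :: "('f, 'r) lang \<Rightarrow> ('f, 'r) fo_form \<Rightarrow> bool" where
  "wf_form L (Eq s t) \<longleftrightarrow> wf_term L s \<and> wf_term L t"
| "wf_form L (Rel r ts) \<longleftrightarrow> rel_arity L r = Some (length ts) \<and> list_all (wf_term L) ts"
| "wf_form L (Neg \<phi>) \<longleftrightarrow> wf_form L \<phi>"
| "wf_form L (Conj \<phi> \<psi>) \<longleftrightarrow> wf_form L \<phi> \<and> wf_form L \<psi>"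
| "wf_form L (All x \<phi>) \<longleftrightarrow> wf_form L \<phi>"

primrec fv_term :: "'f fo_term \<Rightarrow> nat set" where
  "fv_term (Var x) = {x}"
| "fv_term (Fun f ts) = \<Union> (set (map fv_term ts))"

primrec fv_form :: "('f, 'r) fo_form \<Rightarrow> nat set" where
  "fv_form (Eq s t) = fv_term s \<union> fv_term t"
| "fv_form (Rel r ts) = \<Union> (set (map fv_term ts))"
| "fv_form (Neg \<phi>) = fv_form \<phi>"
| "fv_form (Conj \<phi> \<psi>) = fv_form \<phi> \<union> fv_form \<psi>"
| "fv_form (All x \<phi>) = fv_form \<phi> - {x}"

primrec eval_term :: "('f, 'r, 'a) struct \<Rightarrow> (nat \<Rightarrow> 'a) \<Rightarrow> 'f fo_term \<Rightarrow> 'a" where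
  "eval_term M e (Var x) = e x"
| "eval_term M e (Fun f ts) = fun_int M f (map (eval_term M e) ts)"

primrec sat :: "('f, 'r, 'a) struct \<Rightarrow> (nat \<Rightarrow> 'a) \<Rightarrow> ('f, 'r) fo_form \<Rightarrow> bool" where
  "sat M e (Eq s t) \<longleftrightarrow> eval_term M e s = eval_term M e t"
| "sat M e (Rel r ts) \<longleftrightarrow> rel_int M r (map (eval_term M e) ts)"
| "sat M e (Neg \<phi>) \<longleftrightarrow> \<not> sat M e \<phi>"
| "sat M e (Conj \<phi> \<psi>) \<longleftrightarrow> sat M e \<phi> \<and> sat M e \<psi>"
| "sat M e (All x \<phi>) \<longleftrightarrow> (\<forall>a\<in>univ M. sat M (e(x := a)) \<phi>)"

definition sentences :: "('f, 'r) lang \<Rightarrow> ('f, 'r) fo_form set" where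
  "sentences L = {\<phi>. wf_form L \<phi> \<and> fv_form \<phi> = {}}"

definition holds :: "('f, 'r, 'a) struct \<Rightarrow> ('f, 'r) fo_form \<Rightarrow> bool" where
  "holds M \<phi> \<longleftrightarrow> (\<forall>e. range e \<subseteq> univ M \<longrightarrow> sat M e \<phi>)"

definition Th :: "('f, 'r) lang \<Rightarrow> ('f, 'r, 'a) struct \<Rightarrow> ('f, 'r) fo_form set" where
  "Th L M = {\<phi> \<in> sentences L. holds M \<phi>}"

definition models :: "('f, 'r) lang \<Rightarrow> ('f, 'r, 'a) struct \<Rightarrow> ('f, 'r) fo_form set \<Rightarrow> bool" where
  "models L M T \<longleftrightarrow> is_struct L M \<and> (\<forall>\<phi>\<in>T. holds M \<phi>)"

text \<open>A theory is \<open>\<aleph>\<^sub>0\<close>-categorical if up to isomorphism it has exactly one model of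
  cardinality \<open>\<aleph>\<^sub>0\<close>. Every such model has an isomorphic copy with universe a set of
  natural numbers, so it suffices to let the models range over structures on \<^typ>\<open>nat\<close>.\<close>

definition aleph0_categorical_theory :: "('f, 'r) lang \<Rightarrow> ('f, 'r) fo_form set \<Rightarrow> bool" where
  "aleph0_categorical_theory L T \<longleftrightarrow>
     (\<exists>N :: ('f, 'r, nat) struct. models L N T \<and> infinite (univ N)) \<and>
     (\<forall>(N :: ('f, 'r, nat) struct) (N' :: ('f, 'r, nat) struct).
        models L N T \<and> infinite (univ N) \<and> models L N' T \<and> infinite (univ N') \<longrightarrow>
        (\<exists>h. struct_iso L N N' h))"

definition aleph0_categorical :: "('f, 'r) lang \<Rightarrow> ('f, 'r, 'a) struct \<Rightarrow> bool" where
  "aleph0_categorical L M \<longleftrightarrow> aleph0_categorical_theory L (Th L M)"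


section \<open>Automorphism groups of structures\<close>

text \<open>As for \<^const>\<open>AutoGroup\<close>, automorphisms are extensional on the universe.\<close>

definition Aut :: "('f, 'r) lang \<Rightarrow> ('f, 'r, 'a) struct \<Rightarrow> ('a \<Rightarrow> 'a) monoid" where
  "Aut L M = BijGroup (univ M)\<lparr>carrier := {g \<in> Bij (univ M). struct_iso L M M g}\<rparr>"

definition pointwise_stab :: "('f, 'r) lang \<Rightarrow> ('f, 'r, 'a) struct \<Rightarrow> 'a set \<Rightarrow> ('a \<Rightarrow> 'a) set" where
  "pointwise_stab L M A = {g \<in> carrier (Aut L M). \<forall>a\<in>A. g a = a}"

definition setwise_stab :: "('f, 'r) lang \<Rightarrow> ('f, 'r, 'a) struct \<Rightarrow> 'a set \<Rightarrow> ('a \<Rightarrow> 'a) set" where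
  "setwise_stab L M A = {g \<in> carrier (Aut L M). g ` A = A}"

definition homogeneous :: "('f, 'r) lang \<Rightarrow> ('f, 'r, 'a) struct \<Rightarrow> bool" where
  "homogeneous L M \<longleftrightarrow>
     (\<forall>A B h. finite A \<and> finite B \<and> substruct L M A \<and> substruct L M B \<and>
        struct_iso L (induced M A) (induced M B) h \<longrightarrow>
        (\<exists>g\<in>carrier (Aut L M). \<forall>a\<in>A. g a = h a))"

definition strong_small_index_property ::
  "('f, 'r) lang \<Rightarrow> ('f, 'r, 'a) struct \<Rightarrow> bool" where
  "strong_small_index_property L M \<longleftrightarrow>
     (\<forall>H. subgroup H (Aut L M) \<and> rcosets\<^bsub>Aut L M\<^esub> H \<prec> (UNIV :: nat set set) \<longrightarrow>
        (\<exists>A. finite A \<and> A \<subseteq> univ M \<and> pointwise_stab L M A \<subseteq> H \<and> H \<subseteq> setwise_stab L M A))"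

definition acl :: "('f, 'r) lang \<Rightarrow> ('f, 'r, 'a) struct \<Rightarrow> 'a set \<Rightarrow> 'a set" where
  "acl L M A =
     {b \<in> univ M. finite (orbit (Aut L M\<lparr>carrier := pointwise_stab L M A\<rparr>) (\<lambda>g. g) b)}"

text \<open>The sets \<open>A\<close> have to be finite: for \<open>b\<close> in the universe, the pointwise stabilizer of
  \<open>univ M - {b}\<close> is trivial, so \<open>b \<in> acl L M (univ M - {b})\<close> for every structure \<open>M\<close>.\<close>

definition no_algebraicity :: "('f, 'r) lang \<Rightarrow> ('f, 'r, 'a) struct \<Rightarrow> bool" where
  "no_algebraicity L M \<longleftrightarrow> (\<forall>A. finite A \<and> A \<subseteq> univ M \<longrightarrow> acl L M A = A)"


section \<open>Outer automorphism groups\<close>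

definition Inn :: "('a, 'b) monoid_scheme \<Rightarrow> ('a \<Rightarrow> 'a) set" where
  "Inn G = (\<lambda>g. \<lambda>x\<in>carrier G. g \<otimes>\<^bsub>G\<^esub> x \<otimes>\<^bsub>G\<^esub> inv\<^bsub>G\<^esub> g) ` carrier G"

definition Out :: "('a, 'b) monoid_scheme \<Rightarrow> ('a \<Rightarrow> 'a) set monoid" where
  "Out G = AutoGroup G Mod Inn G"

end

theory Submission
  imports Defs
begin

text \<open>
  Points carry sorts from the set \<open>K\<close>, and every finite set \<open>S\<close> whose numbers of points in the
  various sorts follow the pattern of some \<open>v \<in> K\<close> (\<open>E (v\<^sup>-\<^sup>1 u)\<close> points of sort \<open>u\<close>, where
  \<open>E\<close> is injective and \<open>E 1 = 3\<close>) may single out two of its three points of sort \<open>v\<close>; \<open>M\<close> is the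
  generic such structure.  The choices on a fixed set form a vector space over the field with two
  elements, which makes the extension property for partial automorphisms easy, and the one-point
  extension property holds without restriction.  From these two facts one gets, by a Baire
  category argument with generic tuples of automorphisms, that a subgroup of index less than the
  continuum contains a pointwise stabilizer, and then the strong small index property.

  An automorphism of \<open>Aut(M)\<close> permutes the point stabilizers and hence is conjugation by a permutation
  normalizing \<open>Aut(M)\<close>.  The choice on \<open>S\<close> can be read off from the setwise stabilizer of \<open>S\<close>,
  because \<open>S\<^sub>3\<close> is its own normalizer; so a normalizing permutation preserves the relation and
  permutes the sorts compatibly with the patterns, i.e. by a left translation of \<open>K\<close>.
\<close>

section \<open>Structures with sorts and a parity relation\<close>

text \<open>With sorts alone, every permutation of the infinite sort classes would normalize the
  automorphism group; the relation is there to leave only the translations. Its shape is dictated by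
  the extension of partial automorphisms within finite structures, on which the existence of generic
  tuples rests: holding at an even number of points is preserved by symmetric difference, so a
  relation can be encoded by votes that are added modulo two and corrected at a single point. Among
  three points, even means none or two; a chosen pair leaves one exceptional point, which every
  automorphism preserving the set must fix, while without a pair the three points can be permuted
  freely. The value 3 is kept for the sort of the chosen points and the other values of
  \<open>E\<close> are at least 4, so that a set can choose points of one sort only. Since nothing
  forces a relation to hold, amalgams need no relations across the parts. The index is only assumed
  to be below the continuum and may be uncountable; cosets are therefore separated along trees of
  automorphisms indexed by infinite binary sequences.\<close>

definition emb ::
  "('a \<Rightarrow> 'b) \<Rightarrow> 'a set \<Rightarrow> ('a \<Rightarrow> 'k) \<Rightarrow> ('a \<Rightarrow> 'a set \<Rightarrow> bool) \<Rightarrow> ('b \<Rightarrow> 'k) \<Rightarrow> ('b \<Rightarrow> 'b set \<Rightarrow> bool) \<Rightarrow> bool" where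
  "emb f A s Q s' Q' \<longleftrightarrow> inj_on f A \<and> (\<forall>x\<in>A. s' (f x) = s x) \<and>
     (\<forall>S t. finite S \<and> S \<subseteq> A \<and> t \<in> S \<longrightarrow> Q' (f t) (f ` S) = Q t S)"

lemma embI:
  assumes "inj_on f A" "\<And>x. x \<in> A \<Longrightarrow> s' (f x) = s x"
    "\<And>S t. finite S \<Longrightarrow> S \<subseteq> A \<Longrightarrow> t \<in> S \<Longrightarrow> Q' (f t) (f ` S) = Q t S"
  shows "emb f A s Q s' Q'"
  using assms unfolding emb_def by blast

lemma emb_inj: "emb f A s Q s' Q' \<Longrightarrow> inj_on f A"
  by (simp add: emb_def)

lemma emb_sort: "emb f A s Q s' Q' \<Longrightarrow> x \<in> A \<Longrightarrow> s' (f x) = s x"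
  by (simp add: emb_def)

lemma emb_rel: "emb f A s Q s' Q' \<Longrightarrow> finite S \<Longrightarrow> S \<subseteq> A \<Longrightarrow> t \<in> S \<Longrightarrow> Q' (f t) (f ` S) = Q t S"
  by (simp add: emb_def)

lemma emb_id: "emb (\<lambda>x. x) A s Q s Q"
  by (auto simp: emb_def)

lemma emb_subset: "emb f A s Q s' Q' \<Longrightarrow> B \<subseteq> A \<Longrightarrow> emb f B s Q s' Q'"
  unfolding emb_def by (blast intro: inj_on_subset)

lemma emb_cong:
  assumes "\<And>x. x \<in> A \<Longrightarrow> f x = g x"
  shows "emb f A s Q s' Q' = emb g A s Q s' Q'"
proof -
  have "emb f' A s Q s' Q'" if "emb g' A s Q s' Q'" and e: "\<And>x. x \<in> A \<Longrightarrow> f' x = g' x" for f' g'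
  proof (rule embI)
    show "inj_on f' A" using emb_inj[OF that(1)] e by (simp cong: inj_on_cong)
    show "s' (f' x) = s x" if "x \<in> A" for x using emb_sort[OF \<open>emb g' A s Q s' Q'\<close> that] e that by simp
    fix S t assume S: "finite S" "S \<subseteq> A" "t \<in> S"
    have "f' ` S = g' ` S" using e S(2) by (intro image_cong) auto
    thus "Q' (f' t) (f' ` S) = Q t S" using emb_rel[OF \<open>emb g' A s Q s' Q'\<close> S] e S by auto
  qed
  thus ?thesis using assms by metis
qed

lemma emb_trans:
  assumes "emb f A s Q s' Q'" "emb g B s' Q' s'' Q''" "f ` A \<subseteq> B"
  shows "emb (\<lambda>x. g (f x)) A s Q s'' Q''"
proof (rule embI)
  show "inj_on (\<lambda>x. g (f x)) A"
    using comp_inj_on[OF emb_inj[OF assms(1)] inj_on_subset[OF emb_inj[OF assms(2)] assms(3)]]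
    by (simp add: comp_def)
  show "s'' (g (f x)) = s x" if "x \<in> A" for x
    using emb_sort[OF assms(1) that] emb_sort[OF assms(2), of "f x"] assms(3) that by auto
  fix S t assume S: "finite S" "S \<subseteq> A" "t \<in> S"
  have "Q'' (g (f t)) (g ` (f ` S)) = Q' (f t) (f ` S)"
    using S assms(3) by (intro emb_rel[OF assms(2)]) auto
  thus "Q'' (g (f t)) ((\<lambda>x. g (f x)) ` S) = Q t S"
    using emb_rel[OF assms(1) S] by (simp add: image_image)
qed

lemma emb_inv_into:
  assumes "emb f A s Q s' Q'"
  shows "emb (inv_into A f) (f ` A) s' Q' s Q"
proof (rule embI)
  show "inj_on (inv_into A f) (f ` A)" by (rule inj_on_inv_into) simp
  show "s (inv_into A f x) = s' x" if "x \<in> f ` A" for x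
    using emb_sort[OF assms, of "inv_into A f x"] that by (simp add: inv_into_into f_inv_into_f)
  fix S t assume S: "finite S" "S \<subseteq> f ` A" "t \<in> S"
  let ?S = "inv_into A f ` S"
  have "Q' (f (inv_into A f t)) (f ` ?S) = Q (inv_into A f t) ?S"
    using S by (intro emb_rel[OF assms]) (auto simp: inv_into_into)
  moreover have "f ` ?S = S" using S(2) by (rule image_inv_into_cancel[OF refl])
  moreover have "f (inv_into A f t) = t" using S by (auto intro: f_inv_into_f)
  ultimately show "Q (inv_into A f t) ?S = Q' t S" by simp
qed

text \<open>\<open>pat v u\<close> is the number of points of sort \<open>u\<close> in a set on
  which a point of sort \<open>v\<close> may be chosen. The common row sum \<open>N\<close> makes
  all these sets equally large, so that one relation symbol of arity \<open>N\<close> suffices;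
  \<open>2 \<le> N\<close> keeps single points free of relations.\<close>

locale sort_pattern =
  fixes V :: "'k set" and pat :: "'k \<Rightarrow> 'k \<Rightarrow> nat" and N :: nat
  assumes finite_V: "finite V" and V_nonempty: "V \<noteq> {}"
    and pat_sum: "\<And>v. v \<in> V \<Longrightarrow> sum (pat v) V = N"
    and N_ge2: "2 \<le> N"
begin

definition allowed :: "('a \<Rightarrow> 'k) \<Rightarrow> 'a \<Rightarrow> 'a set \<Rightarrow> bool" where
  "allowed s t S \<longleftrightarrow> finite S \<and> t \<in> S \<and> s ` S \<subseteq> V \<and> (\<forall>u\<in>V. card {x\<in>S. s x = u} = pat (s t) u)"

text \<open>Evenness is the form of "none or two chosen points" that survives addition modulo two;
  under the later assumption \<open>pat_diag\<close> it amounts to exactly that. The points may come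
  from any type, so that amalgams can be built on sums and products before they are mapped into the
  natural numbers.\<close>

definition valid :: "'a set \<Rightarrow> ('a \<Rightarrow> 'k) \<Rightarrow> ('a \<Rightarrow> 'a set \<Rightarrow> bool) \<Rightarrow> bool" where
  "valid B s Q \<longleftrightarrow> s ` B \<subseteq> V \<and>
     (\<forall>S. finite S \<and> S \<subseteq> B \<longrightarrow> (\<forall>t. Q t S \<longrightarrow> allowed s t S) \<and> even (card {t. Q t S}))"

lemma valid_sort: "valid B s Q \<Longrightarrow> x \<in> B \<Longrightarrow> s x \<in> V"
  by (auto simp: valid_def)

lemma valid_allowed: "valid B s Q \<Longrightarrow> finite S \<Longrightarrow> S \<subseteq> B \<Longrightarrow> Q t S \<Longrightarrow> allowed s t S"
  by (auto simp: valid_def)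

lemma valid_even: "valid B s Q \<Longrightarrow> finite S \<Longrightarrow> S \<subseteq> B \<Longrightarrow> even (card {t. Q t S})"
  by (auto simp: valid_def)

lemma valid_subset: "valid B s Q \<Longrightarrow> A \<subseteq> B \<Longrightarrow> valid A s Q"
  unfolding valid_def by blast

lemma allowed_mem: "allowed s t S \<Longrightarrow> t \<in> S"
  by (simp add: allowed_def)

lemma allowed_card:
  assumes "allowed s t S" shows "card S = N"
proof -
  have "card S = (\<Sum>u\<in>V. card {x\<in>S. s x = u})"
    using assms finite_V unfolding allowed_def
    by (subst card_eq_sum, subst sum.group[symmetric, where g = s and T = V]) auto
  also have "\<dots> = sum (pat (s t)) V" using assms by (auto simp: allowed_def)
  also have "\<dots> = N" using assms by (intro pat_sum) (auto simp: allowed_def)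
  finally show ?thesis .
qed

lemma allowed_image:
  assumes "inj_on f S" "\<And>x. x \<in> S \<Longrightarrow> s' (f x) = s x" "t \<in> S" "finite S"
  shows "allowed s' (f t) (f ` S) = allowed s t S"
proof -
  have "card {x \<in> f ` S. s' x = u} = card {x\<in>S. s x = u}" for u
  proof -
    have "{x \<in> f ` S. s' x = u} = f ` {x\<in>S. s x = u}" using assms(2) by force
    thus ?thesis using inj_on_subset[OF assms(1)] by (simp add: card_image)
  qed
  moreover have "s' ` f ` S = s ` S" using assms(2) by force
  ultimately show ?thesis using assms by (auto simp: allowed_def)
qed

type_synonym code = "nat \<times> (nat option \<times> nat list) list"

text \<open>A point \<open>m\<close> codes its sort and the relations on the sets with maximum \<open>m\<close>, a pair
  \<open>(a, S)\<close> in the code referring to the set \<open>insert m S\<close> and to its point \<open>a\<close>, where \<open>None\<close> stands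
  for \<open>m\<close>.  Every code occurs at arbitrarily large \<open>m\<close>.\<close>

definition code_at :: "nat \<Rightarrow> code" where
  "code_at m = snd (from_nat m :: nat \<times> code)"

lemma code_at_infinitely_often:
  assumes "finite X" shows "\<exists>m. m \<notin> X \<and> (\<forall>x\<in>X. x < m) \<and> code_at m = c"
proof -
  let ?r = "range (\<lambda>j::nat. to_nat (j, c))"
  have "infinite ?r" by (intro range_inj_infinite injI) simp
  then obtain m where m: "m \<in> ?r" "m > Max (insert 0 X)"
    by (meson infinite_nat_iff_unbounded)
  then show ?thesis using assms by (intro exI[of _ m]) (auto simp: code_at_def)
qed

definition srt :: "nat \<Rightarrow> 'k" where
  "srt m = from_nat_into V (fst (code_at m))"

definition coded :: "nat \<Rightarrow> nat \<Rightarrow> nat set \<Rightarrow> bool" where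
  "coded m t S \<longleftrightarrow> allowed srt t S \<and>
     (if t = m then None else Some t, S - {m}) \<in> (\<lambda>(a, l). (a, set l)) ` set (snd (code_at m))"

text \<open>A code may name an odd number of points for some set; then nothing is made to hold on
  that set. Every code is thereby harmless, and the structure is valid by construction.\<close>

definition R :: "nat \<Rightarrow> nat set \<Rightarrow> bool" where
  "R t S \<longleftrightarrow> coded (Max S) t S \<and> even (card {t. coded (Max S) t S})"

lemma srt_in: "srt x \<in> V"
  unfolding srt_def using V_nonempty by (rule from_nat_into)

lemma valid_M: "valid UNIV srt R"
  unfolding valid_def
proof (intro conjI allI impI)
  show "srt ` UNIV \<subseteq> V" using srt_in by auto
  fix S :: "nat set" assume "finite S \<and> S \<subseteq> UNIV"
  show "allowed srt t S" if "R t S" for t using that by (auto simp: R_def coded_def)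
  show "even (card {t. R t S})"
    by (cases "even (card {t. coded (Max S) t S})") (simp_all add: R_def)
qed

lemma allowed_M: "R t S \<Longrightarrow> allowed srt t S"
  by (auto simp: R_def coded_def)

lemma R_mem: "R t S \<Longrightarrow> t \<in> S"
  using allowed_M allowed_mem by metis

text \<open>A point \<open>m\<close> above the image of \<open>A\<close> is the maximum of the image
  of every set through \<open>b\<close>, so the code of \<open>m\<close> alone decides these
  relations and can be prescribed at will. The parity filter in \<open>R\<close> lets them pass
  because \<open>Q\<close> is valid.\<close>

lemma one_point_extension:
  fixes b :: 'b
  assumes fin: "finite A" "finite X" and b: "b \<notin> A" and v: "valid (insert b A) s Q"
    and f: "emb f A s Q srt R"
  shows "\<exists>m. m \<notin> X \<and> emb (f(b := m)) (insert b A) s Q srt R"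
proof -
  \<comment> \<open>All relations on sets through \<open>b\<close>. The code of \<open>m\<close>
    cannot contain \<open>m\<close> itself, which is why the image of \<open>b\<close> is
    represented by \<open>None\<close>.\<close>
  define E where "E = {(Some t, S) | t S. S \<subseteq> A \<and> t \<in> S \<and> Q t (insert b S)} \<union> {(None, S) | S. S \<subseteq> A \<and> Q b (insert b S)}"
  have finE: "finite E"
  proof (rule finite_subset)
    show "E \<subseteq> (Some ` A \<union> {None}) \<times> Pow A" by (auto simp: E_def)
    show "finite ((Some ` A \<union> {None}) \<times> Pow A)" using fin by simp
  qed
  define E' where "E' = (\<lambda>(a, S). (map_option f a, sorted_list_of_set (f ` S))) ` E"
  have finE': "finite E'" using finE by (simp add: E'_def)
  obtain i where i: "from_nat_into V i = s b"
    using from_nat_into_surj[of V "s b"] valid_sort[OF v, of b] finite_V by (auto intro: countable_finite)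
  obtain L where L: "set L = E'" using finite_list[OF finE'] by blast
  obtain m where m: "m \<notin> X \<union> f ` A" "\<And>x. x \<in> X \<union> f ` A \<Longrightarrow> x < m" "code_at m = (i, L)"
    using code_at_infinitely_often[of "X \<union> f ` A" "(i, L)"] fin by auto
  define g where "g = f(b := m)"
  have gA: "g x = f x" if "x \<in> A" for x using that b by (auto simp: g_def)
  have gb: "g b = m" by (simp add: g_def)
  have imS: "g ` S = f ` S" if "S \<subseteq> A" for S using that gA by (auto simp: subset_iff)
  have inj: "inj_on g (insert b A)"
    using emb_inj[OF f] m(1) b unfolding g_def
    by (auto simp: inj_on_def fun_upd_def)
  have srtm: "srt m = s b" using m(3) i by (simp add: srt_def)
  have gs: "srt (g x) = s x" if "x \<in> insert b A" for x
    using that gA gb srtm emb_sort[OF f] by auto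
  have set': "(\<lambda>(a, l). (a, set l)) ` set (snd (code_at m)) = (\<lambda>(a, S). (map_option f a, f ` S)) ` E"
  proof -
    have "set (sorted_list_of_set (f ` S)) = f ` S" if "(a, S) \<in> E" for a S
      using that fin finite_subset[of S A] by (auto simp: E_def)
    thus ?thesis unfolding m(3) snd_conv L E'_def image_image by (intro image_cong) auto
  qed
  have inE: "(map_option f a, f ` S) \<in> (\<lambda>(a, S). (map_option f a, f ` S)) ` E \<longleftrightarrow> (a, S) \<in> E"
    if a: "set_option a \<subseteq> A" and S: "S \<subseteq> A" for a S
  proof
    assume "(map_option f a, f ` S) \<in> (\<lambda>(a, S). (map_option f a, f ` S)) ` E"
    then obtain a' S' where E: "(a', S') \<in> E" and eq: "map_option f a = map_option f a'" "f ` S = f ` S'" by auto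
    have S': "S' \<subseteq> A" "set_option a' \<subseteq> A" using E by (auto simp: E_def)
    have "S = S'" using eq(2) S S' emb_inj[OF f] by (metis inj_on_image_eq_iff)
    moreover have "a = a'" using eq(1) a S'(2) emb_inj[OF f] by (cases a; cases a') (auto dest: inj_onD)
    ultimately show "(a, S) \<in> E" using E by simp
  qed force
  have cod: "coded m t (g ` insert b S) \<longleftrightarrow> (\<exists>t'\<in>insert b S. t = g t' \<and> Q t' (insert b S))" if S: "S \<subseteq> A" for t S
  proof (cases "t \<in> g ` insert b S")
    case False
    hence "\<not> coded m t (g ` insert b S)" using allowed_mem[of srt t "g ` insert b S"] by (auto simp: coded_def)
    with False show ?thesis by auto
  next
    case True
    then obtain t' where t': "t' \<in> insert b S" "t = g t'" by blast
    have finS: "finite S" using S fin finite_subset by blast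
    have injS: "inj_on g (insert b S)" using inj S by (auto intro: inj_on_subset)
    have "allowed srt t (g ` insert b S) = allowed s t' (insert b S)"
      unfolding t'(2) using t' injS finS gs S by (intro allowed_image) auto
    moreover have "g ` insert b S - {m} = f ` S"
    proof -
      have "m \<notin> f ` S" using m(1) S by blast
      thus ?thesis using gb imS[OF S] by auto
    qed
    moreover have "(if t = m then None else Some t, f ` S) = (map_option f (if t' = b then None else Some t'), f ` S)"
    proof (cases "t' = b")
      case False
      hence "t' \<in> A" using t' S by auto
      moreover have "f t' \<noteq> m" using m(1) calculation by blast
      ultimately show ?thesis using False t'(2) gA by simp
    qed (use t'(2) gb in simp)
    moreover have "((if t' = b then None else Some t'), S) \<in> E \<longleftrightarrow> Q t' (insert b S)"
      using t' S b by (auto simp: E_def)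
    moreover have "set_option (if t' = b then None else Some t') \<subseteq> A" using t' S by auto
    moreover have "Q t' (insert b S) \<Longrightarrow> allowed s t' (insert b S)"
      using valid_allowed[OF v, of "insert b S"] finS S by auto
    ultimately have "coded m t (g ` insert b S) \<longleftrightarrow> Q t' (insert b S)"
      unfolding coded_def set' using inE[of "if t' = b then None else Some t'" S] S by (auto simp del: image_insert)
    moreover have "t = g t'' \<longleftrightarrow> t'' = t'" if "t'' \<in> insert b S" for t''
      using t'(2) inj_on_eq_iff[OF injS that t'(1)] by metis
    ultimately show ?thesis using t'(1) by auto
  qed
  have "emb g (insert b A) s Q srt R"
  proof (rule embI)
    show "inj_on g (insert b A)" by fact
    show "srt (g x) = s x" if "x \<in> insert b A" for x using gs that .
    fix S t assume S: "finite S" "S \<subseteq> insert b A" "t \<in> S"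
    show "R (g t) (g ` S) = Q t S"
    proof (cases "b \<in> S")
      case False
      hence SA: "S \<subseteq> A" using S by auto
      thus ?thesis using emb_rel[OF f S(1) SA S(3)] imS[OF SA] gA S by auto
    next
      case True
      define S0 where "S0 = S - {b}"
      have S0: "S = insert b S0" "S0 \<subseteq> A" using True S by (auto simp: S0_def)
      have "x < m" if "x \<in> f ` S0" for x using m(2) that S0(2) by blast
      hence "x \<le> m" if "x \<in> g ` S" for x
        using that S0(1) gb imS[OF S0(2)] by (auto intro: less_imp_le)
      hence "Max (g ` S) = m" using S(1) True gb by (intro Max_eqI) auto
      moreover have QS: "t \<in> S" if "Q t S" for t
        using valid_allowed[OF v S(1,2) that] by (rule allowed_mem)
      have "{t. coded m t (g ` S)} = g ` {t. Q t S}"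
      proof (rule Set.set_eqI)
        fix t
        have "coded m t (g ` S) \<longleftrightarrow> (\<exists>t'\<in>S. t = g t' \<and> Q t' S)" unfolding S0(1) by (rule cod[OF S0(2)])
        thus "t \<in> {t. coded m t (g ` S)} \<longleftrightarrow> t \<in> g ` {t. Q t S}" using QS by auto
      qed
      moreover have "inj_on g {t. Q t S}"
        by (rule inj_on_subset[OF inj]) (use QS S(2) in auto)
      hence "card (g ` {t. Q t S}) = card {t. Q t S}" by (rule card_image)
      moreover have "coded m (g t) (g ` S) = Q t S"
        unfolding S0(1) cod[OF S0(2)] using S inj S0 by (metis inj_onD subset_iff)
      ultimately show ?thesis using valid_even[OF v S(1,2)] by (simp add: R_def)
    qed
  qed
  thus ?thesis using m(1) unfolding g_def by blast
qed

text \<open>Points are added one at a time. That the new ones can avoid any finite \<open>X\<close>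
  is the later source of the absence of algebraicity.\<close>

lemma extension:
  assumes fin: "finite P" and A: "A \<subseteq> P" and v: "valid P s Q" and f: "emb f A s Q srt R" and X: "finite X"
  shows "\<exists>e. emb e P s Q srt R \<and> (\<forall>a\<in>A. e a = f a) \<and> e ` (P - A) \<inter> X = {}"
proof -
  have "\<exists>e. emb e (A \<union> D) s Q srt R \<and> (\<forall>a\<in>A. e a = f a) \<and> e ` D \<inter> X = {}"
    if "finite D" "D \<subseteq> P - A" for D
    using that
  proof (induction D rule: finite_induct)
    case empty
    show ?case using f by auto
  next
    case (insert b D)
    then obtain e where e: "emb e (A \<union> D) s Q srt R" "\<forall>a\<in>A. e a = f a" "e ` D \<inter> X = {}" by auto
    have "finite (A \<union> D)" using fin A insert.hyps finite_subset by blast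
    moreover have "b \<notin> A \<union> D" using insert by auto
    moreover have "valid (insert b (A \<union> D)) s Q" using insert A by (intro valid_subset[OF v]) auto
    ultimately obtain m where m: "m \<notin> X" "emb (e(b := m)) (insert b (A \<union> D)) s Q srt R"
      using one_point_extension[OF _ X _ _ e(1)] by blast
    have "\<forall>a\<in>A. (e(b := m)) a = f a" using e(2) insert.prems by auto
    moreover have "(e(b := m)) ` insert b D \<inter> X = {}" using e(3) m(1) insert.hyps by auto
    ultimately show ?case using m(2) by (auto simp del: fun_upd_apply)
  qed
  from this[of "P - A"] show ?thesis using A fin by (auto simp: Un_absorb1)
qed

end

section \<open>Back and forth, homogeneity\<close>

lemma chain_exists:
  fixes P :: "'a set \<Rightarrow> ('a \<Rightarrow> 'b) \<Rightarrow> bool"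
  assumes P0: "P A0 h0"
    and step: "\<And>n A h. P A h \<Longrightarrow> \<exists>A' h'. P A' h' \<and> A \<subseteq> A' \<and> (\<forall>x\<in>A. h' x = h x) \<and> D n A' h'"
  shows "\<exists>A h. A 0 = A0 \<and> h 0 = h0 \<and> (\<forall>n. P (A n) (h n) \<and> A n \<subseteq> A (Suc n) \<and>
           (\<forall>x\<in>A n. h (Suc n) x = h n x) \<and> D n (A (Suc n)) (h (Suc n)))"
proof -
  \<comment> \<open>Dependent choice leaves the starting value open; the implication from
    \<open>n = 0\<close> pins it to the given pair.\<close>
  have "\<exists>c. \<forall>n. (P (fst (c n)) (snd (c n)) \<and> (n = 0 \<longrightarrow> c n = (A0, h0))) \<and>
          (fst (c n) \<subseteq> fst (c (Suc n)) \<and> (\<forall>x\<in>fst (c n). snd (c (Suc n)) x = snd (c n) x) \<and>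
           D n (fst (c (Suc n))) (snd (c (Suc n))))"
  proof (rule dependent_nat_choice)
    show "\<exists>c. P (fst c) (snd c) \<and> (0 = (0::nat) \<longrightarrow> c = (A0, h0))" using P0 by auto
    fix c n assume "P (fst c) (snd c) \<and> (n = (0::nat) \<longrightarrow> c = (A0, h0))"
    thus "\<exists>c'. (P (fst c') (snd c') \<and> (Suc n = 0 \<longrightarrow> c' = (A0, h0))) \<and>
          fst c \<subseteq> fst c' \<and> (\<forall>x\<in>fst c. snd c' x = snd c x) \<and> D n (fst c') (snd c')"
      using step[of "fst c" "snd c" n] by auto
  qed
  then obtain c where c: "\<And>n. P (fst (c n)) (snd (c n))" "c 0 = (A0, h0)"
     "\<And>n. fst (c n) \<subseteq> fst (c (Suc n))" "\<And>n. \<forall>x\<in>fst (c n). snd (c (Suc n)) x = snd (c n) x"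
     "\<And>n. D n (fst (c (Suc n))) (snd (c (Suc n)))" by blast
  show ?thesis
    by (rule exI[of _ "\<lambda>n. fst (c n)"], rule exI[of _ "\<lambda>n. snd (c n)"]) (use c in auto)
qed

lemma chain_agree:
  fixes A :: "nat \<Rightarrow> 'a set"
  assumes "\<And>n. A n \<subseteq> A (Suc n)" "\<And>n x. x \<in> A n \<Longrightarrow> h (Suc n) x = h n x"
    and "m \<le> n" "x \<in> A m"
  shows "h n x = h m x"
  using assms(3,4)
proof (induction n rule: dec_induct)
  case (step n)
  have "A m \<subseteq> A n" using assms(1) step.hyps(1) lift_Suc_mono_le[of A m n] by blast
  thus ?case using step assms(2)[of x n] by auto
qed simp

lemma chain_limit:
  fixes A :: "nat \<Rightarrow> 'a set"
  assumes mono: "\<And>n. A n \<subseteq> A (Suc n)" and agree: "\<And>n x. x \<in> A n \<Longrightarrow> h (Suc n) x = h n x"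
  shows "\<exists>f. \<forall>n. \<forall>x\<in>A n. f x = h n x"
proof -
  define f where "f x = h (LEAST n. x \<in> A n) x" for x
  have "f x = h n x" if "x \<in> A n" for n x
    unfolding f_def
    using chain_agree[of A h, OF mono agree Least_le[of "\<lambda>n. x \<in> A n", OF that] LeastI[of "\<lambda>n. x \<in> A n", OF that]]
    by simp
  thus ?thesis by blast
qed

lemma finite_subset_chain:
  fixes A :: "nat \<Rightarrow> 'a set"
  assumes mono: "\<And>n. A n \<subseteq> A (Suc n)" and F: "finite F" "F \<subseteq> (\<Union>n. A n)"
  shows "\<exists>n. F \<subseteq> A n"
  using F
proof (induction F rule: finite_induct)
  case (insert x F)
  then obtain m n where "x \<in> A m" "F \<subseteq> A n" by auto
  moreover have "A m \<subseteq> A (max m n)" "A n \<subseteq> A (max m n)"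
    using lift_Suc_mono_le[of A] mono by auto
  ultimately have "insert x F \<subseteq> A (max m n)" by blast
  thus ?case by blast
qed simp

text \<open>The last conjunct says that on each finite set \<open>f\<close> coincides with an
  approximation from \<open>P\<close>. Any property that is checked on finitely many points thus
  passes from the approximations to \<open>f\<close>.\<close>

lemma back_and_forth:
  fixes P :: "'a set \<Rightarrow> ('a \<Rightarrow> 'b) \<Rightarrow> bool"
  assumes X: "countable X" "X \<noteq> {}" and Y: "countable Y" "Y \<noteq> {}"
    and P: "\<And>A h. P A h \<Longrightarrow> A \<subseteq> X \<and> h ` A \<subseteq> Y \<and> inj_on h A"
    and forth: "\<And>A h x. P A h \<Longrightarrow> x \<in> X \<Longrightarrow> \<exists>A' h'. P A' h' \<and> A \<subseteq> A' \<and> (\<forall>a\<in>A. h' a = h a) \<and> x \<in> A'"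
    and backw: "\<And>A h y. P A h \<Longrightarrow> y \<in> Y \<Longrightarrow> \<exists>A' h'. P A' h' \<and> A \<subseteq> A' \<and> (\<forall>a\<in>A. h' a = h a) \<and> y \<in> h' ` A'"
    and P0: "P A0 h0"
  shows "\<exists>f. bij_betw f X Y \<and> (\<forall>x\<in>A0. f x = h0 x) \<and>
    (\<forall>F. finite F \<and> F \<subseteq> X \<longrightarrow> (\<exists>A h. P A h \<and> F \<subseteq> A \<and> (\<forall>x\<in>A. f x = h x)))"
proof -
  let ?D = "\<lambda>n A h. from_nat_into X n \<in> A \<and> from_nat_into Y n \<in> h ` A"
  have step: "\<exists>A' h'. P A' h' \<and> A \<subseteq> A' \<and> (\<forall>x\<in>A. h' x = h x) \<and> ?D n A' h'" if Ph: "P A h" for n A h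
  proof -
    obtain A1 h1 where 1: "P A1 h1" "A \<subseteq> A1" "\<forall>a\<in>A. h1 a = h a" "from_nat_into X n \<in> A1"
      using forth[OF Ph from_nat_into[OF X(2)]] by blast
    obtain A2 h2 where 2: "P A2 h2" "A1 \<subseteq> A2" "\<forall>a\<in>A1. h2 a = h1 a" "from_nat_into Y n \<in> h2 ` A2"
      using backw[OF 1(1) from_nat_into[OF Y(2)]] by blast
    show ?thesis using 1 2 by (intro exI[of _ A2] exI[of _ h2]) auto
  qed
  obtain A h where Ah: "A 0 = A0" "h 0 = h0" "\<And>n. P (A n) (h n)" "\<And>n. A n \<subseteq> A (Suc n)"
    "\<And>n x. x \<in> A n \<Longrightarrow> h (Suc n) x = h n x"
    "\<And>n. from_nat_into X n \<in> A (Suc n)" "\<And>n. from_nat_into Y n \<in> h (Suc n) ` A (Suc n)"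
    using chain_exists[of P A0 h0 ?D, OF P0 step] by blast
  obtain f where f: "\<And>n x. x \<in> A n \<Longrightarrow> f x = h n x"
    using chain_limit[of A h, OF Ah(4,5)] by blast
  have UA: "(\<Union>n. A n) = X"
  proof (intro equalityI subsetI)
    fix x assume "x \<in> X"
    then obtain n where "x = from_nat_into X n" using subset_range_from_nat_into[OF X(1)] by blast
    thus "x \<in> (\<Union>n. A n)" using Ah(6)[of n] by blast
  qed (use P[OF Ah(3)] in blast)
  have "inj_on f X"
  proof (rule inj_onI)
    fix x y assume "x \<in> X" "y \<in> X" "f x = f y"
    then obtain n where "{x, y} \<subseteq> A n" using finite_subset_chain[of A "{x, y}", OF Ah(4)] UA by auto
    thus "x = y" using P[OF Ah(3), of n] f[of _ n] \<open>f x = f y\<close> by (auto dest: inj_onD)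
  qed
  moreover have "f ` X = Y"
  proof (intro equalityI subsetI)
    fix y assume "y \<in> f ` X"
    then obtain n x where "x \<in> A n" "y = f x" using UA by blast
    thus "y \<in> Y" using P[OF Ah(3), of n] f[of x n] by auto
  next
    fix y assume "y \<in> Y"
    then obtain n where "y = from_nat_into Y n" using subset_range_from_nat_into[OF Y(1)] by auto
    hence "y \<in> f ` A (Suc n)" using Ah(7)[of n] f[of _ "Suc n"] by auto
    thus "y \<in> f ` X" using UA by blast
  qed
  moreover have "\<exists>A h. P A h \<and> F \<subseteq> A \<and> (\<forall>x\<in>A. f x = h x)" if F: "finite F" "F \<subseteq> X" for F
  proof -
    obtain n where "F \<subseteq> A n" using finite_subset_chain[of A F, OF Ah(4)] F UA by auto
    thus ?thesis using Ah(3) f by blast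
  qed
  ultimately show ?thesis using f[of _ 0] Ah(1,2) by (auto simp: bij_betw_def)
qed

context sort_pattern begin

section \<open>Relabelling the sorts, and homogeneity\<close>

definition twist :: "('k \<Rightarrow> 'k) \<Rightarrow> bool" where
  "twist \<pi> \<longleftrightarrow> bij_betw \<pi> V V \<and> (\<forall>v\<in>V. \<forall>u\<in>V. pat (\<pi> v) (\<pi> u) = pat v u)"

lemma twist_id: "twist (\<lambda>v. v)"
  by (simp add: twist_def bij_betw_def)

lemma twist_inv: "twist \<pi> \<Longrightarrow> twist (inv_into V \<pi>)"
proof -
  assume "twist \<pi>"
  hence b: "bij_betw \<pi> V V" and p: "\<And>v u. v \<in> V \<Longrightarrow> u \<in> V \<Longrightarrow> pat (\<pi> v) (\<pi> u) = pat v u"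
    by (auto simp: twist_def)
  have "inv_into V \<pi> v \<in> V \<and> \<pi> (inv_into V \<pi> v) = v" if "v \<in> V" for v
    using b that bij_betw_inv_into_right[OF b that] bij_betwE[OF bij_betw_inv_into[OF b]] by blast
  thus ?thesis using p bij_betw_inv_into[OF b] unfolding twist_def by metis
qed

lemma allowed_twist:
  assumes \<pi>: "twist \<pi>" and S: "s ` S \<subseteq> V"
  shows "allowed (\<lambda>x. \<pi> (s x)) t S = allowed s t S"
proof -
  have b: "bij_betw \<pi> V V" and p: "\<And>v u. v \<in> V \<Longrightarrow> u \<in> V \<Longrightarrow> pat (\<pi> v) (\<pi> u) = pat v u"
    using \<pi> by (auto simp: twist_def)
  have V: "\<pi> ` V = V" using b by (simp add: bij_betw_def)
  have c: "{x\<in>S. \<pi> (s x) = \<pi> u} = {x\<in>S. s x = u}" if "u \<in> V" for u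
    using S that inj_on_eq_iff[OF bij_betw_imp_inj_on[OF b]] by blast
  have "(\<forall>u\<in>V. card {x\<in>S. \<pi> (s x) = u} = pat (\<pi> (s t)) u) \<longleftrightarrow> (\<forall>u\<in>V. card {x\<in>S. \<pi> (s x) = \<pi> u} = pat (\<pi> (s t)) (\<pi> u))"
    by (subst (1) V[symmetric]) (simp only: ball_simps)
  also have "\<dots> \<longleftrightarrow> (\<forall>u\<in>V. card {x\<in>S. s x = u} = pat (s t) u)" if "t \<in> S"
    using c p S that by (simp add: image_subset_iff)
  finally have "t \<in> S \<Longrightarrow> ?thesis" using S V by (auto simp: allowed_def)
  thus ?thesis by (auto simp: allowed_def)
qed

lemma valid_twist:
  assumes \<pi>: "twist \<pi>" and v: "valid B s Q"
  shows "valid B (\<lambda>x. \<pi> (s x)) Q"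
proof -
  have "allowed (\<lambda>x. \<pi> (s x)) t S = allowed s t S" if "S \<subseteq> B" for t S
    using v that by (intro allowed_twist[OF \<pi>]) (auto simp: valid_def)
  moreover have "\<pi> ` V = V" using \<pi> by (simp add: twist_def bij_betw_def)
  moreover have "\<pi> (s x) \<in> V" if "x \<in> B" for x using valid_sort[OF v that] calculation(2) by blast
  ultimately show ?thesis using valid_allowed[OF v] valid_even[OF v] unfolding valid_def by auto
qed

lemma emb_untwist:
  assumes \<pi>: "twist \<pi>" and e: "emb h A s Q (\<lambda>x. inv_into V \<pi> (s' x)) Q'" and V: "s' ` h ` A \<subseteq> V"
  shows "emb h A (\<lambda>x. \<pi> (s x)) Q s' Q'"
proof -
  have "\<pi> (s x) = s' (h x)" if "x \<in> A" for x
    using emb_sort[OF e that] V \<pi> that by (metis (no_types, lifting) bij_betw_inv_into_right imageI subset_iff twist_def)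
  thus ?thesis using e by (auto simp: emb_def)
qed

lemma emb_twist:
  assumes \<pi>: "twist \<pi>" and e: "emb h A s Q (\<lambda>x. \<pi> (s' x)) Q'" and V: "s' ` h ` A \<subseteq> V"
  shows "emb h A (\<lambda>x. inv_into V \<pi> (s x)) Q s' Q'"
proof -
  have "inv_into V \<pi> (s x) = s' (h x)" if "x \<in> A" for x
    using emb_sort[OF e that] V \<pi> that by (metis (no_types, lifting) bij_betw_inv_into_left imageI subset_iff twist_def)
  thus ?thesis using e by (auto simp: emb_def)
qed

text \<open>Relabelling by a symmetry of the pattern keeps a structure valid, so finite pieces of
  the relabelled structure extend into the original one as before. With \<pi> the identity this is
  homogeneity; the other \<pi> yield the permutations behind the outer automorphisms.\<close>

lemma twisted_homogeneity:
  assumes \<pi>: "twist \<pi>" and A: "finite A" and h: "emb h A (\<lambda>x. \<pi> (srt x)) R srt R"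
  shows "\<exists>f. bij f \<and> emb f UNIV (\<lambda>x. \<pi> (srt x)) R srt R \<and> (\<forall>x\<in>A. f x = h x)"
proof -
  let ?P = "\<lambda>A h. finite A \<and> emb h A (\<lambda>x. \<pi> (srt x)) R srt R"
  have srt_V: "srt ` B \<subseteq> V" for B using srt_in by blast
  have "\<exists>f. bij_betw f UNIV UNIV \<and> (\<forall>x\<in>A. f x = h x) \<and>
    (\<forall>F. finite F \<and> F \<subseteq> UNIV \<longrightarrow> (\<exists>A h. ?P A h \<and> F \<subseteq> A \<and> (\<forall>x\<in>A. f x = h x)))"
  proof (rule back_and_forth)
    show "?P A h" using A h by simp
    show "A \<subseteq> UNIV \<and> h ` A \<subseteq> UNIV \<and> inj_on h A" if "?P A h" for A h
      using that emb_inj by auto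
    show "\<exists>A' h'. ?P A' h' \<and> A \<subseteq> A' \<and> (\<forall>a\<in>A. h' a = h a) \<and> x \<in> A'" if Ph: "?P A h" for A h x
    proof -
      obtain e where "emb e (insert x A) (\<lambda>x. \<pi> (srt x)) R srt R" "\<forall>a\<in>A. e a = h a"
        using extension[of "insert x A" A "\<lambda>x. \<pi> (srt x)" R h "{}"] Ph
          valid_subset[OF valid_twist[OF \<pi> valid_M], of "insert x A"] by auto
      thus ?thesis using Ph by (intro exI[of _ "insert x A"] exI[of _ e]) auto
    qed
    \<comment> \<open>Only domains can be enlarged. To reach \<open>y\<close> in the range, the
      inverse is extended instead; it embeds for the inverse relabelling.\<close>
    show "\<exists>A' h'. ?P A' h' \<and> A \<subseteq> A' \<and> (\<forall>a\<in>A. h' a = h a) \<and> y \<in> h' ` A'" if Ph: "?P A h" for A h y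
    proof -
      let ?g = "inv_into A h" and ?\<rho> = "inv_into V \<pi>"
      have \<rho>: "twist ?\<rho>" by (rule twist_inv[OF \<pi>])
      have "emb ?g (h ` A) srt R (\<lambda>x. \<pi> (srt x)) R" using Ph emb_inv_into by blast
      hence g: "emb ?g (h ` A) (\<lambda>x. ?\<rho> (srt x)) R srt R"
        using emb_twist[OF \<pi>] srt_V by blast
      define B where "B = insert y (h ` A)"
      obtain e where e: "emb e B (\<lambda>x. ?\<rho> (srt x)) R srt R" "\<forall>b\<in>h ` A. e b = ?g b"
        using extension[of B "h ` A" "\<lambda>x. ?\<rho> (srt x)" R ?g "{}"] Ph g
          valid_subset[OF valid_twist[OF \<rho> valid_M], of B] unfolding B_def by auto
      have i: "emb (inv_into B e) (e ` B) (\<lambda>x. \<pi> (srt x)) R srt R"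
        using emb_untwist[OF \<pi> emb_inv_into[OF e(1)]] srt_V by blast
      have hA: "e (h a) = a" if "a \<in> A" for a
        using e(2) that Ph emb_inj inv_into_f_f by fastforce
      have "inv_into B e a = h a" if "a \<in> A" for a
        using hA[OF that] inv_into_f_f[OF emb_inj[OF e(1)], of "h a"] that unfolding B_def by simp
      moreover have "A \<subseteq> e ` B" using hA unfolding B_def by force
      moreover have "y \<in> inv_into B e ` e ` B"
        using inv_into_f_f[OF emb_inj[OF e(1)], of y] unfolding B_def by force
      ultimately show ?thesis using i Ph unfolding B_def
        by (intro exI[of _ "e ` insert y (h ` A)"] exI[of _ "inv_into (insert y (h ` A)) e"]) auto
    qed
  qed auto
  then obtain f where f: "bij f" "\<forall>x\<in>A. f x = h x"
    "\<And>F. finite F \<Longrightarrow> \<exists>A h. ?P A h \<and> F \<subseteq> A \<and> (\<forall>x\<in>A. f x = h x)" by auto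
  have "emb f UNIV (\<lambda>x. \<pi> (srt x)) R srt R"
  proof (rule embI)
    show "inj f" using f(1) by (rule bij_is_inj)
    have loc: "emb f F (\<lambda>x. \<pi> (srt x)) R srt R" if "finite F" for F
      using f(3)[OF that] emb_subset emb_cong by (metis (no_types, lifting))
    show "srt (f x) = \<pi> (srt x)" for x using emb_sort[OF loc[of "{x}"]] by simp
    show "R (f t) (f ` S) = R t S" if "finite S" "t \<in> S" for S t
      using emb_rel[OF loc[OF that(1)] that(1) _ that(2)] by simp
  qed
  thus ?thesis using f by blast
qed

section \<open>The automorphism group as a closed group of permutations\<close>

abbreviation ginv :: "(nat \<Rightarrow> nat) \<Rightarrow> nat \<Rightarrow> nat" where
  "ginv g \<equiv> inv_into UNIV g"

definition Gr :: "(nat \<Rightarrow> nat) set" where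
  "Gr = {g. bij g \<and> emb g UNIV srt R srt R}"

lemma homogeneity:
  assumes "finite A" "emb h A srt R srt R"
  shows "\<exists>g\<in>Gr. \<forall>x\<in>A. g x = h x"
  using twisted_homogeneity[OF twist_id assms] by (auto simp: Gr_def)

lemma Gr_bij: "g \<in> Gr \<Longrightarrow> bij g"
  by (simp add: Gr_def)

lemma Gr_inj: "g \<in> Gr \<Longrightarrow> inj_on g A"
  by (auto simp: Gr_def intro: inj_on_subset bij_is_inj)

lemma Gr_emb: "g \<in> Gr \<Longrightarrow> emb g A srt R srt R"
  by (auto simp: Gr_def intro: emb_subset)

lemma Gr_srt: "g \<in> Gr \<Longrightarrow> srt (g x) = srt x"
  using emb_sort[OF Gr_emb[of g UNIV]] by simp

lemma Gr_R: "g \<in> Gr \<Longrightarrow> R (g t) (g ` S) = R t S"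
proof -
  assume g: "g \<in> Gr"
  show ?thesis
  proof (cases "finite S \<and> t \<in> S")
    case True
    thus ?thesis using emb_rel[OF Gr_emb[OF g, of UNIV]] by blast
  next
    case False
    hence "\<not> (finite (g ` S) \<and> g t \<in> g ` S)"
      using finite_image_iff[OF Gr_inj[OF g, of S]] Gr_inj[OF g, of UNIV] by (auto dest: injD)
    thus ?thesis using False allowed_M[of t S] allowed_M[of "g t" "g ` S"] by (auto simp: allowed_def)
  qed
qed

lemma Gr_id: "(\<lambda>x. x) \<in> Gr"
  using bij_id by (simp add: Gr_def emb_id id_def)

lemma Gr_comp: "g \<in> Gr \<Longrightarrow> h \<in> Gr \<Longrightarrow> (\<lambda>x. g (h x)) \<in> Gr"
  using emb_trans[of h UNIV srt R srt R g UNIV srt R] bij_comp[of h g]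
  by (auto simp: Gr_def comp_def)

lemma Gr_inv: "g \<in> Gr \<Longrightarrow> ginv g \<in> Gr"
  using emb_inv_into[of g UNIV srt R srt R] by (auto simp: Gr_def bij_imp_bij_inv bij_is_surj)

lemma Gr_inv_f [simp]: "g \<in> Gr \<Longrightarrow> ginv g (g x) = x"
  by (simp add: Gr_bij bij_is_inj)

lemma Gr_f_inv [simp]: "g \<in> Gr \<Longrightarrow> g (ginv g x) = x"
  by (simp add: Gr_bij bij_is_surj surj_f_inv_f)

text \<open>\<open>Gr\<close> is closed among the permutations for pointwise convergence, since
  sorts and relations concern finitely many points at a time.\<close>

lemma Gr_local:
  assumes "bij f" "\<And>F. finite F \<Longrightarrow> \<exists>g\<in>Gr. \<forall>x\<in>F. f x = g x"
  shows "f \<in> Gr"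
proof -
  have loc: "emb f F srt R srt R" if fin: "finite F" for F
  proof -
    obtain g where "g \<in> Gr" "\<forall>x\<in>F. f x = g x" using assms(2)[OF fin] by blast
    thus ?thesis using Gr_emb[of g F] emb_cong[of F f g] by blast
  qed
  have "emb f UNIV srt R srt R"
  proof (rule embI)
    show "inj f" using assms(1) by (rule bij_is_inj)
    show "srt (f x) = srt x" for x using emb_sort[OF loc[of "{x}"]] by simp
    show "R (f t) (f ` S) = R t S" if "finite S" "t \<in> S" for S t
      using emb_rel[OF loc[OF that(1)] that(1) _ that(2)] by simp
  qed
  thus ?thesis using assms(1) by (simp add: Gr_def)
qed

lemma valid_empty: "s ` P \<subseteq> V \<Longrightarrow> valid P s (\<lambda>t S. False)"
  by (simp add: valid_def)

text \<open>The means to build free amalgams block by block. Parity is kept because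
  \<open>\<phi>\<close> is a bijection between the points chosen on both sides. Nothing has to agree
  on overlaps of blocks for validity; agreement matters only when the blocks are to be
  embedded.\<close>

lemma valid_glue:
  assumes v: "valid P s Q" and \<phi>: "inj_on \<phi> B" "\<And>x. x \<in> B \<Longrightarrow> srt (\<phi> x) = s x"
  shows "valid P s (\<lambda>t S. if S \<subseteq> B then t \<in> S \<and> R (\<phi> t) (\<phi> ` S) else Q t S)"
  unfolding valid_def
proof (intro conjI allI impI)
  show "s ` P \<subseteq> V" using v by (simp add: valid_def)
  fix S assume S: "finite S \<and> S \<subseteq> P"
  show "allowed s t S" if "if S \<subseteq> B then t \<in> S \<and> R (\<phi> t) (\<phi> ` S) else Q t S" for t
  proof (cases "S \<subseteq> B")
    case True
    hence "allowed srt (\<phi> t) (\<phi> ` S) = allowed s t S"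
      using S that \<phi> by (intro allowed_image) (auto intro: inj_on_subset)
    thus ?thesis using True that allowed_M by auto
  next
    case False
    thus ?thesis using that S valid_allowed[OF v] by auto
  qed
  show "even (card {t. if S \<subseteq> B then t \<in> S \<and> R (\<phi> t) (\<phi> ` S) else Q t S})"
  proof (cases "S \<subseteq> B")
    case True
    have "{t. R t (\<phi> ` S)} = \<phi> ` {t. t \<in> S \<and> R (\<phi> t) (\<phi> ` S)}" using R_mem by auto
    moreover have "inj_on \<phi> {t. t \<in> S \<and> R (\<phi> t) (\<phi> ` S)}" using \<phi>(1) True by (auto intro: inj_on_subset)
    ultimately have "card {t. R t (\<phi> ` S)} = card {t. t \<in> S \<and> R (\<phi> t) (\<phi> ` S)}" by (simp add: card_image)
    thus ?thesis using True valid_even[OF valid_M, of "\<phi> ` S"] S by simp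
  next
    case False
    thus ?thesis using S valid_even[OF v] by simp
  qed
qed

end

section \<open>Extending partial automorphisms\<close>

lemma odd_card_neq:
  assumes "finite S"
  shows "odd (card {x\<in>S. a x \<noteq> b x}) \<longleftrightarrow> odd (card {x\<in>S. a x}) \<noteq> odd (card {x\<in>S. b x})"
  using assms
proof (induction S rule: finite_induct)
  case (insert y S)
  have c: "card {x \<in> insert y S. r x} = (if r y then Suc (card {x\<in>S. r x}) else card {x\<in>S. r x})" for r
  proof -
    have "{x \<in> insert y S. r x} = (if r y then insert y {x\<in>S. r x} else {x\<in>S. r x})" by auto
    thus ?thesis using insert.hyps by simp
  qed
  show ?case unfolding c using insert.IH by auto
qed simp

text \<open>Double counting of incidences. In terms of vectors modulo two, a sum of vectors of even
  weight has even weight.\<close>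

lemma even_card_odd_fibres:
  assumes fin: "finite T" "finite Y" and even: "\<And>y. y \<in> Y \<Longrightarrow> even (card {t\<in>T. r t y})"
  shows "even (card {t\<in>T. odd (card {y\<in>Y. r t y})})"
proof -
  have "(\<Sum>t\<in>T. card {y\<in>Y. r t y}) = (\<Sum>t\<in>T. \<Sum>y\<in>Y. if r t y then 1 else 0)"
    using fin by (simp add: sum.If_cases Int_def)
  also have "\<dots> = (\<Sum>y\<in>Y. \<Sum>t\<in>T. if r t y then 1 else 0)" by (rule sum.swap)
  also have "\<dots> = (\<Sum>y\<in>Y. card {t\<in>T. r t y})"
    using fin by (simp add: sum.If_cases Int_def)
  finally have "(\<Sum>t\<in>T. card {y\<in>Y. r t y}) = (\<Sum>y\<in>Y. card {t\<in>T. r t y})" .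
  moreover have "even (\<Sum>y\<in>Y. card {t\<in>T. r t y})" using even by (rule dvd_sum)
  ultimately show ?thesis using even_sum_iff[OF fin(1), of "\<lambda>t. card {y\<in>Y. r t y}"] by simp
qed

lemma extend_to_permutation:
  assumes A: "finite A" and D: "D \<subseteq> A" "inj_on p D" "p ` D \<subseteq> A" "\<And>d. d \<in> D \<Longrightarrow> s (p d) = s d"
  shows "\<exists>q. bij_betw q A A \<and> (\<forall>d\<in>D. q d = p d) \<and> (\<forall>x\<in>A. s (q x) = s x)"
  using D
proof (induction "card (A - D)" arbitrary: D p)
  case 0
  hence "D = A" using A by auto
  moreover have "bij_betw p A A"
    using endo_inj_surj[OF A] 0(3,4) unfolding \<open>D = A\<close> bij_betw_def by blast
  ultimately show ?case using 0 by blast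
next
  case (Suc n)
  then obtain a where a: "a \<in> A" "a \<notin> D" by (metis Diff_iff card.empty ex_in_conv nat.distinct(1))
  have "{x\<in>D. s x = s a} \<subset> {x\<in>A. s x = s a}" using a Suc.prems(1) by auto
  hence "card {x\<in>D. s x = s a} < card {x\<in>A. s x = s a}" using A by (intro psubset_card_mono) auto
  moreover have "card (p ` {x\<in>D. s x = s a}) = card {x\<in>D. s x = s a}"
    using Suc.prems(2) by (intro card_image) (auto intro: inj_on_subset)
  moreover have "finite D" using Suc.prems(1) A by (rule finite_subset)
  ultimately have "\<not> {x\<in>A. s x = s a} \<subseteq> p ` {x\<in>D. s x = s a}"
    using card_mono[of "p ` {x\<in>D. s x = s a}" "{x\<in>A. s x = s a}"] by auto
  then obtain b where b: "b \<in> A" "s b = s a" "b \<notin> p ` {x\<in>D. s x = s a}" by blast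
  have b': "b \<notin> p ` D" using b Suc.prems(4) by auto
  have "A - insert a D = (A - D) - {a}" by auto
  hence "n = card (A - insert a D)" using Suc.hyps(2) a A by simp
  moreover have "inj_on (p(a := b)) (insert a D)"
    using Suc.prems(2) b' a by (auto simp: inj_on_def)
  moreover have "(p(a := b)) ` insert a D \<subseteq> A" using Suc.prems(3) b a by auto
  moreover have "s ((p(a := b)) d) = s d" if "d \<in> insert a D" for d using that Suc.prems(4) b by auto
  ultimately obtain q where "bij_betw q A A" "\<forall>d\<in>insert a D. q d = (p(a := b)) d" "\<forall>x\<in>A. s (q x) = s x"
    using Suc.hyps(1)[of "insert a D" "p(a := b)"] Suc.prems(1) a by auto
  thus ?case using a by (intro exI[of _ q]) auto
qed

context sort_pattern begin

text \<open>The extension property for partial automorphisms, by the valuation construction: a point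
  \<open>(x, \<chi>)\<close> of the larger structure carries a vote on every possible relation \<open>(t, S)\<close> with
  \<open>x \<in> S\<close>, and the relation holds iff the number of votes in favour is odd.  A partial isomorphism
  is extended by permuting the first coordinates and correcting the votes; as long as \<open>S\<close> has a
  point outside the domain, that point absorbs the necessary corrections.\<close>

lemma extension_property_partial_automorphisms:
  assumes A: "finite A"
  shows "\<exists>(P :: (nat \<times> (nat \<times> nat set) set) set) s' Q' \<psi>.
    finite P \<and> valid P s' Q' \<and> emb \<psi> A srt R s' Q' \<and> \<psi> ` A \<subseteq> P \<and>
    (\<forall>D p. D \<subseteq> A \<and> emb p D srt R srt R \<and> p ` D \<subseteq> A \<longrightarrow>
       (\<exists>\<theta>. emb \<theta> P s' Q' s' Q' \<and> \<theta> ` P = P \<and> (\<forall>d\<in>D. \<theta> (\<psi> d) = \<psi> (p d))))"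
proof -
  have fS: "finite S" if "S \<subseteq> A" for S using A that by (rule rev_finite_subset)
  \<comment> \<open>The votes open to a point with first coordinate \<open>x\<close>: only allowed
    relations on sets through \<open>x\<close>, and an even number of them on each set, so that sums
    of votes stay even.\<close>
  define W where "W x = {c. c \<subseteq> {(t, S). S \<subseteq> A \<and> x \<in> S \<and> allowed srt t S} \<and> (\<forall>S. even (card {t. (t, S) \<in> c}))}" for x
  define P where "P = Sigma A W"
  define s' where "s' = (\<lambda>y :: nat \<times> (nat \<times> nat set) set. srt (fst y))"
  \<comment> \<open>Only sets that meet each fibre of \<open>fst\<close> at most once carry
    relations; the votes of their points are added modulo two.\<close>
  define Q' where "Q' = (\<lambda>(y :: nat \<times> (nat \<times> nat set) set) Y. y \<in> Y \<and> inj_on fst Y \<and> allowed srt (fst y) (fst ` Y) \<and>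
      odd (card {z\<in>Y. (fst y, fst ` Y) \<in> snd z}))"
  \<comment> \<open>In the copy of \<open>A\<close> the point \<open>Min S\<close> alone votes for
    the relations that hold on \<open>S\<close>, so that exactly one vote is cast for each of
    them.\<close>
  define \<chi> where "\<chi> x = {(t, S). S \<subseteq> A \<and> x \<in> S \<and> x = Min S \<and> R t S}" for x
  define \<psi> where "\<psi> x = (x, \<chi> x)" for x
  have WD: "S \<subseteq> A" "x \<in> S" "allowed srt t S" "t \<in> S" if "(t, S) \<in> c" "c \<in> W x" for t S c x
    using that allowed_mem[of srt t S] by (auto simp: W_def)
  have WE: "even (card {t. (t, S) \<in> c})" if "c \<in> W x" for S c x using that by (auto simp: W_def)
  have finP: "finite P"
  proof (rule finite_subset)
    show "P \<subseteq> A \<times> Pow (A \<times> Pow A)" using WD unfolding P_def by fast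
    show "finite (A \<times> Pow (A \<times> Pow A))" using A by simp
  qed
  have \<chi>W: "\<chi> x \<in> W x" for x
  proof -
    have "even (card {t. (t, S) \<in> \<chi> x})" for S
    proof (cases "S \<subseteq> A \<and> x \<in> S \<and> x = Min S")
      case True
      hence "{t. (t, S) \<in> \<chi> x} = {t. R t S}" by (auto simp: \<chi>_def)
      thus ?thesis using valid_even[OF valid_M, of S] fS True by simp
    next
      case False
      hence "{t. (t, S) \<in> \<chi> x} = {}" by (auto simp: \<chi>_def)
      thus ?thesis by simp
    qed
    thus ?thesis using allowed_M by (auto simp: W_def \<chi>_def)
  qed
  have valP: "valid P s' Q'"
    unfolding valid_def
  proof (intro conjI allI impI)
    show "s' ` P \<subseteq> V" using srt_in by (auto simp: s'_def)
    fix Y assume Y: "finite Y \<and> Y \<subseteq> P"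
    show "allowed s' y Y" if "Q' y Y" for y
      using that Y allowed_image[of fst Y srt s' y] by (auto simp: Q'_def s'_def)
    show "even (card {y. Q' y Y})"
    proof (cases "inj_on fst Y")
      case False
      thus ?thesis by (simp add: Q'_def)
    next
      case True
      let ?S = "fst ` Y"
      have YD: "snd z \<in> W (fst z)" if "z \<in> Y" for z using that Y by (auto simp: P_def)
      have "fst ` {y. Q' y Y} = {t\<in>?S. odd (card {z\<in>Y. (t, ?S) \<in> snd z})}"
      proof (intro equalityI subsetI)
        fix t assume t: "t \<in> {t\<in>?S. odd (card {z\<in>Y. (t, ?S) \<in> snd z})}"
        hence "odd (card {z\<in>Y. (t, ?S) \<in> snd z})" by simp
        then obtain z where "z \<in> Y" "(t, ?S) \<in> snd z" using odd_card_imp_not_empty by blast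
        hence "allowed srt t ?S" using WD(3) YD by blast
        thus "t \<in> fst ` {y. Q' y Y}" using t True by (auto simp: Q'_def)
      qed (auto simp: Q'_def)
      moreover have "even (card {t\<in>?S. odd (card {z\<in>Y. (t, ?S) \<in> snd z})})"
      proof (rule even_card_odd_fibres)
        fix z assume z: "z \<in> Y"
        have "{t\<in>?S. (t, ?S) \<in> snd z} = {t. (t, ?S) \<in> snd z}" using WD(4) YD[OF z] by blast
        thus "even (card {t\<in>?S. (t, ?S) \<in> snd z})" using WE[OF YD[OF z]] by simp
      qed (use Y in auto)
      moreover have "inj_on fst {y. Q' y Y}" using True by (auto simp: Q'_def inj_on_def)
      ultimately show ?thesis by (metis card_image)
    qed
  qed
  have \<psi>P: "\<psi> ` A \<subseteq> P" using \<chi>W by (auto simp: P_def \<psi>_def)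
  have \<psi>emb: "emb \<psi> A srt R s' Q'"
  proof (rule embI)
    show "inj_on \<psi> A" by (auto simp: \<psi>_def inj_on_def)
    show "s' (\<psi> x) = srt x" for x by (simp add: s'_def \<psi>_def)
    fix S t assume S: "finite S" "S \<subseteq> A" "t \<in> S"
    have im: "fst ` \<psi> ` S = S" by (force simp: \<psi>_def)
    have "Min S \<in> S" using S by (intro Min_in) auto
    hence "{z \<in> \<psi> ` S. (t, S) \<in> snd z} = (if R t S then {\<psi> (Min S)} else {})"
      using S(2) by (auto simp: \<psi>_def \<chi>_def)
    thus "Q' (\<psi> t) (\<psi> ` S) = R t S"
      using S allowed_M[of t S] unfolding Q'_def im by (auto simp: \<psi>_def inj_on_def)
  qed
  have ext: "\<exists>\<theta>. emb \<theta> P s' Q' s' Q' \<and> \<theta> ` P = P \<and> (\<forall>d\<in>D. \<theta> (\<psi> d) = \<psi> (p d))"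
    if D: "D \<subseteq> A" "emb p D srt R srt R" "p ` D \<subseteq> A" for D p
  proof -
    obtain q where q: "bij_betw q A A" "\<And>d. d \<in> D \<Longrightarrow> q d = p d" "\<And>x. x \<in> A \<Longrightarrow> srt (q x) = srt x"
      using extend_to_permutation[of A D p srt] A D emb_inj emb_sort by metis
    have qi: "inj_on q A" and qA: "q ` A = A" using q(1) by (auto simp: bij_betw_def)
    define U where "U = {(t, S). S \<subseteq> A \<and> t \<in> S}"
    define \<kappa> where "\<kappa> = (\<lambda>(t, S). (q t, q ` S))"
    have \<kappa>inj: "inj_on \<kappa> U"
    proof (rule inj_onI)
      fix u u' assume u: "u \<in> U" "u' \<in> U" "\<kappa> u = \<kappa> u'"
      obtain t S t' S' where tS: "u = (t, S)" "u' = (t', S')" by (meson surj_pair)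
      hence "t \<in> A" "t' \<in> A" "S \<subseteq> A" "S' \<subseteq> A" using u by (auto simp: U_def)
      thus "u = u'" using u(3) inj_on_image_eq_iff[OF qi] inj_on_eq_iff[OF qi] unfolding tS \<kappa>_def by auto
    qed
    have finU: "finite U"
      by (rule finite_subset[of _ "A \<times> Pow A"]) (use A in \<open>auto simp: U_def\<close>)
    have \<kappa>U: "\<kappa> ` U = U"
    proof (rule endo_inj_surj[OF finU _ \<kappa>inj])
      show "\<kappa> ` U \<subseteq> U" using qA by (auto simp: U_def \<kappa>_def)
    qed
    have allq: "allowed srt (q t) (q ` S) = allowed srt t S" if "S \<subseteq> A" "t \<in> S" for t S
      using that q(3) fS by (intro allowed_image) (auto intro: inj_on_subset[OF qi])
    have WU: "c \<subseteq> U" if "c \<in> W x" for c x using WD that by (fastforce simp: U_def)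
    \<comment> \<open>The correction forced at a point \<open>x\<close> of \<open>D\<close> by the
      demand that \<open>\<psi> x\<close> goes to \<open>\<psi> (p x)\<close>.\<close>
    define \<delta> where "\<delta> x = {(t, S). S \<subseteq> A \<and> x \<in> S \<and> t \<in> S \<and> ((t, S) \<in> \<chi> x) \<noteq> ((q t, q ` S) \<in> \<chi> (q x))}" for x
    \<comment> \<open>Outside \<open>D\<close> only the least point of \<open>S - D\<close>
      corrects, by the parity of all forced corrections on \<open>S\<close>. The corrections then
      cancel on every set that is not contained in \<open>D\<close>.\<close>
    define \<beta> where "\<beta> x = (if x \<in> D then \<delta> x else
        {(t, S). S \<subseteq> A \<and> x \<in> S \<and> t \<in> S \<and> x = Min (S - D) \<and> odd (card {z\<in>S \<inter> D. (t, S) \<in> \<delta> z})})" for x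
    have \<delta>W: "\<delta> x \<in> W x" if x: "x \<in> A" for x
    proof -
      have "even (card {t. (t, S) \<in> \<delta> x})" for S
      proof (cases "S \<subseteq> A \<and> x \<in> S")
        case True
        hence dset: "{t. (t, S) \<in> \<delta> x} = {t\<in>S. ((t, S) \<in> \<chi> x) \<noteq> ((q t, q ` S) \<in> \<chi> (q x))}" by (auto simp: \<delta>_def)
        have "{t\<in>S. (t, S) \<in> \<chi> x} = {t. (t, S) \<in> \<chi> x}" using WD(4)[OF _ \<chi>W] by auto
        hence even1: "even (card {t\<in>S. (t, S) \<in> \<chi> x})" using WE[OF \<chi>W] by simp
        have im: "q ` {t\<in>S. (q t, q ` S) \<in> \<chi> (q x)} = {t. (t, q ` S) \<in> \<chi> (q x)}"
        proof (intro equalityI subsetI)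
          fix t assume t: "t \<in> {t. (t, q ` S) \<in> \<chi> (q x)}"
          hence "t \<in> q ` S" using WD(4)[OF _ \<chi>W] by blast
          thus "t \<in> q ` {t\<in>S. (q t, q ` S) \<in> \<chi> (q x)}" using t by auto
        qed auto
        have "inj_on q {t\<in>S. (q t, q ` S) \<in> \<chi> (q x)}" using True by (auto intro: inj_on_subset[OF qi])
        from card_image[OF this] have even2: "even (card {t\<in>S. (q t, q ` S) \<in> \<chi> (q x)})"
          unfolding im using WE[OF \<chi>W, of "q ` S" "q x"] by simp
        with even1 even2 show ?thesis
          unfolding dset
          using odd_card_neq[of S "\<lambda>t. (t, S) \<in> \<chi> x" "\<lambda>t. (q t, q ` S) \<in> \<chi> (q x)"] True fS by blast
      next
        case False
        hence "{t. (t, S) \<in> \<delta> x} = {}" by (auto simp: \<delta>_def)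
        thus ?thesis by simp
      qed
      moreover have "allowed srt t S" if "(t, S) \<in> \<delta> x" for t S
      proof -
        have "S \<subseteq> A" "t \<in> S" "(t, S) \<in> \<chi> x \<or> (q t, q ` S) \<in> \<chi> (q x)" using that by (auto simp: \<delta>_def)
        thus ?thesis using WD(3)[OF _ \<chi>W] allq by metis
      qed
      ultimately show ?thesis unfolding W_def by (auto simp: \<delta>_def)
    qed
    have \<beta>W: "\<beta> x \<in> W x" if x: "x \<in> A" for x
    proof (cases "x \<in> D")
      case True
      thus ?thesis using \<delta>W x by (simp add: \<beta>_def)
    next
      case False
      have "even (card {t. (t, S) \<in> \<beta> x})" for S
      proof (cases "S \<subseteq> A \<and> x \<in> S \<and> x = Min (S - D)")
        case True
        hence "{t. (t, S) \<in> \<beta> x} = {t\<in>S. odd (card {z\<in>S \<inter> D. (t, S) \<in> \<delta> z})}" using False by (auto simp: \<beta>_def)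
        moreover have "even (card {t\<in>S. odd (card {z\<in>S \<inter> D. (t, S) \<in> \<delta> z})})"
        proof (rule even_card_odd_fibres)
          fix z assume z: "z \<in> S \<inter> D"
          hence "{t\<in>S. (t, S) \<in> \<delta> z} = {t. (t, S) \<in> \<delta> z}" using WD(4)[OF _ \<delta>W] True by blast
          thus "even (card {t\<in>S. (t, S) \<in> \<delta> z})" using WE[OF \<delta>W] z True by auto
        qed (use True fS in auto)
        ultimately show ?thesis by simp
      next
        case *: False
        hence "{t. (t, S) \<in> \<beta> x} = {}" using False by (auto simp: \<beta>_def)
        thus ?thesis by simp
      qed
      moreover have "allowed srt t S" if h: "(t, S) \<in> \<beta> x" for t S
      proof -
        have "odd (card {z\<in>S \<inter> D. (t, S) \<in> \<delta> z})" using h False by (simp add: \<beta>_def)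
        then obtain z where "z \<in> S \<inter> D" "(t, S) \<in> \<delta> z" using odd_card_imp_not_empty by blast
        thus ?thesis using WD(3)[OF _ \<delta>W] D(1) by blast
      qed
      ultimately show ?thesis using False unfolding W_def by (auto simp: \<beta>_def)
    qed
    \<comment> \<open>This is why \<open>\<theta>\<close> will preserve \<open>Q'\<close>. A set
      contained in \<open>D\<close> has no free point, and there the corrections cancel because
      \<open>p\<close> preserves \<open>R\<close>: before and after the move one vote is cast in the
      same cases.\<close>
    have \<beta>sum: "even (card {x\<in>S. (t, S) \<in> \<beta> x})" if S: "S \<subseteq> A" "t \<in> S" for t S
    proof (cases "S \<subseteq> D")
      case True
      have "{x\<in>S. (t, S) \<in> \<beta> x} = {x\<in>S. ((t, S) \<in> \<chi> x) \<noteq> ((q t, q ` S) \<in> \<chi> (q x))}"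
        using True S by (auto simp: \<beta>_def \<delta>_def)
      moreover have "Min S \<in> S" using S fS[OF S(1)] by (intro Min_in) auto
      hence "{x\<in>S. (t, S) \<in> \<chi> x} = (if R t S then {Min S} else {})"
        using S by (auto simp: \<chi>_def)
      moreover have "card {x\<in>S. (q t, q ` S) \<in> \<chi> (q x)} = (if R t S then 1 else 0)"
      proof -
        have qp: "q ` S = p ` S" "q t = p t" using True S q(2) by (force intro!: image_cong, blast)
        have Req: "R (q t) (q ` S) = R t S" unfolding qp using emb_rel[OF D(2) fS[OF S(1)] True S(2)] .
        have "Min (q ` S) \<in> q ` S" using S fS[OF S(1)] by (intro Min_in) auto
        moreover have "q ` S \<subseteq> A" using S(1) qA by blast
        ultimately have "q ` {x\<in>S. (q t, q ` S) \<in> \<chi> (q x)} = (if R t S then {Min (q ` S)} else {})"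
          using Req by (auto simp: \<chi>_def)
        moreover have "inj_on q {x\<in>S. (q t, q ` S) \<in> \<chi> (q x)}" using S by (auto intro: inj_on_subset[OF qi])
        ultimately show ?thesis by (metis (no_types, lifting) card_image card.empty card_1_singleton_iff One_nat_def)
      qed
      ultimately show ?thesis
        using odd_card_neq[of S "\<lambda>x. (t, S) \<in> \<chi> x" "\<lambda>x. (q t, q ` S) \<in> \<chi> (q x)"] fS[OF S(1)] by (auto split: if_splits)
    next
      case False
      let ?o = "odd (card {z\<in>S \<inter> D. (t, S) \<in> \<delta> z})" and ?m = "Min (S - D)"
      have m: "?m \<in> S - D" using fS[OF S(1)] False by (intro Min_in) auto
      have "{x\<in>S. (t, S) \<in> \<beta> x} = {z\<in>S \<inter> D. (t, S) \<in> \<delta> z} \<union> (if ?o then {?m} else {})"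
        using S m by (auto simp: \<beta>_def)
      moreover have "{z\<in>S \<inter> D. (t, S) \<in> \<delta> z} \<inter> (if ?o then {?m} else {}) = {}" using m by auto
      ultimately show ?thesis using fS[OF S(1)] by (simp add: card_Un_disjoint)
    qed
    \<comment> \<open>The votes are translated by the correction \<open>\<beta> x\<close> and then
      carried along \<open>q\<close>.\<close>
    define \<theta> where "\<theta> = (\<lambda>(x, c). (q x, \<kappa> ` {u\<in>U. (u \<in> c) \<noteq> (u \<in> \<beta> x)}))"
    have f\<theta>: "fst (\<theta> y) = q (fst y)" for y by (simp add: \<theta>_def split: prod.split)
    have s\<theta>: "(q t, q ` S) \<in> snd (\<theta> y) \<longleftrightarrow> ((t, S) \<in> snd y) \<noteq> ((t, S) \<in> \<beta> (fst y))" if "S \<subseteq> A" "t \<in> S" for y t S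
    proof -
      have "\<kappa> (t, S) \<in> \<kappa> ` {u\<in>U. (u \<in> snd y) \<noteq> (u \<in> \<beta> (fst y))} \<longleftrightarrow> (t, S) \<in> {u\<in>U. (u \<in> snd y) \<noteq> (u \<in> \<beta> (fst y))}"
        using that by (intro inj_on_image_mem_iff[OF \<kappa>inj]) (auto simp: U_def)
      thus ?thesis using that by (auto simp: \<theta>_def \<kappa>_def U_def split: prod.split)
    qed
    have s\<theta>U: "snd (\<theta> y) \<subseteq> U" for y using \<kappa>U by (auto simp: \<theta>_def split: prod.split)
    have repr: "\<exists>t0 S0. S0 \<subseteq> A \<and> t0 \<in> S0 \<and> t = q t0 \<and> S = q ` S0" if "(t, S) \<in> U" for t S
    proof -
      have "(t, S) \<in> \<kappa> ` U" unfolding \<kappa>U by (rule that)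
      then obtain u where u: "u \<in> U" "(t, S) = \<kappa> u" by (rule imageE) blast
      obtain t0 S0 where "u = (t0, S0)" by (cases u)
      thus ?thesis using u by (auto simp: \<kappa>_def U_def)
    qed
    have \<theta>P: "\<theta> y \<in> P" if y: "y \<in> P" for y
    proof -
      have y': "fst y \<in> A" "snd y \<in> W (fst y)" using y by (auto simp: P_def)
      have "snd (\<theta> y) \<subseteq> {(t, S). S \<subseteq> A \<and> q (fst y) \<in> S \<and> allowed srt t S}"
      proof safe
        fix t S assume m: "(t, S) \<in> snd (\<theta> y)"
        hence "(t, S) \<in> U" using s\<theta>U by blast
        then obtain t0 S0 where 0: "S0 \<subseteq> A" "t0 \<in> S0" "t = q t0" "S = q ` S0" using repr by metis
        hence "(t0, S0) \<in> snd y \<or> (t0, S0) \<in> \<beta> (fst y)" using m s\<theta>[OF 0(1,2), of y] by auto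
        hence "fst y \<in> S0 \<and> allowed srt t0 S0" using WD(2,3)[OF _ y'(2)] WD(2,3)[OF _ \<beta>W[OF y'(1)]] by metis
        thus "allowed srt t S" "q (fst y) \<in> S" using 0 allq by auto
        show "x \<in> A" if "x \<in> S" for x using that 0 qA by blast
      qed
      moreover have "even (card {t. (t, S) \<in> snd (\<theta> y)})" for S
      proof (cases "S \<subseteq> A")
        case False
        hence "{t. (t, S) \<in> snd (\<theta> y)} = {}" using subsetD[OF s\<theta>U[of y]] unfolding U_def by blast
        thus ?thesis by simp
      next
        case True
        then obtain S0 where S0: "S0 \<subseteq> A" "S = q ` S0" using qA by (metis subset_imageE)
        have "{t. (t, S) \<in> snd (\<theta> y)} = q ` {t\<in>S0. ((t, S0) \<in> snd y) \<noteq> ((t, S0) \<in> \<beta> (fst y))}"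
        proof (intro equalityI subsetI)
          fix t assume t: "t \<in> {t. (t, S) \<in> snd (\<theta> y)}"
          hence "t \<in> S" using subsetD[OF s\<theta>U[of y]] unfolding U_def by blast
          then obtain t0 where "t0 \<in> S0" "t = q t0" using S0 by blast
          thus "t \<in> q ` {t\<in>S0. ((t, S0) \<in> snd y) \<noteq> ((t, S0) \<in> \<beta> (fst y))}"
            using t s\<theta>[OF S0(1), of t0 y] S0(2) by simp
        next
          fix t assume "t \<in> q ` {t\<in>S0. ((t, S0) \<in> snd y) \<noteq> ((t, S0) \<in> \<beta> (fst y))}"
          then obtain t0 where "t0 \<in> S0" "t = q t0" "((t0, S0) \<in> snd y) \<noteq> ((t0, S0) \<in> \<beta> (fst y))" by blast
          thus "t \<in> {t. (t, S) \<in> snd (\<theta> y)}" using s\<theta>[OF S0(1), of t0 y] S0(2) by simp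
        qed
        moreover have "inj_on q {t\<in>S0. ((t, S0) \<in> snd y) \<noteq> ((t, S0) \<in> \<beta> (fst y))}"
          using S0 by (auto intro: inj_on_subset[OF qi])
        ultimately have "card {t. (t, S) \<in> snd (\<theta> y)} = card {t\<in>S0. ((t, S0) \<in> snd y) \<noteq> ((t, S0) \<in> \<beta> (fst y))}"
          by (simp only: card_image)
        moreover have "even (card {t\<in>S0. (t, S0) \<in> c})" if "c \<in> W x" for c x
        proof -
          have "{t\<in>S0. (t, S0) \<in> c} = {t. (t, S0) \<in> c}" using WD(4)[OF _ that] by auto
          thus ?thesis using WE[OF that] by simp
        qed
        ultimately show ?thesis
          using odd_card_neq[OF fS[OF S0(1)], of "\<lambda>t. (t, S0) \<in> snd y" "\<lambda>t. (t, S0) \<in> \<beta> (fst y)"]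
            y'(2) \<beta>W[OF y'(1)] by auto
      qed
      ultimately have "snd (\<theta> y) \<in> W (fst (\<theta> y))" unfolding W_def f\<theta> by blast
      moreover have "fst (\<theta> y) \<in> A" using y' qA f\<theta> by auto
      ultimately show ?thesis unfolding P_def by (metis mem_Sigma_iff prod.collapse)
    qed
    have \<theta>inj: "inj_on \<theta> P"
    proof (rule inj_onI)
      fix y z assume y: "y \<in> P" and z: "z \<in> P" and e: "\<theta> y = \<theta> z"
      have "q (fst y) = q (fst z)" using e f\<theta> by metis
      hence f: "fst y = fst z" using y z qi by (auto simp: P_def dest: inj_onD)
      have "(t, S) \<in> snd y \<longleftrightarrow> (t, S) \<in> snd z" if "S \<subseteq> A" "t \<in> S" for t S
        using s\<theta>[OF that, of y] s\<theta>[OF that, of z] e f by auto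
      moreover have "snd y \<subseteq> U" "snd z \<subseteq> U"
        using y z WU[of "snd y" "fst y"] WU[of "snd z" "fst z"] by (auto simp: P_def)
      ultimately have "snd y = snd z" by (auto simp: U_def)
      thus "y = z" using f by (simp add: prod_eq_iff)
    qed
    have "\<theta> ` P = P" by (rule endo_inj_surj[OF finP _ \<theta>inj]) (use \<theta>P in auto)
    moreover have "emb \<theta> P s' Q' s' Q'"
    proof (rule embI)
      show "inj_on \<theta> P" by fact
      show "s' (\<theta> y) = s' y" if "y \<in> P" for y using that q(3) by (auto simp: s'_def f\<theta> P_def)
      fix Y y assume Y: "finite Y" "Y \<subseteq> P" "y \<in> Y"
      let ?S = "fst ` Y"
      have S: "?S \<subseteq> A" "fst y \<in> ?S" using Y by (auto simp: P_def)
      have im: "fst ` \<theta> ` Y = q ` ?S" using f\<theta> by (auto simp: image_image)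
      have i: "inj_on fst (\<theta> ` Y) \<longleftrightarrow> inj_on fst Y"
      proof
        assume h: "inj_on fst (\<theta> ` Y)"
        show "inj_on fst Y"
        proof (rule inj_onI)
          fix u v assume uv: "u \<in> Y" "v \<in> Y" "fst u = fst v"
          hence "fst (\<theta> u) = fst (\<theta> v)" by (simp add: f\<theta>)
          hence "\<theta> u = \<theta> v" using inj_onD[OF h] uv by blast
          thus "u = v" using inj_onD[OF \<theta>inj] uv Y(2) by blast
        qed
      next
        assume h: "inj_on fst Y"
        have "inj_on (\<lambda>y. q (fst y)) Y"
          using comp_inj_on[OF h inj_on_subset[OF qi S(1)]] by (simp add: comp_def)
        thus "inj_on fst (\<theta> ` Y)" using f\<theta> by (auto simp: inj_on_def)
      qed
      have "odd (card {z\<in>\<theta> ` Y. (fst (\<theta> y), q ` ?S) \<in> snd z}) = odd (card {z\<in>Y. (fst y, ?S) \<in> snd z})"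
        if h: "inj_on fst Y"
      proof -
        let ?Y = "{z\<in>Y. ((fst y, ?S) \<in> snd z) \<noteq> ((fst y, ?S) \<in> \<beta> (fst z))}"
        have "{z\<in>\<theta> ` Y. (fst (\<theta> y), q ` ?S) \<in> snd z} = \<theta> ` ?Y"
          unfolding f\<theta> using s\<theta>[OF S] by (auto simp del: image_eqI)
        moreover have "inj_on \<theta> ?Y" by (rule inj_on_subset[OF \<theta>inj]) (use Y in auto)
        ultimately have 1: "card {z\<in>\<theta> ` Y. (fst (\<theta> y), q ` ?S) \<in> snd z} = card ?Y"
          by (simp only: card_image)
        have "{x\<in>?S. (fst y, ?S) \<in> \<beta> x} = fst ` {z\<in>Y. (fst y, ?S) \<in> \<beta> (fst z)}" by blast
        moreover have "inj_on fst {z\<in>Y. (fst y, ?S) \<in> \<beta> (fst z)}" using h by (auto simp: inj_on_def)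
        ultimately have 2: "card {x\<in>?S. (fst y, ?S) \<in> \<beta> x} = card {z\<in>Y. (fst y, ?S) \<in> \<beta> (fst z)}"
          by (simp only: card_image)
        show ?thesis
          using odd_card_neq[OF Y(1), of "\<lambda>z. (fst y, ?S) \<in> snd z" "\<lambda>z. (fst y, ?S) \<in> \<beta> (fst z)"] \<beta>sum[OF S]
          unfolding 1 2 by blast
      qed
      thus "Q' (\<theta> y) (\<theta> ` Y) = Q' y Y"
        unfolding Q'_def im i f\<theta> using Y allq[OF S] by auto
    qed
    moreover have "\<theta> (\<psi> d) = \<psi> (p d)" if d: "d \<in> D" for d
    proof -
      have f: "fst (\<theta> (\<psi> d)) = fst (\<psi> (p d))" using f\<theta> q(2)[OF d] by (simp add: \<psi>_def)
      have "(q t, q ` S) \<in> snd (\<theta> (\<psi> d)) \<longleftrightarrow> (q t, q ` S) \<in> \<chi> (p d)" if S: "S \<subseteq> A" "t \<in> S" for t S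
      proof (cases "d \<in> S")
        case True
        thus ?thesis unfolding s\<theta>[OF S] using d S q(2) by (auto simp: \<psi>_def \<beta>_def \<delta>_def)
      next
        case False
        have "q d \<notin> q ` S" using inj_on_image_mem_iff[OF qi, of d S] d D(1) False S by blast
        thus ?thesis unfolding s\<theta>[OF S] using d q(2) False by (auto simp: \<psi>_def \<beta>_def \<delta>_def \<chi>_def)
      qed
      hence "(t, S) \<in> snd (\<theta> (\<psi> d)) \<longleftrightarrow> (t, S) \<in> \<chi> (p d)" if "(t, S) \<in> U" for t S
        using repr[OF that] by blast
      moreover have "\<chi> (p d) \<subseteq> U" using WU[OF \<chi>W] .
      moreover have "snd (\<theta> (\<psi> d)) \<subseteq> U" by (rule s\<theta>U)
      ultimately have "snd (\<theta> (\<psi> d)) = \<chi> (p d)" by auto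
      thus ?thesis using f by (simp add: \<psi>_def prod_eq_iff)
    qed
    ultimately show ?thesis by blast
  qed
  show ?thesis
    by (rule exI[of _ P], rule exI[of _ s'], rule exI[of _ Q'], rule exI[of _ \<psi>])
      (intro conjI allI impI finP valP \<psi>emb \<psi>P, elim conjE, rule ext)
qed

end

section \<open>Category and generic tuples of automorphisms\<close>

context sort_pattern begin

text \<open>Basic open sets prescribe the values at finitely many points. The condition says that
  \<open>U\<close> contains a dense open subset of \<open>Gr\<close>, without asking
  \<open>U\<close> itself to be open; stated this way it spares a topology on
  \<open>Gr\<close>.\<close>

definition dense_open :: "(nat \<Rightarrow> nat) set \<Rightarrow> bool" where
  "dense_open U \<longleftrightarrow> (\<forall>g\<in>Gr. \<forall>A. finite A \<longrightarrow>
     (\<exists>g'\<in>Gr. \<exists>A'. finite A' \<and> A \<subseteq> A' \<and> (\<forall>x\<in>A. g' x = g x) \<and> (\<forall>z\<in>Gr. (\<forall>x\<in>A'. z x = g' x) \<longrightarrow> z \<in> U)))"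

definition comeagre :: "(nat \<Rightarrow> nat) set \<Rightarrow> bool" where
  "comeagre S \<longleftrightarrow> (\<exists>U :: nat \<Rightarrow> _. (\<forall>n. dense_open (U n)) \<and> (\<forall>z\<in>Gr. (\<forall>n. z \<in> U n) \<longrightarrow> z \<in> S))"

lemma dense_openI:
  assumes "\<And>g A. g \<in> Gr \<Longrightarrow> finite A \<Longrightarrow> \<exists>g'\<in>Gr. \<exists>A'. finite A' \<and> A \<subseteq> A' \<and> (\<forall>x\<in>A. g' x = g x) \<and> (\<forall>z\<in>Gr. (\<forall>x\<in>A'. z x = g' x) \<longrightarrow> z \<in> U)"
  shows "dense_open U"
  unfolding dense_open_def by (intro ballI allI impI assms)

lemma dense_openD:
  assumes "dense_open U" "g \<in> Gr" "finite A"
  shows "\<exists>g' A'. g' \<in> Gr \<and> finite A' \<and> A \<subseteq> A' \<and> (\<forall>x\<in>A. g' x = g x) \<and> (\<forall>z\<in>Gr. (\<forall>x\<in>A'. z x = g' x) \<longrightarrow> z \<in> U)"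
  using assms(1)[unfolded dense_open_def, rule_format, OF assms(2,3)] by (elim bexE exE) (intro exI conjI, auto)

lemma dense_open_UNIV: "dense_open UNIV"
proof (rule dense_openI)
  fix g A assume "g \<in> Gr" "finite (A :: nat set)"
  thus "\<exists>g'\<in>Gr. \<exists>A'. finite A' \<and> A \<subseteq> A' \<and> (\<forall>x\<in>A. g' x = g x) \<and> (\<forall>z\<in>Gr. (\<forall>x\<in>A'. z x = g' x) \<longrightarrow> z \<in> UNIV)"
    by (intro bexI[of _ g] exI[of _ A]) auto
qed

lemma dense_open_Int:
  assumes U: "dense_open U" and W: "dense_open W" shows "dense_open (U \<inter> W)"
proof (rule dense_openI)
  fix g A assume g: "g \<in> Gr" and A: "finite (A :: nat set)"
  obtain g1 A1 where 1: "g1 \<in> Gr" "finite A1" "A \<subseteq> A1" "\<forall>x\<in>A. g1 x = g x"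
    "\<forall>z\<in>Gr. (\<forall>x\<in>A1. z x = g1 x) \<longrightarrow> z \<in> U" using dense_openD[OF U g A] by blast
  obtain g2 A2 where 2: "g2 \<in> Gr" "finite A2" "A1 \<subseteq> A2" "\<forall>x\<in>A1. g2 x = g1 x"
    "\<forall>z\<in>Gr. (\<forall>x\<in>A2. z x = g2 x) \<longrightarrow> z \<in> W" using dense_openD[OF W 1(1,2)] by blast
  have "z \<in> U \<inter> W" if z: "z \<in> Gr" "\<forall>x\<in>A2. z x = g2 x" for z
  proof -
    have "\<forall>x\<in>A1. z x = g1 x" using z(2) 2(3,4) by auto
    thus ?thesis using 1(5) 2(5) z by blast
  qed
  thus "\<exists>g'\<in>Gr. \<exists>A'. finite A' \<and> A \<subseteq> A' \<and> (\<forall>x\<in>A. g' x = g x) \<and> (\<forall>z\<in>Gr. (\<forall>x\<in>A'. z x = g' x) \<longrightarrow> z \<in> U \<inter> W)"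
    using 1 2 by (intro bexI[of _ g2] exI[of _ A2]) auto
qed

lemma dense_open_finite_Int: "(\<And>i. dense_open (U i)) \<Longrightarrow> dense_open (\<Inter>i\<le>(n::nat). U i)"
proof (induction n)
  case (Suc n)
  have "(\<Inter>i\<le>Suc n. U i) = (\<Inter>i\<le>n. U i) \<inter> U (Suc n)" by (auto simp: atMost_Suc)
  thus ?case using Suc dense_open_Int by metis
qed simp

lemma comeagreE:
  assumes "comeagre S"
  obtains U :: "nat \<Rightarrow> _" where "\<And>n. dense_open (U n)" "\<And>z. z \<in> Gr \<Longrightarrow> (\<And>n. z \<in> U n) \<Longrightarrow> z \<in> S"
  using assms unfolding comeagre_def by blast

lemma comeagre_Int:
  assumes "comeagre S" "comeagre T" shows "comeagre (S \<inter> T)"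
proof -
  obtain U where U: "\<And>n. dense_open (U n)" "\<And>z. z \<in> Gr \<Longrightarrow> (\<And>n::nat. z \<in> U n) \<Longrightarrow> z \<in> S"
    using comeagreE[OF assms(1)] by blast
  obtain W where W: "\<And>n. dense_open (W n)" "\<And>z. z \<in> Gr \<Longrightarrow> (\<And>n::nat. z \<in> W n) \<Longrightarrow> z \<in> T"
    using comeagreE[OF assms(2)] by blast
  show ?thesis unfolding comeagre_def
    by (rule exI[of _ "\<lambda>n. U n \<inter> W n"]) (use U W dense_open_Int in auto)
qed

lemma comeagre_countable:
  assumes "countable I" "\<And>i. i \<in> I \<Longrightarrow> dense_open (U i)" "\<And>z. z \<in> Gr \<Longrightarrow> (\<And>i. i \<in> I \<Longrightarrow> z \<in> U i) \<Longrightarrow> z \<in> S"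
  shows "comeagre S"
proof (cases "I = {}")
  case True
  thus ?thesis using assms(3) dense_open_UNIV unfolding comeagre_def by (intro exI[of _ "\<lambda>_. UNIV"]) auto
next
  case False
  have "z \<in> S" if "z \<in> Gr" "\<forall>n. z \<in> U (from_nat_into I n)" for z
  proof (rule assms(3)[OF that(1)])
    fix i assume "i \<in> I"
    then obtain n where "from_nat_into I n = i" using from_nat_into_surj[OF assms(1)] by blast
    thus "z \<in> U i" using that(2) by auto
  qed
  thus ?thesis unfolding comeagre_def
    by (intro exI[of _ "\<lambda>n. U (from_nat_into I n)"]) (use assms(2) from_nat_into[OF False] in auto)
qed

lemma limit_in_Gr:
  assumes Ah: "\<And>n. h n \<in> Gr" "\<And>n. A n \<subseteq> A (Suc n)" "\<And>n x. x \<in> A n \<Longrightarrow> h (Suc n) x = h n x"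
    and ex: "\<And>n::nat. n \<in> A (Suc n)" "\<And>n. n \<in> h (Suc n) ` A (Suc n)"
  shows "\<exists>f\<in>Gr. \<forall>n. \<forall>x\<in>A n. f x = h n x"
proof -
  obtain f where f: "\<And>n x. x \<in> A n \<Longrightarrow> f x = h n x" using chain_limit[of A h, OF Ah(2,3)] by blast
  have UA: "(\<Union>n. A n) = UNIV" using ex(1) by blast
  have loc: "\<exists>g\<in>Gr. \<forall>x\<in>F. f x = g x" if F: "finite F" for F
  proof -
    obtain n where "F \<subseteq> A n" using finite_subset_chain[of A F, OF Ah(2) F] UA by auto
    thus ?thesis using f Ah(1) by blast
  qed
  have "inj f"
  proof (rule injI)
    fix x y assume e: "f x = f y"
    obtain g where g: "g \<in> Gr" "\<forall>z\<in>{x, y}. f z = g z" using loc[of "{x, y}"] by blast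
    have "g x = f x" "g y = f y" using g(2) by simp_all
    hence "g x = g y" using e by (rule_tac trans) simp_all
    thus "x = y" by (rule injD[OF Gr_inj[OF g(1)]])
  qed
  moreover have "y \<in> range f" for y
  proof -
    obtain x where "x \<in> A (Suc y)" "y = h (Suc y) x" using ex(2)[of y] by blast
    hence "y = f x" using f by simp
    thus ?thesis by (rule range_eqI)
  qed
  ultimately have "bij f" by (auto simp: bij_def)
  hence "f \<in> Gr" using loc by (intro Gr_local) auto
  thus ?thesis using f by blast
qed

lemma baire:
  assumes S: "comeagre S" and g: "g \<in> Gr" and A: "finite A"
  shows "\<exists>z\<in>Gr. z \<in> S \<and> (\<forall>x\<in>A. z x = g x)"
proof -
  obtain U where U: "\<And>n. dense_open (U n)" "\<And>z. z \<in> Gr \<Longrightarrow> (\<And>n::nat. z \<in> U n) \<Longrightarrow> z \<in> S"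
    using comeagreE[OF S] by blast
  \<comment> \<open>Besides entering \<open>U n\<close>, stage \<open>n\<close> puts
    \<open>n\<close> into the domain and into the range, because a pointwise limit of permutations
    may fail to be onto.\<close>
  define D where "D n B h \<longleftrightarrow> n \<in> B \<and> n \<in> h ` B \<and> (\<forall>z\<in>Gr. (\<forall>x\<in>B. z x = h x) \<longrightarrow> z \<in> U n)" for n B h
  have step: "\<exists>B' h'. (finite B' \<and> h' \<in> Gr) \<and> B \<subseteq> B' \<and> (\<forall>x\<in>B. h' x = h x) \<and> D n B' h'"
    if Bh: "finite B \<and> h \<in> Gr" for n B h
  proof -
    obtain h' B' where h': "h' \<in> Gr" "finite B'" "insert n (insert (ginv h n) B) \<subseteq> B'"
       "\<forall>x\<in>insert n (insert (ginv h n) B). h' x = h x" "\<forall>z\<in>Gr. (\<forall>x\<in>B'. z x = h' x) \<longrightarrow> z \<in> U n"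
      using dense_openD[OF U(1), of h "insert n (insert (ginv h n) B)" n] Bh by auto
    have "h' (ginv h n) = n" using h'(4) Bh by simp
    hence "n \<in> h' ` B'" using h'(3) by (metis image_eqI insert_subset)
    thus ?thesis using h' unfolding D_def by (intro exI[of _ B'] exI[of _ h']) auto
  qed
  obtain B h where Bh: "B 0 = A" "h 0 = g" "\<And>n. finite (B n) \<and> h n \<in> Gr" "\<And>n. B n \<subseteq> B (Suc n)"
    "\<And>n x. x \<in> B n \<Longrightarrow> h (Suc n) x = h n x" "\<And>n. D n (B (Suc n)) (h (Suc n))"
    using chain_exists[of "\<lambda>B h. finite B \<and> h \<in> Gr" A g D, OF _ step] A g by blast
  obtain f where f: "f \<in> Gr" "\<And>n x. x \<in> B n \<Longrightarrow> f x = h n x"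
    using limit_in_Gr[of h B] Bh(3-6) unfolding D_def by blast
  have "f \<in> U n" for n using Bh(6)[of n] f unfolding D_def by blast
  thus ?thesis using f U(2) Bh(1,2) by blast
qed

text \<open>Inversion and translations are homeomorphisms of \<open>Gr\<close>, so preimages of
  dense open sets under their composite are dense open.\<close>

lemma comeagre_translate_inverse:
  assumes u: "u \<in> Gr" and v: "v \<in> Gr" and S: "comeagre S"
  shows "comeagre {z. (\<lambda>x. u (ginv z (v x))) \<in> S}"
proof -
  obtain U where U: "\<And>n. dense_open (U n)" "\<And>z. z \<in> Gr \<Longrightarrow> (\<And>n::nat. z \<in> U n) \<Longrightarrow> z \<in> S"
    using comeagreE[OF S] by blast
  let ?t = "\<lambda>z x. u (ginv z (v x))"
  have tG: "?t z \<in> Gr" if "z \<in> Gr" for z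
    using Gr_comp[OF u Gr_comp[OF Gr_inv[OF that] v]] by simp
  have d: "dense_open {z. ?t z \<in> W}" if W: "dense_open W" for W
  proof (rule dense_openI)
    fix g A assume g: "g \<in> Gr" and A: "finite (A :: nat set)"
    let ?B = "(\<lambda>x. ginv v (g x)) ` A"
    obtain h B where h: "h \<in> Gr" "finite B" "?B \<subseteq> B" "\<forall>x\<in>?B. h x = ?t g x"
      "\<forall>z\<in>Gr. (\<forall>x\<in>B. z x = h x) \<longrightarrow> z \<in> W"
      using dense_openD[OF W tG[OF g], of ?B] A by blast
    define g' where "g' x = v (ginv h (u x))" for x
    have g'G: "g' \<in> Gr" using Gr_comp[OF v Gr_comp[OF Gr_inv[OF h(1)] u]] unfolding g'_def[abs_def] .
    have agree: "g' x = g x" if "x \<in> A" for x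
    proof -
      have "h (ginv v (g x)) = u x" using h(4) that g v by simp
      hence "ginv h (u x) = ginv v (g x)" using h(1) by (metis Gr_inv_f)
      thus ?thesis using v by (simp add: g'_def)
    qed
    let ?A = "A \<union> (\<lambda>x. ginv u (h x)) ` B"
    have "?t z \<in> W" if z: "z \<in> Gr" "\<forall>x\<in>?A. z x = g' x" for z
    proof -
      have "?t z x = h x" if "x \<in> B" for x
      proof -
        have "z (ginv u (h x)) = g' (ginv u (h x))" using z(2) that by blast
        also have "\<dots> = v x" using u h(1) by (simp add: g'_def)
        finally have "ginv z (v x) = ginv u (h x)" using z(1) by (metis Gr_inv_f)
        thus ?thesis using u by simp
      qed
      thus ?thesis by (intro h(5)[rule_format, OF tG[OF z(1)]])
    qed
    thus "\<exists>g'\<in>Gr. \<exists>A'. finite A' \<and> A \<subseteq> A' \<and> (\<forall>x\<in>A. g' x = g x) \<and> (\<forall>z\<in>Gr. (\<forall>x\<in>A'. z x = g' x) \<longrightarrow> z \<in> {z. ?t z \<in> W})"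
      using g'G agree A h(2) by (intro bexI[of _ g'] exI[of _ ?A]) auto
  qed
  show ?thesis unfolding comeagre_def
  proof (intro exI[of _ "\<lambda>n. {z. ?t z \<in> U n}"] conjI allI ballI impI)
    show "dense_open {z. ?t z \<in> U n}" for n by (rule d[OF U(1)])
    fix z assume z: "z \<in> Gr" "\<forall>n. z \<in> {z. ?t z \<in> U n}"
    have "?t z \<in> S" by (rule U(2)[OF tG[OF z(1)]]) (use z(2) in simp)
    thus "z \<in> {z. ?t z \<in> S}" by simp
  qed
qed

section \<open>Generic tuples and finite invariant sets\<close>

definition invariant :: "(nat \<Rightarrow> nat) list \<Rightarrow> nat set \<Rightarrow> bool" where
  "invariant xs C \<longleftrightarrow> (\<forall>x\<in>set xs. x ` C = C)"

text \<open>A tuple of automorphisms is generic if its action on \<open>M\<close> is locally finite and realizes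
  every finite extension of every finite invariant substructure.\<close>

definition gen :: "(nat \<Rightarrow> nat) list \<Rightarrow> bool" where
  "gen xs \<longleftrightarrow> set xs \<subseteq> Gr \<and> (\<forall>F. finite F \<longrightarrow> (\<exists>C. finite C \<and> F \<subseteq> C \<and> invariant xs C)) \<and>
     (\<forall>C B \<xi>. finite B \<and> C \<subseteq> B \<and> invariant xs C \<and>
        (\<forall>i<length xs. emb (\<xi> i) B srt R srt R \<and> \<xi> i ` B = B \<and> (\<forall>c\<in>C. \<xi> i c = (xs ! i) c)) \<longrightarrow>
        (\<exists>e. emb e B srt R srt R \<and> (\<forall>c\<in>C. e c = c) \<and> (\<forall>i<length xs. \<forall>b\<in>B. e (\<xi> i b) = (xs ! i) (e b))))"

lemma gen_Nil: "gen []"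
  unfolding gen_def invariant_def using emb_id by (auto intro!: exI[of _ "\<lambda>x. x"])

lemma gen_Gr: "gen xs \<Longrightarrow> x \<in> set xs \<Longrightarrow> x \<in> Gr"
  by (auto simp: gen_def)

lemma gen_invariant: "gen xs \<Longrightarrow> finite F \<Longrightarrow> \<exists>C. finite C \<and> F \<subseteq> C \<and> invariant xs C"
  by (simp add: gen_def)

lemma gen_extend:
  assumes "gen xs" "finite B" "C \<subseteq> B" "invariant xs C"
    "\<And>i. i < length xs \<Longrightarrow> emb (\<xi> i) B srt R srt R" "\<And>i. i < length xs \<Longrightarrow> \<xi> i ` B = B"
    "\<And>i c. i < length xs \<Longrightarrow> c \<in> C \<Longrightarrow> \<xi> i c = (xs ! i) c"
  shows "\<exists>e. emb e B srt R srt R \<and> (\<forall>c\<in>C. e c = c) \<and> (\<forall>i<length xs. \<forall>b\<in>B. e (\<xi> i b) = (xs ! i) (e b))"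
proof -
  have "finite B \<and> C \<subseteq> B \<and> invariant xs C \<and>
    (\<forall>i<length xs. emb (\<xi> i) B srt R srt R \<and> \<xi> i ` B = B \<and> (\<forall>c\<in>C. \<xi> i c = (xs ! i) c))"
    using assms(2-7) by (intro conjI allI impI ballI)
  thus ?thesis using assms(1)[unfolded gen_def, THEN conjunct2, THEN conjunct2, rule_format] by simp
qed

text \<open>The definition of \<open>gen\<close> only speaks of extensions inside the structure. An
  abstract \<open>P\<close> is placed there over \<open>C\<close> by \<open>extension\<close> and
  its maps are transported; genericity then moves this copy to one on which the tuple itself acts as
  prescribed.\<close>

lemma gen_realize:
  assumes xs: "gen xs" and P: "finite P" "valid P s Q" and C: "finite C" "invariant xs C"
    and \<psi>: "emb \<psi> C srt R s Q" "\<psi> ` C \<subseteq> P"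
    and \<theta>: "\<And>i. i < length xs \<Longrightarrow> emb (\<theta> i) P s Q s Q" "\<And>i. i < length xs \<Longrightarrow> \<theta> i ` P = P"
      "\<And>i c. i < length xs \<Longrightarrow> c \<in> C \<Longrightarrow> \<theta> i (\<psi> c) = \<psi> ((xs ! i) c)"
  shows "\<exists>e. emb e P s Q srt R \<and> (\<forall>c\<in>C. e (\<psi> c) = c) \<and> (\<forall>i<length xs. \<forall>p\<in>P. e (\<theta> i p) = (xs ! i) (e p))"
proof -
  obtain e0 where e0: "emb e0 P s Q srt R" "\<forall>a\<in>\<psi> ` C. e0 a = inv_into C \<psi> a"
    using extension[OF P(1) \<psi>(2) P(2) emb_inv_into[OF \<psi>(1)], of "{}"] by auto
  have e0\<psi>: "e0 (\<psi> c) = c" if "c \<in> C" for c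
    using e0(2) that inv_into_f_f[OF emb_inj[OF \<psi>(1)] that] by auto
  let ?B = "e0 ` P" and ?r = "inv_into P e0"
  have r: "?r (e0 p) = p" if "p \<in> P" for p using inv_into_f_f[OF emb_inj[OF e0(1)] that] .
  have rB: "?r ` ?B = P" by (force simp: r)
  define \<xi> where "\<xi> i b = e0 (\<theta> i (?r b))" for i b
  have "\<exists>e. emb e ?B srt R srt R \<and> (\<forall>c\<in>C. e c = c) \<and> (\<forall>i<length xs. \<forall>b\<in>?B. e (\<xi> i b) = (xs ! i) (e b))"
  proof (rule gen_extend[OF xs])
    show "finite ?B" using P(1) by simp
    show "C \<subseteq> ?B" using e0\<psi> \<psi>(2) by force
    show "invariant xs C" by fact
    fix i assume i: "i < length xs"
    have "emb (\<lambda>b. \<theta> i (?r b)) ?B srt R s Q"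
      by (rule emb_trans[OF emb_inv_into[OF e0(1)] \<theta>(1)[OF i]]) (simp add: rB)
    from emb_trans[OF this e0(1)] show "emb (\<xi> i) ?B srt R srt R"
      unfolding \<xi>_def using rB \<theta>(2)[OF i] by (metis image_image order_refl)
    have "\<xi> i ` ?B = e0 ` \<theta> i ` P" by (auto simp: \<xi>_def image_image r)
    thus "\<xi> i ` ?B = ?B" using \<theta>(2)[OF i] by simp
    fix c assume c: "c \<in> C"
    have xc: "(xs ! i) c \<in> C" using C(2) c i unfolding invariant_def by (metis imageI nth_mem)
    have "?r c = \<psi> c" using r[of "\<psi> c"] e0\<psi>[OF c] \<psi>(2) c by auto
    thus "\<xi> i c = (xs ! i) c" using \<theta>(3)[OF i c] e0\<psi>[OF xc] by (simp add: \<xi>_def)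
  qed
  then obtain e1 where e1: "emb e1 ?B srt R srt R" "\<forall>c\<in>C. e1 c = c"
    "\<And>i b. i < length xs \<Longrightarrow> b \<in> ?B \<Longrightarrow> e1 (\<xi> i b) = (xs ! i) (e1 b)" by blast
  have "emb (\<lambda>p. e1 (e0 p)) P s Q srt R" by (rule emb_trans[OF e0(1) e1(1)]) simp
  moreover have "e1 (e0 (\<psi> c)) = c" if "c \<in> C" for c using e0\<psi> e1(2) that by simp
  moreover have "e1 (e0 (\<theta> i p)) = (xs ! i) (e1 (e0 p))" if "i < length xs" "p \<in> P" for i p
    using e1(3)[of i "e0 p"] that r by (simp add: \<xi>_def)
  ultimately show ?thesis by (intro exI[of _ "\<lambda>p. e1 (e0 p)"]) auto
qed

lemma invariant_snoc: "invariant (xs @ [z]) C \<longleftrightarrow> invariant xs C \<and> z ` C = C"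
  by (auto simp: invariant_def)

text \<open>The extension of partial automorphisms enters here: the tuple on a finite invariant set
  and \<open>g\<close> on \<open>A\<close> extend to automorphisms of one and the same finite
  structure, which genericity of \<open>xs\<close> realizes with the true action of
  \<open>xs\<close>. The remaining automorphism becomes \<open>g'\<close>.\<close>

lemma gen_close:
  assumes xs: "gen xs" and g: "g \<in> Gr" and A: "finite A"
  shows "\<exists>g'\<in>Gr. \<exists>C. finite C \<and> A \<subseteq> C \<and> invariant (xs @ [g']) C \<and> (\<forall>x\<in>A. g' x = g x)"
proof -
  obtain C0 where C0: "finite C0" "A \<union> g ` A \<subseteq> C0" "invariant xs C0"
    using gen_invariant[OF xs, of "A \<union> g ` A"] A by auto
  obtain P :: "(nat \<times> (nat \<times> nat set) set) set" and s' Q' \<psi> where P: "finite P" "valid P s' Q'"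
      "emb \<psi> C0 srt R s' Q'" "\<psi> ` C0 \<subseteq> P"
    and ext: "\<And>D p. D \<subseteq> C0 \<Longrightarrow> emb p D srt R srt R \<Longrightarrow> p ` D \<subseteq> C0 \<Longrightarrow>
       \<exists>\<theta>. emb \<theta> P s' Q' s' Q' \<and> \<theta> ` P = P \<and> (\<forall>d\<in>D. \<theta> (\<psi> d) = \<psi> (p d))"
    using extension_property_partial_automorphisms[OF C0(1)] by auto
  have "\<exists>\<theta>. emb \<theta> P s' Q' s' Q' \<and> \<theta> ` P = P \<and> (\<forall>d\<in>C0. \<theta> (\<psi> d) = \<psi> ((xs ! i) d))" if "i < length xs" for i
    using that C0(3) xs by (intro ext) (auto simp: invariant_def intro!: Gr_emb gen_Gr)
  then obtain \<theta> where \<theta>: "\<And>i. i < length xs \<Longrightarrow> emb (\<theta> i) P s' Q' s' Q'" "\<And>i. i < length xs \<Longrightarrow> \<theta> i ` P = P"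
     "\<And>i d. i < length xs \<Longrightarrow> d \<in> C0 \<Longrightarrow> \<theta> i (\<psi> d) = \<psi> ((xs ! i) d)" by metis
  obtain \<zeta> where \<zeta>: "emb \<zeta> P s' Q' s' Q'" "\<zeta> ` P = P" "\<forall>d\<in>A. \<zeta> (\<psi> d) = \<psi> (g d)"
    using ext[of A g] C0(2) Gr_emb[OF g] by auto
  obtain e where e: "emb e P s' Q' srt R" "\<forall>c\<in>C0. e (\<psi> c) = c"
    "\<And>i p. i < length xs \<Longrightarrow> p \<in> P \<Longrightarrow> e (\<theta> i p) = (xs ! i) (e p)"
    using gen_realize[OF xs P(1,2) C0(1,3) P(3,4) \<theta>] by auto
  let ?C = "e ` P" and ?r = "inv_into P e"
  have r: "?r (e p) = p" if "p \<in> P" for p using inv_into_f_f[OF emb_inj[OF e(1)] that] .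
  have rC: "?r ` ?C = P" by (force simp: r)
  have "emb (\<lambda>b. \<zeta> (?r b)) ?C srt R s' Q'"
    by (rule emb_trans[OF emb_inv_into[OF e(1)] \<zeta>(1)]) (simp add: rC)
  from emb_trans[OF this e(1)] have "emb (\<lambda>b. e (\<zeta> (?r b))) ?C srt R srt R"
    using rC \<zeta>(2) by (metis image_image order_refl)
  then obtain g' where g': "g' \<in> Gr" "\<forall>x\<in>?C. g' x = e (\<zeta> (?r x))"
    using homogeneity[of ?C] P(1) by blast
  have g'e: "g' (e p) = e (\<zeta> p)" if "p \<in> P" for p using g'(2) that r by simp
  have "g' ` ?C = e ` \<zeta> ` P" by (simp add: image_image g'e)
  hence "g' ` ?C = ?C" using \<zeta>(2) by simp
  moreover have "invariant xs ?C"
    unfolding invariant_def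
  proof
    fix x assume "x \<in> set xs"
    then obtain i where i: "i < length xs" "x = xs ! i" by (metis in_set_conv_nth)
    have "x ` ?C = e ` \<theta> i ` P" using e(3)[OF i(1)] i(2) by (simp add: image_image)
    thus "x ` ?C = ?C" using \<theta>(2)[OF i(1)] by simp
  qed
  moreover have "A \<subseteq> ?C"
  proof
    fix a assume "a \<in> A"
    hence "a = e (\<psi> a)" "\<psi> a \<in> P" using C0(2) e(2) P(4) by auto
    thus "a \<in> ?C" by blast
  qed
  moreover have "g' a = g a" if a: "a \<in> A" for a
  proof -
    have "a \<in> C0" "g a \<in> C0" using C0(2) a by auto
    hence "a = e (\<psi> a)" "\<psi> a \<in> P" "e (\<psi> (g a)) = g a" using e(2) P(4) by auto
    thus ?thesis using g'e[of "\<psi> a"] \<zeta>(3) a by simp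
  qed
  ultimately show ?thesis using g'(1) P(1)
    by (intro bexI[of _ g'] exI[of _ ?C]) (auto simp: invariant_snoc)
qed

end

section \<open>Generic tuples are comeagre and conjugate\<close>

context sort_pattern begin

text \<open>Both \<open>C1\<close> with the given tuple and \<open>B\<close> with the maps
  \<open>\<xi>\<close> extend the action on \<open>C\<close>, so the two actions fit together on the
  amalgam over \<open>C\<close> that has no relations across. Genericity of \<open>xs\<close>
  realizes all maps but the last, and the last one defines \<open>g'\<close>.\<close>

lemma free_amalgam:
  assumes xs: "gen xs" and g: "g \<in> Gr" and C1: "finite C1" "invariant (xs @ [g]) C1"
    and B: "finite B" "C \<subseteq> B" "C \<subseteq> C1" "invariant (xs @ [g]) C"
    and \<xi>: "\<And>i. i < Suc (length xs) \<Longrightarrow> emb (\<xi> i) B srt R srt R" "\<And>i. i < Suc (length xs) \<Longrightarrow> \<xi> i ` B = B"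
      "\<And>i c. i < Suc (length xs) \<Longrightarrow> c \<in> C \<Longrightarrow> \<xi> i c = ((xs @ [g]) ! i) c"
  shows "\<exists>g'\<in>Gr. \<exists>e. (\<forall>x\<in>C1. g' x = g x) \<and> emb e B srt R srt R \<and> (\<forall>c\<in>C. e c = c) \<and>
     (\<forall>i<Suc (length xs). \<forall>b\<in>B. e (\<xi> i b) = ((xs @ [g']) ! i) (e b))"
proof -
  let ?n = "length xs"
  define x where "x i = (xs @ [g]) ! i" for i
  have xG: "x i \<in> Gr" if "i < Suc ?n" for i
    using that gen_Gr[OF xs nth_mem] g by (auto simp: x_def nth_append less_Suc_eq)
  have xmem: "x i \<in> set (xs @ [g])" if "i < Suc ?n" for i
    unfolding x_def by (rule nth_mem) (use that in simp)
  have xC1: "x i ` C1 = C1" and xC: "x i ` C = C" if "i < Suc ?n" for i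
    using C1(2) B(4) xmem[OF that] by (auto simp only: invariant_def)
  define P1 :: "(nat + nat) set" where "P1 = Inl ` C1"
  define P2 :: "(nat + nat) set" where "P2 = Inl ` C \<union> Inr ` (B - C)"
  define P :: "(nat + nat) set" where "P = P1 \<union> P2"
  define s where "s = case_sum srt srt"
  \<comment> \<open>Sets that lie in both blocks consist of points coming from \<open>C\<close>,
    where the two clauses agree.\<close>
  define Q where "Q t S \<longleftrightarrow> (if S \<subseteq> P1 then t \<in> S \<and> R (projl t) (projl ` S) else
     if S \<subseteq> P2 then t \<in> S \<and> R (case_sum id id t) (case_sum id id ` S) else False)" for t S
  have P2sub: "P2 \<subseteq> Inl ` C1 \<union> Inr ` (B - C)" using B(3) by (auto simp: P2_def)
  have inj1: "inj_on projl P1" by (auto simp: P1_def inj_on_def)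
  have inj2: "inj_on (case_sum id id) P2" by (auto simp: P2_def inj_on_def)
  have finP: "finite P" using C1(1) B(1) finite_subset[OF B(2)] by (simp add: P_def P1_def P2_def)
  have valP: "valid P s Q"
    unfolding Q_def
    by (intro valid_glue valid_empty inj1 inj2) (auto simp: P1_def P2_def s_def srt_in split: sum.split)
  define j where "j b = (if b \<in> C then Inl b else Inr b :: nat + nat)" for b
  have j_P2: "j b \<in> P2" if "b \<in> B" for b using that by (auto simp: j_def P2_def)
  have j_id: "case_sum id id (j b) = b" for b by (simp add: j_def)
  have s_j: "s (j b) = srt b" for b by (simp add: j_def s_def)
  have P2_j: "\<exists>b\<in>B. p = j b" if "p \<in> P2" for p using that B(2) by (auto simp: j_def P2_def)
  define \<theta> where "\<theta> i = case_sum (\<lambda>c. Inl (x i c)) (\<lambda>b. j (\<xi> i b))" for i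
  have \<theta>Inl: "\<theta> i (Inl c) = Inl (x i c)" for i c by (simp add: \<theta>_def)
  have \<theta>j: "\<theta> i (j b) = j (\<xi> i b)" if "i < Suc ?n" "b \<in> B" for i b
  proof (cases "b \<in> C")
    case True
    hence "x i b \<in> C" using xC[OF that(1)] by blast
    thus ?thesis using True \<xi>(3)[OF that(1) True] by (simp add: \<theta>_def j_def x_def)
  qed (simp add: \<theta>_def j_def)
  have j_inj: "j b = j b' \<Longrightarrow> b = b'" for b b' by (auto simp: j_def split: if_splits)
  have \<theta>P1: "\<theta> i ` P1 = P1" if "i < Suc ?n" for i
  proof -
    have "\<theta> i ` P1 = Inl ` x i ` C1" by (simp add: P1_def image_image \<theta>Inl)
    thus ?thesis using xC1[OF that] by (simp add: P1_def)
  qed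
  have P2B: "P2 = j ` B" using P2_j j_P2 by blast
  have \<theta>P2: "\<theta> i ` P2 = P2" if "i < Suc ?n" for i
  proof -
    have "\<theta> i ` P2 = j ` \<xi> i ` B" unfolding P2B using \<theta>j[OF that] by (simp add: image_image)
    thus ?thesis using \<xi>(2)[OF that] P2B by simp
  qed
  have \<theta>P: "\<theta> i ` P = P" if "i < Suc ?n" for i
    using \<theta>P1[OF that] \<theta>P2[OF that] by (simp add: P_def image_Un)
  have \<theta>inj: "inj_on (\<theta> i) P" if "i < Suc ?n" for i
    using finP \<theta>P[OF that] by (simp add: eq_card_imp_inj_on)
  have sub: "\<theta> i ` S \<subseteq> P' \<longleftrightarrow> S \<subseteq> P'" if "i < Suc ?n" "S \<subseteq> P" "P' \<subseteq> P" "\<theta> i ` P' = P'" for i S P'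
  proof
    assume h: "\<theta> i ` S \<subseteq> P'"
    show "S \<subseteq> P'"
    proof
      fix p assume "p \<in> S"
      hence "p \<in> P" "\<theta> i p \<in> \<theta> i ` P'" using h that(2,4) by auto
      thus "p \<in> P'" using inj_on_image_mem_iff[OF \<theta>inj[OF that(1)] _ that(3)] by blast
    qed
  next
    assume "S \<subseteq> P'"
    thus "\<theta> i ` S \<subseteq> P'" using image_mono[of S P' "\<theta> i"] that(4) by simp
  qed
  have \<theta>emb: "emb (\<theta> i) P s Q s Q" if i: "i < Suc ?n" for i
  proof (rule embI)
    show "inj_on (\<theta> i) P" by (rule \<theta>inj[OF i])
    show "s (\<theta> i p) = s p" if pP: "p \<in> P" for p
    proof (cases "p \<in> P1")
      case True
      thus ?thesis using Gr_srt[OF xG[OF i]] by (auto simp: P1_def \<theta>Inl s_def)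
    next
      case False
      then obtain b where "b \<in> B" "p = j b" using P2_j pP unfolding P_def by blast
      thus ?thesis using \<theta>j[OF i] s_j emb_sort[OF \<xi>(1)[OF i]] by simp
    qed
    fix S t assume S: "finite S" "S \<subseteq> P" "t \<in> S"
    have t: "\<theta> i t \<in> \<theta> i ` S" using S(3) by blast
    have 1: "(\<theta> i ` S \<subseteq> P1) = (S \<subseteq> P1)" and 2: "(\<theta> i ` S \<subseteq> P2) = (S \<subseteq> P2)"
      using sub[OF i S(2)] \<theta>P1[OF i] \<theta>P2[OF i] by (auto simp only: P_def Un_upper1 Un_upper2)
    show "Q (\<theta> i t) (\<theta> i ` S) = Q t S"
    proof (cases "S \<subseteq> P1")
      case True
      have pl: "projl (\<theta> i p) = x i (projl p)" if "p \<in> S" for p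
        using that True by (auto simp: P1_def \<theta>Inl)
      have "projl ` \<theta> i ` S = x i ` projl ` S" using pl by (simp add: image_image)
      thus ?thesis using True pl[OF S(3)] Gr_R[OF xG[OF i], of "projl t" "projl ` S"] t S(3)
        unfolding Q_def 1 by simp
    next
      case F1: False
      show ?thesis
      proof (cases "S \<subseteq> P2")
        case True
        let ?c = "case_sum id id"
        have pl: "?c (\<theta> i p) = \<xi> i (?c p) \<and> ?c p \<in> B" if pS: "p \<in> S" for p
        proof -
          obtain b where "b \<in> B" "p = j b" using P2_j True pS by blast
          thus ?thesis using \<theta>j[OF i] by (simp add: j_id)
        qed
        have "?c ` \<theta> i ` S = \<xi> i ` ?c ` S" using pl by (simp add: image_image)
        moreover have "R (\<xi> i (?c t)) (\<xi> i ` ?c ` S) = R (?c t) (?c ` S)"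
          using S pl by (intro emb_rel[OF \<xi>(1)[OF i]]) auto
        ultimately show ?thesis using F1 True pl[OF S(3)] t S(3)
          unfolding Q_def 1 2 by simp
      next
        case False
        thus ?thesis using F1 unfolding Q_def 1 2 by simp
      qed
    qed
  qed
  have Inlemb: "emb Inl C1 srt R s Q"
  proof (rule embI)
    fix S t assume S: "finite S" "S \<subseteq> C1" "t \<in> (S :: nat set)"
    have "Inl ` S \<subseteq> P1" using S by (auto simp: P1_def)
    moreover have "projl ` (Inl ` S :: (nat + nat) set) = S" by (simp add: image_image)
    ultimately show "Q (Inl t) (Inl ` S) = R t S" using S(3) unfolding Q_def by simp
  qed (auto simp: s_def)
  have C1P: "Inl ` C1 \<subseteq> P" by (auto simp: P_def P1_def)
  have inv1: "invariant xs C1" using C1(2) by (simp add: invariant_snoc)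
  have "\<exists>e. emb e P s Q srt R \<and> (\<forall>c\<in>C1. e (Inl c) = c) \<and> (\<forall>i<?n. \<forall>p\<in>P. e (\<theta> i p) = (xs ! i) (e p))"
  proof (rule gen_realize[OF xs finP valP C1(1) inv1 Inlemb C1P])
    fix i assume i: "i < ?n"
    show "emb (\<theta> i) P s Q s Q" "\<theta> i ` P = P" using i by (auto intro!: \<theta>emb \<theta>P)
    show "\<theta> i (Inl c) = Inl ((xs ! i) c)" for c using i by (simp add: \<theta>Inl x_def nth_append)
  qed
  then obtain e where e: "emb e P s Q srt R" "\<And>c. c \<in> C1 \<Longrightarrow> e (Inl c) = c"
    "\<And>i p. i < ?n \<Longrightarrow> p \<in> P \<Longrightarrow> e (\<theta> i p) = (xs ! i) (e p)" by blast
  let ?r = "inv_into P e" and ?\<zeta> = "\<theta> ?n"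
  have r: "?r (e p) = p" if "p \<in> P" for p using inv_into_f_f[OF emb_inj[OF e(1)] that] .
  have rC: "?r ` e ` P = P" by (force simp: r)
  have "emb (\<lambda>b. ?\<zeta> (?r b)) (e ` P) srt R s Q"
    by (rule emb_trans[OF emb_inv_into[OF e(1)] \<theta>emb]) (simp_all add: rC)
  from emb_trans[OF this e(1)] have "emb (\<lambda>b. e (?\<zeta> (?r b))) (e ` P) srt R srt R"
    using rC \<theta>P[of ?n] by (metis image_image lessI order_refl)
  then obtain g' where g': "g' \<in> Gr" "\<forall>x\<in>e ` P. g' x = e (?\<zeta> (?r x))"
    using homogeneity[of "e ` P"] finP by blast
  have g'e: "g' (e p) = e (?\<zeta> p)" if "p \<in> P" for p using g'(2) that r by simp
  have agree: "g' c = g c" if c: "c \<in> C1" for c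
  proof -
    have "g c \<in> C1" using xC1[of ?n] c by (auto simp: x_def)
    thus ?thesis using g'e[of "Inl c"] e(2) c C1P by (auto simp: \<theta>Inl x_def)
  qed
  have jemb: "emb j B srt R s Q"
  proof (rule embI)
    show "inj_on j B" using j_inj by (auto intro: inj_onI)
    fix S t assume S: "finite S" "S \<subseteq> B" "t \<in> S"
    have im: "case_sum id id ` j ` S = S" by (simp add: image_image j_id)
    have im1: "projl ` j ` S = S" if "j ` S \<subseteq> P1"
    proof -
      have "projl (j b) = b" if "b \<in> S" for b using that \<open>j ` S \<subseteq> P1\<close> by (auto simp: P1_def j_def split: if_splits)
      thus ?thesis by (simp add: image_image)
    qed
    have t1: "projl (j t) = t" if "j ` S \<subseteq> P1" using that S(3) by (auto simp: P1_def j_def split: if_splits)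
    have "j ` S \<subseteq> P2" using S(2) j_P2 by blast
    thus "Q (j t) (j ` S) = R t S" using im im1 t1 S(3) by (simp add: Q_def j_id)
  qed (rule s_j)
  have "emb (\<lambda>b. e (j b)) B srt R srt R"
    by (rule emb_trans[OF jemb e(1)]) (use j_P2 in \<open>auto simp: P_def\<close>)
  moreover have "e (j c) = c" if "c \<in> C" for c using that e(2) B(3) by (auto simp: j_def)
  moreover have "e (j (\<xi> i b)) = ((xs @ [g']) ! i) (e (j b))" if "i < Suc ?n" "b \<in> B" for i b
  proof -
    have P: "j b \<in> P" using j_P2 that by (auto simp: P_def)
    have "e (j (\<xi> i b)) = e (\<theta> i (j b))" using \<theta>j[OF that] by simp
    also have "\<dots> = ((xs @ [g']) ! i) (e (j b))"
      using e(3)[OF _ P] g'e[OF P] that(1) by (cases "i = ?n") (auto simp: nth_append)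
    finally show ?thesis .
  qed
  ultimately show ?thesis using g'(1) agree
    by (intro bexI[of _ g'] exI[of _ "\<lambda>b. e (j b)"]) auto
qed

text \<open>Genericity quantifies over finite data only, coded here by lists, so it is a countable
  conjunction of conditions. Each is dense: \<open>gen_close\<close> supplies a finite invariant
  set, and \<open>free_amalgam\<close> realizes the prescribed extension without disturbing
  it.\<close>

lemma comeagre_gen:
  assumes xs: "gen xs"
  shows "comeagre {z. gen (xs @ [z])}"
proof -
  define \<xi> where "\<xi> zs i b = zs ! i ! b" for zs :: "nat list list" and i b
  define U where "U = (\<lambda>(F, C, B, zs). {z. (\<exists>D. finite D \<and> set F \<subseteq> D \<and> invariant (xs @ [z]) D) \<and>
    (set C \<subseteq> set B \<and> invariant (xs @ [z]) (set C) \<and>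
        (\<forall>i<Suc (length xs). emb (\<xi> zs i) (set B) srt R srt R \<and> \<xi> zs i ` set B = set B \<and> (\<forall>c\<in>set C. \<xi> zs i c = ((xs @ [z]) ! i) c)) \<longrightarrow>
        (\<exists>e. emb e (set B) srt R srt R \<and> (\<forall>c\<in>set C. e c = c) \<and> (\<forall>i<Suc (length xs). \<forall>b\<in>set B. e (\<xi> zs i b) = ((xs @ [z]) ! i) (e b))))})"
  show ?thesis
  proof (rule comeagre_countable[of "UNIV :: (nat list \<times> nat list \<times> nat list \<times> nat list list) set" U])
    fix i :: "nat list \<times> nat list \<times> nat list \<times> nat list list"
    obtain F C B zs where i: "i = (F, C, B, zs)" by (cases i) auto
    let ?cond = "\<lambda>z. set C \<subseteq> set B \<and> invariant (xs @ [z]) (set C) \<and>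
        (\<forall>i<Suc (length xs). emb (\<xi> zs i) (set B) srt R srt R \<and> \<xi> zs i ` set B = set B \<and> (\<forall>c\<in>set C. \<xi> zs i c = ((xs @ [z]) ! i) c))"
    let ?real = "\<lambda>z e. emb e (set B) srt R srt R \<and> (\<forall>c\<in>set C. e c = c) \<and> (\<forall>i<Suc (length xs). \<forall>b\<in>set B. e (\<xi> zs i b) = ((xs @ [z]) ! i) (e b))"
    have U: "z \<in> U i \<longleftrightarrow> (\<exists>D. finite D \<and> set F \<subseteq> D \<and> invariant (xs @ [z]) D) \<and> (?cond z \<longrightarrow> (\<exists>e. ?real z e))" for z
      by (simp add: U_def i)
    have nth_cong: "((xs @ [z]) ! i) c = ((xs @ [z']) ! i) c" if "i < Suc (length xs)" "z c = z' c" for z z' i and c :: nat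
      using that by (cases "i = length xs") (auto simp: nth_append)
    show "dense_open (U i)"
    proof (rule dense_openI)
      fix g A assume g: "g \<in> Gr" and A: "finite (A :: nat set)"
      obtain g1 D where g1: "g1 \<in> Gr" "finite D" "A \<union> set F \<union> set C \<subseteq> D" "invariant (xs @ [g1]) D" "\<forall>x\<in>A \<union> set F \<union> set C. g1 x = g x"
        using gen_close[OF xs g, of "A \<union> set F \<union> set C"] A by auto
      have clD: "invariant (xs @ [z]) D" if "\<forall>x\<in>D. z x = g1 x" for z
      proof -
        have "z ` D = g1 ` D" using that by (intro image_cong) auto
        thus ?thesis using g1(4) by (simp add: invariant_snoc)
      qed
      \<comment> \<open>The premise depends on \<open>z\<close> only through its values on
        \<open>C\<close>, which are settled by now: it either fails on the whole neighbourhood or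
        holds on all of it and can be answered.\<close>
      have cond_cong: "?cond z \<longleftrightarrow> ?cond g1" if z: "\<forall>x\<in>D. z x = g1 x" for z
      proof -
        have zC: "z c = g1 c" if "c \<in> set C" for c using z g1(3) that by blast
        have "z ` set C = g1 ` set C" using zC by (intro image_cong) auto
        hence "invariant (xs @ [z]) (set C) = invariant (xs @ [g1]) (set C)" by (simp add: invariant_snoc)
        moreover have "(\<forall>c\<in>set C. \<xi> zs i c = ((xs @ [z]) ! i) c) = (\<forall>c\<in>set C. \<xi> zs i c = ((xs @ [g1]) ! i) c)"
          if "i < Suc (length xs)" for i
        proof (intro ball_cong refl)
          fix c assume "c \<in> set C"
          thus "(\<xi> zs i c = ((xs @ [z]) ! i) c) = (\<xi> zs i c = ((xs @ [g1]) ! i) c)"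
            using nth_cong[OF that, of z c g1] zC by simp
        qed
        ultimately show ?thesis by auto
      qed
      show "\<exists>g'\<in>Gr. \<exists>A'. finite A' \<and> A \<subseteq> A' \<and> (\<forall>x\<in>A. g' x = g x) \<and> (\<forall>z\<in>Gr. (\<forall>x\<in>A'. z x = g' x) \<longrightarrow> z \<in> U i)"
      proof (cases "?cond g1")
        case False
        have "z \<in> U i" if z: "\<forall>x\<in>D. z x = g1 x" for z
          unfolding U using False cond_cong[OF z] clD[OF z] g1(2,3) by blast
        thus ?thesis using g1 by (intro bexI[of _ g1] exI[of _ D]) auto
      next
        case True
        have "\<exists>g'\<in>Gr. \<exists>e. (\<forall>x\<in>D. g' x = g1 x) \<and> ?real g' e"
          using True g1(3) by (intro free_amalgam[OF xs g1(1,2,4)]) auto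
        then obtain g' e where g': "g' \<in> Gr" "\<forall>x\<in>D. g' x = g1 x" "?real g' e" by blast
        let ?A = "D \<union> e ` set B"
        have "z \<in> U i" if z: "\<forall>x\<in>?A. z x = g' x" for z
        proof -
          have zD: "\<forall>x\<in>D. z x = g1 x" using z g'(2) by simp
          have "((xs @ [z]) ! i) (e b) = ((xs @ [g']) ! i) (e b)" if "i < Suc (length xs)" "b \<in> set B" for i b
            using z that by (intro nth_cong) auto
          hence "?real z e" using g'(3) by simp
          thus ?thesis unfolding U using clD[OF zD] g1(2,3) by blast
        qed
        thus ?thesis using g1 g' by (intro bexI[of _ g'] exI[of _ ?A]) auto
      qed
    qed
  next
    fix z assume z: "z \<in> Gr" "\<And>i. i \<in> UNIV \<Longrightarrow> z \<in> U i"
    have "gen (xs @ [z])"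
      unfolding gen_def
    proof (intro conjI allI impI)
      show "set (xs @ [z]) \<subseteq> Gr" using z(1) gen_Gr[OF xs] by auto
    next
      fix F :: "nat set" assume "finite F"
      then obtain Fl where "set Fl = F" using finite_list by blast
      thus "\<exists>C. finite C \<and> F \<subseteq> C \<and> invariant (xs @ [z]) C"
        using z(2)[of "(Fl, [], [], [])"] by (auto simp: U_def)
    next
      fix C B \<zeta> assume h: "finite B \<and> C \<subseteq> B \<and> invariant (xs @ [z]) C \<and>
        (\<forall>i<length (xs @ [z]). emb (\<zeta> i) B srt R srt R \<and> \<zeta> i ` B = B \<and> (\<forall>c\<in>C. \<zeta> i c = ((xs @ [z]) ! i) c))"
      note finB = conjunct1[OF h] and CB = conjunct1[OF conjunct2[OF h]]
        and invC = conjunct1[OF conjunct2[OF conjunct2[OF h]]]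
        and hi = conjunct2[OF conjunct2[OF conjunct2[OF h]], rule_format, unfolded length_append_singleton]
      obtain Bl where Bl: "set Bl = B" using finite_list[OF finB] by blast
      have "finite C" using CB finB by (rule finite_subset)
      then obtain Cl where Cl: "set Cl = C" using finite_list by blast
      \<comment> \<open>A common bound for \<open>B\<close>, so that the maps can be coded by their
        tables of values below it.\<close>
      define m where "m = Suc (Max (insert 0 B))"
      have m: "b < m" if "b \<in> B" for b using finB that by (auto simp: m_def less_Suc_eq_le)
      define zs where "zs = map (\<lambda>i. map (\<zeta> i) [0..<m]) [0..<Suc (length xs)]"
      have zs: "\<xi> zs i b = \<zeta> i b" if "i < Suc (length xs)" "b \<in> B" for i b
        using that m unfolding \<xi>_def zs_def by (simp del: upt_Suc)
      have e: "emb (\<xi> zs i) B srt R srt R = emb (\<zeta> i) B srt R srt R" if "i < Suc (length xs)" for i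
        using zs that by (intro emb_cong) auto
      have im: "\<xi> zs i ` B = \<zeta> i ` B" if "i < Suc (length xs)" for i
        using zs that by (intro image_cong) auto
      have c: "\<xi> zs i c = \<zeta> i c" if "i < Suc (length xs)" "c \<in> C" for i c using zs[OF that(1)] that(2) CB by blast
      have "z \<in> U ([], Cl, Bl, zs)" using z(2) by simp
      hence "\<exists>e. emb e B srt R srt R \<and> (\<forall>c\<in>C. e c = c) \<and> (\<forall>i<Suc (length xs). \<forall>b\<in>B. e (\<xi> zs i b) = ((xs @ [z]) ! i) (e b))"
        unfolding U_def split_conv mem_Collect_eq Cl Bl
      proof (elim conjE impE)
        show "C \<subseteq> B \<and> invariant (xs @ [z]) C \<and>
          (\<forall>i<Suc (length xs). emb (\<xi> zs i) B srt R srt R \<and> \<xi> zs i ` B = B \<and> (\<forall>c\<in>C. \<xi> zs i c = ((xs @ [z]) ! i) c))"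
          using CB invC hi by (simp add: e im c)
      qed
      thus "\<exists>e. emb e B srt R srt R \<and> (\<forall>c\<in>C. e c = c) \<and>
        (\<forall>i<length (xs @ [z]). \<forall>b\<in>B. e (\<zeta> i b) = ((xs @ [z]) ! i) (e b))"
        using zs by auto
    qed
    thus "z \<in> {z. gen (xs @ [z])}" by simp
  qed simp
qed

text \<open>\<open>A\<close> is enlarged to a finite invariant set \<open>C\<close> through
  \<open>x\<close>. Read through \<open>g\<close>, the action of \<open>us\<close> on
  \<open>C\<close> is a finite extension of the action of \<open>vs\<close> on the image of
  \<open>A\<close>, and genericity of \<open>vs\<close> realizes it.\<close>

lemma gen_conjugate_step:
  assumes us: "gen us" and vs: "gen vs" and len: "length us = length vs"
    and A: "finite A" "invariant us A" and g: "g \<in> Gr" "\<forall>i<length us. \<forall>a\<in>A. g ((us ! i) a) = (vs ! i) (g a)"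
  shows "\<exists>A' g'. finite A' \<and> invariant us A' \<and> g' \<in> Gr \<and> (\<forall>i<length us. \<forall>a\<in>A'. g' ((us ! i) a) = (vs ! i) (g' a)) \<and>
    insert x A \<subseteq> A' \<and> (\<forall>a\<in>A. g' a = g a)"
proof -
  obtain C where C: "finite C" "insert x A \<subseteq> C" "invariant us C"
    using gen_invariant[OF us, of "insert x A"] A by auto
  have u: "us ! i \<in> Gr" "us ! i ` A = A" "us ! i ` C = C" if "i < length us" for i
    using nth_mem[OF that] gen_Gr[OF us] A(2) C(3) by (auto simp only: invariant_def)
  have "\<exists>e. emb e C srt R srt R \<and> (\<forall>c\<in>g ` A. e (ginv g c) = c) \<and>
     (\<forall>i<length vs. \<forall>p\<in>C. e ((us ! i) p) = (vs ! i) (e p))"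
  proof (rule gen_realize[OF vs C(1) valid_subset[OF valid_M subset_UNIV]])
    show "finite (g ` A)" using A by simp
    show "invariant vs (g ` A)"
      unfolding invariant_def
    proof
      fix v assume "v \<in> set vs"
      then obtain i where i: "i < length us" "v = vs ! i" using len by (metis in_set_conv_nth)
      have "v ` g ` A = g ` (us ! i) ` A" using g(2) i by (simp add: image_image)
      thus "v ` g ` A = g ` A" using u(2)[OF i(1)] by simp
    qed
    show "emb (ginv g) (g ` A) srt R srt R" by (rule Gr_emb[OF Gr_inv[OF g(1)]])
    show "ginv g ` g ` A \<subseteq> C" using C(2) g(1) by auto
    fix i assume "i < length vs"
    hence i: "i < length us" using len by simp
    show "emb (us ! i) C srt R srt R" by (rule Gr_emb[OF u(1)[OF i]])
    show "us ! i ` C = C" by (rule u(3)[OF i])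
    fix c assume "c \<in> g ` A"
    then obtain a where a: "a \<in> A" "c = g a" by blast
    thus "(us ! i) (ginv g c) = ginv g ((vs ! i) c)" using g i Gr_inv_f[OF g(1), of "(us ! i) a"] by simp
  qed
  then obtain e where e: "emb e C srt R srt R" "\<forall>c\<in>g ` A. e (ginv g c) = c"
    "\<forall>i<length us. \<forall>p\<in>C. e ((us ! i) p) = (vs ! i) (e p)" using len by auto
  obtain g' where g': "g' \<in> Gr" "\<forall>x\<in>C. g' x = e x" using homogeneity[OF C(1) e(1)] by blast
  have "\<forall>i<length us. \<forall>a\<in>C. g' ((us ! i) a) = (vs ! i) (g' a)"
  proof (intro allI impI ballI)
    fix i a assume i: "i < length us" and a: "a \<in> C"
    hence "(us ! i) a \<in> C" using u(3) by blast
    thus "g' ((us ! i) a) = (vs ! i) (g' a)" using g'(2) e(3) a i by simp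
  qed
  moreover have "\<forall>a\<in>A. g' a = g a" using g'(2) e(2) C(2) g(1) by auto
  ultimately show ?thesis using C g'(1) by blast
qed

text \<open>Back and forth between finite invariant sets. The two tuples play symmetric roles, so
  the backward step is the forward step for the inverse map.\<close>

lemma gen_conjugate:
  assumes us: "gen us" and vs: "gen vs" and len: "length us = length vs"
    and A: "finite A" "invariant us A" "\<forall>i<length us. \<forall>a\<in>A. (us ! i) a = (vs ! i) a"
  shows "\<exists>f\<in>Gr. (\<forall>a\<in>A. f a = a) \<and> (\<forall>i<length us. \<forall>x. f ((us ! i) x) = (vs ! i) (f x))"
proof -
  let ?P = "\<lambda>A g. finite A \<and> invariant us A \<and> g \<in> Gr \<and> (\<forall>i<length us. \<forall>a\<in>A. g ((us ! i) a) = (vs ! i) (g a))"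
  have forth: "\<exists>A' h'. ?P A' h' \<and> A \<subseteq> A' \<and> (\<forall>a\<in>A. h' a = h a) \<and> x \<in> A'" if "?P A h" for A h x
    using gen_conjugate_step[OF us vs len, of A h x] that by auto
  have backw: "\<exists>A' h'. ?P A' h' \<and> A \<subseteq> A' \<and> (\<forall>a\<in>A. h' a = h a) \<and> y \<in> h' ` A'" if Ah: "?P A h" for A h y
  proof -
    have u: "us ! i \<in> Gr" "us ! i ` A = A" if "i < length us" for i
      using nth_mem[OF that] gen_Gr[OF us] Ah by (auto simp only: invariant_def)
    have h: "h \<in> Gr" using Ah by simp
    have 1: "invariant vs (h ` A)"
      unfolding invariant_def
    proof
      fix v assume "v \<in> set vs"
      then obtain i where i: "i < length us" "v = vs ! i" using len by (metis in_set_conv_nth)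
      have "v ` h ` A = h ` (us ! i) ` A" using Ah i by (simp add: image_image)
      thus "v ` h ` A = h ` A" using u(2)[OF i(1)] by simp
    qed
    have 2: "\<forall>i<length vs. \<forall>a\<in>h ` A. ginv h ((vs ! i) a) = (us ! i) (ginv h a)"
    proof (intro allI impI ballI)
      fix i a assume i: "i < length vs" and "a \<in> h ` A"
      then obtain b where b: "b \<in> A" "a = h b" by blast
      hence "(vs ! i) a = h ((us ! i) b)" using Ah i len by simp
      thus "ginv h ((vs ! i) a) = (us ! i) (ginv h a)" using h b by simp
    qed
    obtain A' k where k: "finite A'" "invariant vs A'" "k \<in> Gr" "\<forall>i<length vs. \<forall>a\<in>A'. k ((vs ! i) a) = (us ! i) (k a)"
      "insert y (h ` A) \<subseteq> A'" "\<forall>a\<in>h ` A. k a = ginv h a"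
      using gen_conjugate_step[OF vs us len[symmetric] _ 1 Gr_inv[OF h] 2, of y] Ah by auto
    have v: "vs ! i ` A' = A'" if "i < length vs" for i
      using nth_mem[OF that] k(2) by (auto simp only: invariant_def)
    have kA: "k (h a) = a" if "a \<in> A" for a using k(6) that h by simp
    have "?P (k ` A') (ginv k)"
    proof (intro conjI)
      show "finite (k ` A')" using k(1) by simp
      show "ginv k \<in> Gr" by (rule Gr_inv[OF k(3)])
      show "invariant us (k ` A')"
        unfolding invariant_def
      proof
        fix u assume "u \<in> set us"
        then obtain i where i: "i < length vs" "u = us ! i" using len by (metis in_set_conv_nth)
        have "u ` k ` A' = k ` (vs ! i) ` A'" using k(4) i by (simp add: image_image)
        thus "u ` k ` A' = k ` A'" using v[OF i(1)] by simp
      qed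
      show "\<forall>i<length us. \<forall>a\<in>k ` A'. ginv k ((us ! i) a) = (vs ! i) (ginv k a)"
      proof (intro allI impI ballI)
        fix i a assume i: "i < length us" and "a \<in> k ` A'"
        then obtain b where b: "b \<in> A'" "a = k b" by blast
        hence "(us ! i) a = k ((vs ! i) b)" using k(4) i len by simp
        thus "ginv k ((us ! i) a) = (vs ! i) (ginv k a)" using k(3) b by simp
      qed
    qed
    moreover have "A \<subseteq> k ` A'" using kA k(5) by force
    moreover have "\<forall>a\<in>A. ginv k a = h a"
    proof
      fix a assume "a \<in> A"
      thus "ginv k a = h a" using Gr_inv_f[OF k(3), of "h a"] kA by simp
    qed
    moreover have "y \<in> ginv k ` k ` A'" using k(3,5) by (force simp: image_image)
    ultimately show ?thesis
      by (intro exI[of _ "k ` A'"] exI[of _ "ginv k"] conjI) ((elim conjE, assumption)+)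
  qed
  have "\<exists>f. bij_betw f UNIV UNIV \<and> (\<forall>x\<in>A. f x = x) \<and>
    (\<forall>F. finite F \<and> F \<subseteq> UNIV \<longrightarrow> (\<exists>A h. ?P A h \<and> F \<subseteq> A \<and> (\<forall>x\<in>A. f x = h x)))"
  proof (rule back_and_forth[of UNIV UNIV ?P A "\<lambda>x. x"])
    show "A \<subseteq> UNIV \<and> h ` A \<subseteq> UNIV \<and> inj_on h A" if "?P A h" for A h
      using that Gr_inj by simp
    show "?P A (\<lambda>x. x)" using A Gr_id by simp
  qed (use forth backw in auto)
  then obtain f where f: "bij f" "\<forall>x\<in>A. f x = x"
    "\<And>F. finite F \<Longrightarrow> \<exists>A h. ?P A h \<and> F \<subseteq> A \<and> (\<forall>x\<in>A. f x = h x)" by auto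
  have "f \<in> Gr"
  proof (rule Gr_local[OF f(1)])
    fix F :: "nat set" assume F: "finite F"
    obtain A h where h: "?P A h \<and> F \<subseteq> A \<and> (\<forall>x\<in>A. f x = h x)" using f(3)[OF F] by (elim exE)
    show "\<exists>g\<in>Gr. \<forall>x\<in>F. f x = g x" by (rule bexI[of _ h]) (use h in auto)
  qed
  moreover have "f ((us ! i) x) = (vs ! i) (f x)" if i: "i < length us" for i x
  proof -
    obtain A h where A: "?P A h" "{x, (us ! i) x} \<subseteq> A" "\<forall>x\<in>A. f x = h x"
      using f(3)[of "{x, (us ! i) x}"] by auto
    hence "f x = h x" "f ((us ! i) x) = h ((us ! i) x)" by auto
    thus ?thesis using A(1,2) i by simp
  qed
  ultimately show ?thesis using f(2) by blast
qed

end

section \<open>Subgroups of small index\<close>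

context sort_pattern begin

text \<open>Only \<open>g j\<close> is replaced, by the composite of \<open>g i\<close> after some
  \<open>u\<close> that agrees on \<open>A\<close> with the quotient of the two and has a whole
  neighbourhood inside \<open>U\<close>.\<close>

lemma separate_pair:
  assumes U: "dense_open U" and g: "\<And>k :: 'i. g k \<in> Gr" and A: "finite A" and ij: "i \<noteq> j"
  shows "\<exists>g' A'. finite A' \<and> A \<subseteq> A' \<and> (\<forall>k. g' k \<in> Gr \<and> (\<forall>x\<in>A. g' k x = g k x)) \<and>
    (\<forall>z\<in>Gr. \<forall>w\<in>Gr. (\<forall>x\<in>A'. z x = g' i x) \<and> (\<forall>x\<in>A'. w x = g' j x) \<longrightarrow> (\<lambda>x. ginv z (w x)) \<in> U)"
proof -
  have "(\<lambda>x. ginv (g i) (g j x)) \<in> Gr" by (rule Gr_comp[OF Gr_inv[OF g] g])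
  from dense_openD[OF U this A] obtain u A1 where u: "u \<in> Gr" "finite A1" "A \<subseteq> A1"
    "\<forall>x\<in>A. u x = ginv (g i) (g j x)" "\<forall>z\<in>Gr. (\<forall>x\<in>A1. z x = u x) \<longrightarrow> z \<in> U"
    by (elim exE conjE) (rule that; assumption)
  define g' where "g' = g(j := \<lambda>x. g i (u x))"
  have g'i: "g' i = g i" and g'j: "g' j = (\<lambda>x. g i (u x))" using ij by (simp_all add: g'_def)
  have "g' k \<in> Gr \<and> (\<forall>x\<in>A. g' k x = g k x)" for k
    using g u(1,4) Gr_comp[OF g[of i] u(1)] by (simp add: g'_def)
  moreover have "(\<lambda>x. ginv z (w x)) \<in> U" if z: "z \<in> Gr" "w \<in> Gr" "\<forall>x\<in>A1 \<union> u ` A1. z x = g' i x" "\<forall>x\<in>A1 \<union> u ` A1. w x = g' j x" for z w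
  proof (rule u(5)[rule_format])
    show "(\<lambda>x. ginv z (w x)) \<in> Gr" by (rule Gr_comp[OF Gr_inv[OF z(1)] z(2)])
    fix x assume x: "x \<in> A1"
    have "w x = z (u x)" using z(3,4) x by (simp add: g'i g'j)
    thus "ginv z (w x) = u x" using z(1) by simp
  qed
  ultimately show ?thesis using u(2,3) by (intro exI[of _ g'] exI[of _ "A1 \<union> u ` A1"]) auto
qed

lemma separate_pairs:
  assumes U: "dense_open U" and g: "\<And>k :: 'i. g k \<in> Gr" and A: "finite A"
    and E: "finite E" "\<And>i j. (i, j) \<in> E \<Longrightarrow> i \<noteq> j"
  shows "\<exists>g' A'. finite A' \<and> A \<subseteq> A' \<and> (\<forall>k. g' k \<in> Gr \<and> (\<forall>x\<in>A. g' k x = g k x)) \<and>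
    (\<forall>(i, j)\<in>E. \<forall>z\<in>Gr. \<forall>w\<in>Gr. (\<forall>x\<in>A'. z x = g' i x) \<and> (\<forall>x\<in>A'. w x = g' j x) \<longrightarrow> (\<lambda>x. ginv z (w x)) \<in> U)"
  using E
proof (induction E rule: finite_induct)
  case empty
  show ?case using g A by (intro exI[of _ g] exI[of _ A]) auto
next
  case (insert p E)
  obtain i j where p: "p = (i, j)" by (cases p)
  have "\<exists>g' A'. finite A' \<and> A \<subseteq> A' \<and> (\<forall>k. g' k \<in> Gr \<and> (\<forall>x\<in>A. g' k x = g k x)) \<and>
    (\<forall>(i, j)\<in>E. \<forall>z\<in>Gr. \<forall>w\<in>Gr. (\<forall>x\<in>A'. z x = g' i x) \<and> (\<forall>x\<in>A'. w x = g' j x) \<longrightarrow> (\<lambda>x. ginv z (w x)) \<in> U)"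
    by (rule insert.IH) (use insert.prems in auto)
  then obtain g1 A1 where g1: "finite A1" "A \<subseteq> A1" "\<forall>k. g1 k \<in> Gr \<and> (\<forall>x\<in>A. g1 k x = g k x)"
    "\<forall>(i, j)\<in>E. \<forall>z\<in>Gr. \<forall>w\<in>Gr. (\<forall>x\<in>A1. z x = g1 i x) \<and> (\<forall>x\<in>A1. w x = g1 j x) \<longrightarrow> (\<lambda>x. ginv z (w x)) \<in> U"
    by (elim exE conjE) (rule that; assumption)
  have 1: "finite A1" "A \<subseteq> A1" "\<And>k. g1 k \<in> Gr" "\<And>k x. x \<in> A \<Longrightarrow> g1 k x = g k x"
    using g1 by simp_all
  have sepE: "(\<lambda>x. ginv z (w x)) \<in> U" if "(i, j) \<in> E" "z \<in> Gr" "w \<in> Gr" "\<forall>x\<in>A1. z x = g1 i x" "\<forall>x\<in>A1. w x = g1 j x" for i j z w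
    using g1(4)[THEN bspec, OF that(1), unfolded split_conv, rule_format, OF that(2,3)] that(4,5) by simp
  have ij: "i \<noteq> j" using insert.prems p by auto
  obtain g2 A2 where g2: "finite A2" "A1 \<subseteq> A2" "\<forall>k. g2 k \<in> Gr \<and> (\<forall>x\<in>A1. g2 k x = g1 k x)"
    "\<forall>z\<in>Gr. \<forall>w\<in>Gr. (\<forall>x\<in>A2. z x = g2 i x) \<and> (\<forall>x\<in>A2. w x = g2 j x) \<longrightarrow> (\<lambda>x. ginv z (w x)) \<in> U"
    using separate_pair[of U g1, OF U 1(3,1) ij] by (elim exE conjE) (rule that; assumption)
  have 2: "finite A2" "A1 \<subseteq> A2" "\<And>k. g2 k \<in> Gr" "\<And>k x. x \<in> A1 \<Longrightarrow> g2 k x = g1 k x"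
    using g2 by simp_all
  have "(\<lambda>x. ginv z (w x)) \<in> U" if "(k, l) \<in> insert p E" "z \<in> Gr" "w \<in> Gr" "\<forall>x\<in>A2. z x = g2 k x" "\<forall>x\<in>A2. w x = g2 l x" for k l z w
  proof (cases "(k, l) = p")
    case True
    hence "k = i" "l = j" using p by auto
    thus ?thesis using g2(4)[rule_format, OF that(2,3)] that(4,5) by simp
  next
    case False
    hence kl: "(k, l) \<in> E" using that(1) by blast
    have "\<forall>x\<in>A1. z x = g1 k x" "\<forall>x\<in>A1. w x = g1 l x" using that(4,5) 2(2,4) by auto
    thus ?thesis by (rule sepE[OF kl that(2,3)])
  qed
  hence "\<forall>(i, j)\<in>insert p E. \<forall>z\<in>Gr. \<forall>w\<in>Gr. (\<forall>x\<in>A2. z x = g2 i x) \<and> (\<forall>x\<in>A2. w x = g2 j x) \<longrightarrow> (\<lambda>x. ginv z (w x)) \<in> U"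
    by (intro ballI impI) (simp only: split_paired_all split_conv, intro ballI impI, blast)
  moreover have "g2 k \<in> Gr \<and> (\<forall>x\<in>A. g2 k x = g k x)" for k using 1 2 by auto
  ultimately show ?case using 1(2) 2(1,2) by (intro exI[of _ g2] exI[of _ A2] conjI allI) (assumption | blast)+
qed

text \<open>A Cantor scheme: the nodes of each level are automorphisms settled on a finite set, and
  the quotients of any two different nodes are pushed into the dense open sets considered so far.
  The branches give continuum many automorphisms with all quotients in \<open>S\<close>.\<close>

lemma comeagre_tree:
  assumes S: "comeagre S"
  shows "\<exists>y :: (nat \<Rightarrow> bool) \<Rightarrow> nat \<Rightarrow> nat. (\<forall>a. y a \<in> Gr) \<and> (\<forall>a b. a \<noteq> b \<longrightarrow> (\<lambda>x. ginv (y a) (y b x)) \<in> S)"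
proof -
  obtain U where U: "\<And>n. dense_open (U n)" "\<And>z. z \<in> Gr \<Longrightarrow> (\<And>n::nat. z \<in> U n) \<Longrightarrow> z \<in> S"
    using comeagreE[OF S] by blast
  define W where "W n = (\<Inter>i\<le>n. U i)" for n
  have W: "dense_open (W n)" for n unfolding W_def by (rule dense_open_finite_Int[OF U(1)])
  define good where "good n A g A' g' \<longleftrightarrow> A \<subseteq> A' \<and> n \<in> A' \<and>
      (\<forall>s. length s = Suc n \<longrightarrow> n \<in> g' s ` A' \<and> (\<forall>x\<in>A. g' s x = g (butlast s) x)) \<and>
      (\<forall>s t. length s = Suc n \<and> length t = Suc n \<and> s \<noteq> t \<longrightarrow>
         (\<forall>z\<in>Gr. \<forall>w\<in>Gr. (\<forall>x\<in>A'. z x = g' s x) \<and> (\<forall>x\<in>A'. w x = g' t x) \<longrightarrow> (\<lambda>x. ginv z (w x)) \<in> W n))"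
    for n :: nat and A A' :: "nat set" and g g' :: "bool list \<Rightarrow> nat \<Rightarrow> nat"
  have "\<exists>c. \<forall>n. (finite (fst (c n)) \<and> (\<forall>s. snd (c n) s \<in> Gr)) \<and> good n (fst (c n)) (snd (c n)) (fst (c (Suc n))) (snd (c (Suc n)))"
  proof (rule dependent_nat_choice)
    show "\<exists>c. finite (fst c) \<and> (\<forall>s::bool list. snd c s \<in> Gr)"
      by (rule exI[of _ "({}, \<lambda>_ x. x)"]) (simp add: Gr_id)
    fix c :: "nat set \<times> (bool list \<Rightarrow> nat \<Rightarrow> nat)" and n :: nat
    assume c: "finite (fst c) \<and> (\<forall>s. snd c s \<in> Gr)"
    define g1 where "g1 s = snd c (butlast s)" for s
    have g1: "g1 s \<in> Gr" for s using c by (simp add: g1_def)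
    let ?L = "{s :: bool list. length s = Suc n}"
    have L: "finite ?L" using finite_lists_length_eq[of "UNIV :: bool set" "Suc n"] by simp
    \<comment> \<open>The preimages of \<open>n\<close> under all nodes of the level are included so
      that \<open>n\<close> gets into the range along every branch.\<close>
    let ?A = "fst c \<union> {n} \<union> (\<lambda>s. ginv (g1 s) n) ` ?L"
    have "finite {(s, t). s \<in> ?L \<and> t \<in> ?L \<and> s \<noteq> t}"
      by (rule finite_subset[of _ "?L \<times> ?L"]) (use L in auto)
    moreover have "finite ?A" using c L by simp
    ultimately have "\<exists>g' A'. finite A' \<and> ?A \<subseteq> A' \<and> (\<forall>k. g' k \<in> Gr \<and> (\<forall>x\<in>?A. g' k x = g1 k x)) \<and>
      (\<forall>(i, j)\<in>{(s, t). s \<in> ?L \<and> t \<in> ?L \<and> s \<noteq> t}. \<forall>z\<in>Gr. \<forall>w\<in>Gr. (\<forall>x\<in>A'. z x = g' i x) \<and> (\<forall>x\<in>A'. w x = g' j x) \<longrightarrow> (\<lambda>x. ginv z (w x)) \<in> W n)"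
      by (intro separate_pairs[OF W g1]) auto
    then obtain g' A' where g': "finite A'" "?A \<subseteq> A'" "\<forall>k. g' k \<in> Gr \<and> (\<forall>x\<in>?A. g' k x = g1 k x)"
      "\<forall>(i, j)\<in>{(s, t). s \<in> ?L \<and> t \<in> ?L \<and> s \<noteq> t}. \<forall>z\<in>Gr. \<forall>w\<in>Gr. (\<forall>x\<in>A'. z x = g' i x) \<and> (\<forall>x\<in>A'. w x = g' j x) \<longrightarrow> (\<lambda>x. ginv z (w x)) \<in> W n"
      by (elim exE conjE) (rule that; assumption)
    have nA: "n \<in> g' s ` A'" if "length s = Suc n" for s
    proof -
      have m: "ginv (g1 s) n \<in> ?A" using that by blast
      hence "g' s (ginv (g1 s) n) = g1 s (ginv (g1 s) n)" using g'(3) by blast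
      also have "\<dots> = n" using g1 by simp
      finally have "g' s (ginv (g1 s) n) = n" .
      thus ?thesis using image_eqI[of n "g' s" "ginv (g1 s) n" A'] subsetD[OF g'(2) m] by simp
    qed
    have "good n (fst c) (snd c) A' g'"
      unfolding good_def
    proof (intro conjI allI impI ballI)
      show "fst c \<subseteq> A'" "n \<in> A'" using g'(2) by auto
      show "n \<in> g' s ` A'" if "length s = Suc n" for s by (rule nA[OF that])
      show "g' s x = snd c (butlast s) x" if "x \<in> fst c" for s x
        using g'(3)[rule_format, of s, THEN conjunct2, rule_format, of x] that by (simp add: g1_def)
      show "(\<lambda>x. ginv z (w x)) \<in> W n" if "length s = Suc n \<and> length t = Suc n \<and> s \<noteq> t" "z \<in> Gr" "w \<in> Gr"
        "(\<forall>x\<in>A'. z x = g' s x) \<and> (\<forall>x\<in>A'. w x = g' t x)" for s t z w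
        using g'(4)[THEN bspec[of _ _ "(s, t)"], unfolded split_conv, rule_format, OF _ that(2,3)] that(1,4) by simp
    qed
    thus "\<exists>c'. (finite (fst c') \<and> (\<forall>s. snd c' s \<in> Gr)) \<and> good n (fst c) (snd c) (fst c') (snd c')"
      using g'(1,3) by (intro exI[of _ "(A', g')"]) simp
  qed
  then obtain c where c: "\<forall>n. (finite (fst (c n)) \<and> (\<forall>s. snd (c n) s \<in> Gr)) \<and> good n (fst (c n)) (snd (c n)) (fst (c (Suc n))) (snd (c (Suc n)))"
    by (elim exE)
  define A where "A n = fst (c n)" for n
  define g where "g n = snd (c n)" for n
  have Ag: "\<And>n. finite (A n)" "\<And>n s. g n s \<in> Gr" "\<And>n. good n (A n) (g n) (A (Suc n)) (g (Suc n))"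
    using c by (simp_all add: A_def g_def)
  define r where "r a n = map a [0..<n]" for a :: "nat \<Rightarrow> bool" and n
  have r: "length (r a n) = n" "butlast (r a (Suc n)) = r a n" for a n by (simp_all add: r_def)
  have "\<exists>f\<in>Gr. \<forall>n. \<forall>x\<in>A n. f x = g n (r a n) x" for a
  proof (rule limit_in_Gr)
    show "g n (r a n) \<in> Gr" for n by (rule Ag(2))
    show "A n \<subseteq> A (Suc n)" "n \<in> A (Suc n)" "n \<in> g (Suc n) (r a (Suc n)) ` A (Suc n)" for n
      using Ag(3)[of n] r(1)[of a "Suc n"] unfolding good_def by blast+
    show "g (Suc n) (r a (Suc n)) x = g n (r a n) x" if "x \<in> A n" for n x
      using Ag(3)[of n] r[of a] that unfolding good_def by metis
  qed
  then obtain y where y: "\<And>a. y a \<in> Gr" "\<And>a n x. x \<in> A n \<Longrightarrow> y a x = g n (r a n) x" by metis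
  have "(\<lambda>x. ginv (y a) (y b x)) \<in> S" if ab: "a \<noteq> b" for a b
  proof (rule U(2))
    show "(\<lambda>x. ginv (y a) (y b x)) \<in> Gr" by (rule Gr_comp[OF Gr_inv[OF y(1)] y(1)])
    fix i
    obtain k where k: "a k \<noteq> b k" using ab by blast
    \<comment> \<open>A level beyond the place where the branches differ and beyond
      \<open>i\<close>, so that \<open>W\<close> at this level is contained in
      \<open>U i\<close>.\<close>
    let ?n = "max i k"
    have "r a (Suc ?n) ! k \<noteq> r b (Suc ?n) ! k" using k by (simp add: r_def del: upt_Suc)
    hence "r a (Suc ?n) \<noteq> r b (Suc ?n)" by metis
    hence "(\<lambda>x. ginv (y a) (y b x)) \<in> W ?n"
      using Ag(3)[of ?n, unfolded good_def, THEN conjunct2, THEN conjunct2, THEN conjunct2, rule_format,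
         of "r a (Suc ?n)" "r b (Suc ?n)" "y a" "y b"] r(1) y by auto
    thus "(\<lambda>x. ginv (y a) (y b x)) \<in> U i" by (simp add: W_def)
  qed
  thus ?thesis using y(1) by blast
qed

definition subgrp :: "(nat \<Rightarrow> nat) set \<Rightarrow> bool" where
  "subgrp H \<longleftrightarrow> H \<subseteq> Gr \<and> (\<lambda>x. x) \<in> H \<and> (\<forall>g\<in>H. \<forall>h\<in>H. (\<lambda>x. g (h x)) \<in> H) \<and> (\<forall>g\<in>H. ginv g \<in> H)"

text \<open>The index being below the continuum is expressed as the absence of pairwise different
  left cosets indexed by all binary sequences; no cardinal arithmetic is involved.\<close>

definition small_index :: "(nat \<Rightarrow> nat) set \<Rightarrow> bool" where
  "small_index H \<longleftrightarrow> \<not> (\<exists>h :: (nat \<Rightarrow> bool) \<Rightarrow> nat \<Rightarrow> nat. (\<forall>a. h a \<in> Gr) \<and>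
     (\<forall>a b. a \<noteq> b \<longrightarrow> (\<lambda>x. ginv (h a) (h b x)) \<notin> H))"

lemma subgrp_Gr: "subgrp H \<Longrightarrow> h \<in> H \<Longrightarrow> h \<in> Gr"
  by (auto simp: subgrp_def)

lemma subgrp_comp: "subgrp H \<Longrightarrow> g \<in> H \<Longrightarrow> h \<in> H \<Longrightarrow> (\<lambda>x. g (h x)) \<in> H"
  by (auto simp: subgrp_def)

lemma subgrp_inv: "subgrp H \<Longrightarrow> g \<in> H \<Longrightarrow> ginv g \<in> H"
  by (auto simp: subgrp_def)

lemma ginv_eqI: "g \<in> Gr \<Longrightarrow> (\<And>x. g (h x) = x) \<Longrightarrow> ginv g = h"
  by (metis Gr_inv_f ext)

text \<open>Of continuum many automorphisms with all quotients in \<open>S\<close>, two lie in the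
  same left coset of \<open>H\<close>, and their quotient is in both sets.\<close>

lemma small_index_comeagre:
  assumes "small_index H" "comeagre S"
  shows "\<exists>y\<in>Gr. y \<in> H \<and> y \<in> S"
proof -
  obtain y :: "(nat \<Rightarrow> bool) \<Rightarrow> nat \<Rightarrow> nat" where y: "\<And>a. y a \<in> Gr" "\<And>a b. a \<noteq> b \<Longrightarrow> (\<lambda>x. ginv (y a) (y b x)) \<in> S"
  proof -
    from comeagre_tree[OF assms(2)] obtain y :: "(nat \<Rightarrow> bool) \<Rightarrow> nat \<Rightarrow> nat" where
      "\<forall>a. y a \<in> Gr" "\<forall>a b. a \<noteq> b \<longrightarrow> (\<lambda>x. ginv (y a) (y b x)) \<in> S"
      by (elim exE conjE) (rule that; assumption)
    thus ?thesis by (intro that[of y]) simp_all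
  qed
  obtain a b where ab: "a \<noteq> b" "(\<lambda>x. ginv (y a) (y b x)) \<in> H"
  proof -
    have "\<not> ((\<forall>a. y a \<in> Gr) \<and> (\<forall>a b. a \<noteq> b \<longrightarrow> (\<lambda>x. ginv (y a) (y b x)) \<notin> H))"
      using assms(1)[unfolded small_index_def not_ex, THEN spec[of _ y]] .
    thus ?thesis using y(1) that by auto
  qed
  moreover have "(\<lambda>x. ginv (y a) (y b x)) \<in> Gr" by (rule Gr_comp[OF Gr_inv[OF y(1)] y(1)])
  ultimately show ?thesis using y(2) by blast
qed

lemma gen_conjugate_last:
  assumes y: "gen (xs @ [y])" and z: "gen (xs @ [z])" and C: "finite C" "invariant (xs @ [y]) C" "\<forall>c\<in>C. y c = z c"
  shows "\<exists>f\<in>Gr. (\<forall>c\<in>C. f c = c) \<and> (\<forall>x\<in>set xs. \<forall>p. f (x p) = x (f p)) \<and> (\<forall>p. f (y p) = z (f p))"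
proof -
  have "\<forall>i<length (xs @ [y]). \<forall>a\<in>C. ((xs @ [y]) ! i) a = ((xs @ [z]) ! i) a"
    using C(3) by (auto simp: nth_append less_Suc_eq)
  then obtain f where f: "f \<in> Gr" "\<forall>a\<in>C. f a = a" "\<And>i p. i < Suc (length xs) \<Longrightarrow> f (((xs @ [y]) ! i) p) = ((xs @ [z]) ! i) (f p)"
    using gen_conjugate[OF y z _ C(1,2)] by auto
  have "f (x p) = x (f p)" if x: "x \<in> set xs" for x p
  proof -
    obtain i where "i < length xs" "x = xs ! i" using x by (metis in_set_conv_nth)
    thus ?thesis using f(3)[of i p] by (simp add: nth_append)
  qed
  moreover have "f (y p) = z (f p)" for p using f(3)[of "length xs" p] by (simp add: nth_append)
  ultimately show ?thesis using f by blast
qed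

text \<open>Generic automorphisms over \<open>xs\<close> that agree on a finite invariant set are
  conjugate by an element commuting with \<open>xs\<close>; it remains to find one in
  \<open>H\<close> and one outside that agree in this way. Both are appended to the tuple, so that
  later conjugators commute with them.\<close>

lemma conjugating_step:
  assumes H: "subgrp H" "small_index H" and nb: "\<forall>B. finite B \<longrightarrow> (\<exists>g\<in>Gr. (\<forall>x\<in>B. g x = x) \<and> g \<notin> H)"
    and xs: "gen xs" and A: "finite A"
  shows "\<exists>f ws y0 y1. f \<in> Gr \<and> (\<forall>a\<in>A. f a = a) \<and> (\<forall>x\<in>set xs. \<forall>p. f (x p) = x (f p)) \<and> gen (xs @ ws) \<and>
    y0 \<in> set ws \<and> y1 \<in> set ws \<and> y0 \<in> H \<and> y1 \<notin> H \<and> (\<forall>p. f (y0 p) = y1 (f p))"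
proof -
  let ?S = "\<lambda>us. {z. gen (us @ [z])}"
  obtain y where y: "y \<in> Gr" "y \<in> H" "gen (xs @ [y])"
    using small_index_comeagre[OF H(2) comeagre_gen[OF xs]] by blast
  obtain C where C: "finite C" "A \<subseteq> C" "invariant (xs @ [y]) C" using gen_invariant[OF y(3) A] by blast
  obtain g where g: "g \<in> Gr" "\<forall>x\<in>C. g x = x" "g \<notin> H" using nb C(1) by blast
  \<comment> \<open>Close to \<open>y\<close>, both \<open>z\<close> and \<open>?t z\<close> will be
    generic. Since \<open>g\<close> is a product of \<open>y\<close>, \<open>z\<close>,
    \<open>?t z\<close> and their inverses, they cannot both lie in \<open>H\<close>.\<close>
  let ?t = "\<lambda>z x. y (g (ginv z (y x)))"
  have "comeagre {z. ?t z \<in> ?S xs}"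
    using comeagre_translate_inverse[OF Gr_comp[OF y(1) g(1)] y(1) comeagre_gen[OF xs]] .
  from comeagre_Int[OF comeagre_gen[OF xs] this]
  have c0: "comeagre (?S xs \<inter> {z. ?t z \<in> ?S xs})" .
  obtain z where z: "z \<in> Gr" "z \<in> ?S xs \<inter> {z. ?t z \<in> ?S xs}" "\<forall>x\<in>C. z x = y x"
    using baire[OF c0 y(1) C(1)] by blast
  have tz: "?t z x = y x" if "x \<in> C" for x
  proof -
    have "ginv z (y x) = x" using z(1,3) that Gr_inv_f by metis
    thus ?thesis using g(2) that by simp
  qed
  have "\<exists>y1. gen (xs @ [y1]) \<and> y1 \<notin> H \<and> (\<forall>x\<in>C. y1 x = y x)"
  proof (cases "z \<in> H")
    case True
    have "?t z \<notin> H"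
    proof
      assume h: "?t z \<in> H"
      note iy = subgrp_inv[OF H(1) y(2)]
      have "(\<lambda>x. ginv y (?t z (ginv y (z x)))) \<in> H"
        using subgrp_comp[OF H(1) iy subgrp_comp[OF H(1) h subgrp_comp[OF H(1) iy True]]] .
      moreover have "(\<lambda>x. ginv y (?t z (ginv y (z x)))) = g" using y(1) z(1) by simp
      ultimately show False using g(3) by simp
    qed
    thus ?thesis using z(2) tz by (intro exI[of _ "?t z"]) auto
  next
    case False
    thus ?thesis using z(2,3) by (intro exI[of _ z]) auto
  qed
  then obtain y1 where y1: "gen (xs @ [y1])" "y1 \<notin> H" "\<forall>x\<in>C. y1 x = y x" by blast
  \<comment> \<open>\<open>y\<close> and \<open>y1\<close> need not be jointly generic over
    \<open>xs\<close>. A third automorphism \<open>w\<close>, generic over each of the two longer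
    tuples, forms the desired pair with \<open>y1\<close> if it lies in \<open>H\<close>, and with
    \<open>y\<close> if not.\<close>
  have c1: "comeagre (?S xs \<inter> (?S (xs @ [y]) \<inter> ?S (xs @ [y1])))"
    by (intro comeagre_Int comeagre_gen xs y y1)
  obtain w where w: "w \<in> Gr" "gen (xs @ [w])" "gen ((xs @ [y]) @ [w])" "gen ((xs @ [y1]) @ [w])" "\<forall>x\<in>C. w x = y x"
    using baire[OF c1 y(1) C(1)] by blast
  show ?thesis
  proof (cases "w \<in> H")
    case False
    obtain f where "f \<in> Gr" "\<forall>c\<in>C. f c = c" "\<forall>x\<in>set xs. \<forall>p. f (x p) = x (f p)" "\<forall>p. f (y p) = w (f p)"
      using gen_conjugate_last[OF y(3) w(2) C(1,3)] w(5) by auto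
    thus ?thesis using False y w C(2)
      by (intro exI[of _ f] exI[of _ "[y, w]"] exI[of _ y] exI[of _ w]) auto
  next
    case True
    have "w ` C = y ` C" using w(5) by (intro image_cong) auto
    hence "invariant (xs @ [w]) C" using C(3) by (simp add: invariant_snoc)
    then obtain f where "f \<in> Gr" "\<forall>c\<in>C. f c = c" "\<forall>x\<in>set xs. \<forall>p. f (x p) = x (f p)" "\<forall>p. f (w p) = y1 (f p)"
      using gen_conjugate_last[OF w(2) y1(1) C(1)] w(5) y1(3) by auto
    thus ?thesis using True y1 w C(2)
      by (intro exI[of _ f] exI[of _ "[y1, w]"] exI[of _ w] exI[of _ y1]) auto
  qed
qed

end

section \<open>The strong small index property\<close>

context sort_pattern begin

text \<open>Otherwise \<open>conjugating_step\<close> can be repeated forever. The infinite products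
  of the conjugators, each factor taken or omitted according to a binary sequence, converge to
  continuum many automorphisms. A quotient of two of them conjugates, up to inversion, some element
  of \<open>H\<close> to one outside, so it is not in \<open>H\<close>.\<close>

lemma small_index_open:
  assumes H: "subgrp H" "small_index H"
  shows "\<exists>A. finite A \<and> (\<forall>g\<in>Gr. (\<forall>x\<in>A. g x = x) \<longrightarrow> g \<in> H)"
proof (rule ccontr)
  assume neg: "\<not> ?thesis"
  have nb: "\<forall>B. finite B \<longrightarrow> (\<exists>g\<in>Gr. (\<forall>x\<in>B. g x = x) \<and> g \<notin> H)"
  proof (rule ccontr)
    assume "\<not> (\<forall>B. finite B \<longrightarrow> (\<exists>g\<in>Gr. (\<forall>x\<in>B. g x = x) \<and> g \<notin> H))"
    then obtain B where "finite B" "\<forall>g\<in>Gr. (\<forall>x\<in>B. g x = x) \<longrightarrow> g \<in> H" by blast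
    thus False using neg by blast
  qed
  \<comment> \<open>The points that the next factor has to fix: the numbers up to \<open>n\<close>,
    for the products to converge, and their preimages under all products so far, for the limits to
    be onto.\<close>
  define T where "T W n = {..n} \<union> (\<lambda>(w, k). ginv w k) ` (W \<times> {..n})" for W :: "(nat \<Rightarrow> nat) set" and n :: nat
  define St where "St xs W f y0 y1 xs' W' \<longleftrightarrow> (\<forall>x\<in>set xs. \<forall>p. f (x p) = x (f p)) \<and> set xs \<subseteq> set xs' \<and> f \<in> Gr \<and>
     y0 \<in> set xs' \<and> y1 \<in> set xs' \<and> y0 \<in> H \<and> y1 \<notin> H \<and> (\<forall>p. f (y0 p) = y1 (f p)) \<and> W' = W \<union> (\<lambda>w x. w (f x)) ` W"
    for xs xs' :: "(nat \<Rightarrow> nat) list" and W W' :: "(nat \<Rightarrow> nat) set" and f y0 y1 :: "nat \<Rightarrow> nat"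
  have "\<exists>c. \<forall>n. (gen (fst (c n)) \<and> finite (fst (snd (c n))) \<and> fst (snd (c n)) \<subseteq> Gr \<and> (n = 0 \<longrightarrow> fst (snd (c n)) = {\<lambda>x. x})) \<and>
     (\<exists>y0 y1. St (fst (c n)) (fst (snd (c n))) (snd (snd (c (Suc n)))) y0 y1 (fst (c (Suc n))) (fst (snd (c (Suc n)))) \<and>
        (\<forall>a\<in>T (fst (snd (c n))) n. snd (snd (c (Suc n))) a = a))"
  proof (rule dependent_nat_choice)
    show "\<exists>c :: (nat \<Rightarrow> nat) list \<times> (nat \<Rightarrow> nat) set \<times> (nat \<Rightarrow> nat). gen (fst c) \<and> finite (fst (snd c)) \<and> fst (snd c) \<subseteq> Gr \<and> (0 = (0::nat) \<longrightarrow> fst (snd c) = {\<lambda>x. x})"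
      by (rule exI[of _ "([], {\<lambda>x. x}, \<lambda>x. x)"]) (simp add: gen_Nil Gr_id)
    fix c :: "(nat \<Rightarrow> nat) list \<times> (nat \<Rightarrow> nat) set \<times> (nat \<Rightarrow> nat)" and n :: nat
    assume c: "gen (fst c) \<and> finite (fst (snd c)) \<and> fst (snd c) \<subseteq> Gr \<and> (n = 0 \<longrightarrow> fst (snd c) = {\<lambda>x. x})"
    define xs where "xs = fst c" define W where "W = fst (snd c)"
    have xs: "gen xs" and W: "finite W" "W \<subseteq> Gr" using c by (simp_all add: xs_def W_def)
    have "finite (T W n)" using W(1) by (simp add: T_def)
    from conjugating_step[OF H nb xs this] obtain f ws y0 y1 where
      f: "f \<in> Gr" "\<forall>a\<in>T W n. f a = a" "\<forall>x\<in>set xs. \<forall>p. f (x p) = x (f p)" "gen (xs @ ws)"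
        "y0 \<in> set ws" "y1 \<in> set ws" "y0 \<in> H" "y1 \<notin> H" "\<forall>p. f (y0 p) = y1 (f p)"
      by (elim exE conjE) (rule that; assumption)
    define W' where "W' = W \<union> (\<lambda>w x. w (f x)) ` W"
    have W': "finite W'" "W' \<subseteq> Gr" using W Gr_comp[OF _ f(1)] by (auto simp: W'_def)
    have "St xs W f y0 y1 (xs @ ws) W'" using f by (auto simp: St_def W'_def)
    thus "\<exists>c'. (gen (fst c') \<and> finite (fst (snd c')) \<and> fst (snd c') \<subseteq> Gr \<and> (Suc n = 0 \<longrightarrow> fst (snd c') = {\<lambda>x. x})) \<and>
     (\<exists>y0 y1. St (fst c) (fst (snd c)) (snd (snd c')) y0 y1 (fst c') (fst (snd c')) \<and>
        (\<forall>a\<in>T (fst (snd c)) n. snd (snd c') a = a))"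
      using f(2,4) W' unfolding xs_def[symmetric] W_def[symmetric]
      by (intro exI[of _ "(xs @ ws, W', f)"]) auto
  qed
  then obtain c where c: "\<forall>n. (gen (fst (c n)) \<and> finite (fst (snd (c n))) \<and> fst (snd (c n)) \<subseteq> Gr \<and> (n = 0 \<longrightarrow> fst (snd (c n)) = {\<lambda>x. x})) \<and>
     (\<exists>y0 y1. St (fst (c n)) (fst (snd (c n))) (snd (snd (c (Suc n)))) y0 y1 (fst (c (Suc n))) (fst (snd (c (Suc n)))) \<and>
        (\<forall>a\<in>T (fst (snd (c n))) n. snd (snd (c (Suc n))) a = a))" by (elim exE)
  define xs where "xs n = fst (c n)" for n
  define W where "W n = fst (snd (c n))" for n
  define f where "f n = snd (snd (c (Suc n)))" for n
  have W: "W n \<subseteq> Gr" "W 0 = {\<lambda>x. x}" for n using c unfolding W_def by blast+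
  have xs: "gen (xs n)" for n using c unfolding xs_def by blast
  have "\<exists>y0 y1. St (xs n) (W n) (f n) y0 y1 (xs (Suc n)) (W (Suc n)) \<and> (\<forall>a\<in>T (W n) n. f n a = a)" for n
    using c unfolding xs_def W_def f_def by blast
  then obtain y0 y1 where st: "\<And>n. St (xs n) (W n) (f n) (y0 n) (y1 n) (xs (Suc n)) (W (Suc n))"
    and fT: "\<And>n a. a \<in> T (W n) n \<Longrightarrow> f n a = a" by metis
  have f_comm: "f n (x p) = x (f n p)" if "x \<in> set (xs n)" for n x p using st[of n] that unfolding St_def by blast
  have fG: "f n \<in> Gr" for n using st[of n] unfolding St_def by blast
  have xs_mono: "set (xs m) \<subseteq> set (xs n)" if "m \<le> n" for m n
    by (rule lift_Suc_mono_le[of "\<lambda>n. set (xs n)", OF _ that]) (use st in \<open>simp add: St_def\<close>)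
  have WS: "W (Suc n) = W n \<union> (\<lambda>w x. w (f n x)) ` W n" for n using st[of n] unfolding St_def by blast
  have y: "y0 n \<in> set (xs (Suc n))" "y1 n \<in> set (xs (Suc n))" "y0 n \<in> H" "y1 n \<notin> H" "f n (y0 n p) = y1 n (f n p)" for n p
    using st[of n] unfolding St_def by blast+
  \<comment> \<open>New factors are multiplied on the right, so that cancelling a common initial
    product leaves only later factors.\<close>
  define w where "w a = rec_nat (\<lambda>x. x) (\<lambda>n u. if a n then (\<lambda>x. u (f n x)) else u)" for a :: "nat \<Rightarrow> bool"
  have w0: "w a 0 = (\<lambda>x. x)" for a by (simp add: w_def)
  have wS: "w a (Suc n) = (if a n then (\<lambda>x. w a n (f n x)) else w a n)" for a n by (simp add: w_def)
  have wW: "w a n \<in> W n" for a n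
  proof (induction n)
    case (Suc n)
    thus ?case unfolding wS WS by auto
  qed (simp add: w0 W(2))
  have wG: "w a n \<in> Gr" for a n using wW W(1) by blast
  define A where "A n = T (W n) n" for n
  have A_mono: "A n \<subseteq> A (Suc n)" for n
  proof -
    have "W n \<times> {..n} \<subseteq> W (Suc n) \<times> {..Suc n}" using WS[of n] by auto
    hence "(\<lambda>(w, k). ginv w k) ` (W n \<times> {..n}) \<subseteq> (\<lambda>(w, k). ginv w k) ` (W (Suc n) \<times> {..Suc n})" by (rule image_mono)
    moreover have "{..n} \<subseteq> {..Suc n}" by simp
    ultimately show ?thesis unfolding A_def T_def by (intro Un_mono)
  qed
  have A_id: "k \<in> A n" if "k \<le> n" for k n using that unfolding A_def T_def by simp
  have lim: "\<exists>h\<in>Gr. \<forall>n. \<forall>x\<in>A n. h x = w a n x" for a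
  proof (rule limit_in_Gr)
    show "w a n \<in> Gr" "A n \<subseteq> A (Suc n)" for n by (rule wG, rule A_mono)
    show "w a (Suc n) x = w a n x" if "x \<in> A n" for n x
      using fT[of x n] that unfolding A_def by (simp add: wS)
    show "n \<in> A (Suc n)" for n by (rule A_id) simp
    show "n \<in> w a (Suc n) ` A (Suc n)" for n
    proof (rule image_eqI)
      show "n = w a (Suc n) (ginv (w a (Suc n)) n)" using wG by simp
      have "(w a (Suc n), n) \<in> W (Suc n) \<times> {..Suc n}" using wW by simp
      hence "(\<lambda>(w, k). ginv w k) (w a (Suc n), n) \<in> A (Suc n)" unfolding A_def T_def by (intro UnI2 imageI)
      thus "ginv (w a (Suc n)) n \<in> A (Suc n)" by simp
    qed
  qed
  then obtain h where hG: "\<And>a. h a \<in> Gr" and h: "\<And>a n x. x \<in> A n \<Longrightarrow> h a x = w a n x" by metis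
  \<comment> \<open>The factors from stage \<open>m\<close> on commute with the tuple of stage
    \<open>m\<close>; this passes to the limit of their products.\<close>
  have tail_comm: "ginv (w a m) (h a (x p)) = x (ginv (w a m) (h a p))" if x: "x \<in> set (xs m)" for a m x p
  proof -
    have fin: "ginv (w a m) (w a k (x q)) = x (ginv (w a m) (w a k q))" if "m \<le> k" for k q
      using that
    proof (induction k arbitrary: q rule: dec_induct)
      case base
      show ?case using wG by simp
    next
      case (step k)
      have "x \<in> set (xs k)" using xs_mono[OF step.hyps(1)] x by blast
      thus ?case using step.IH[of q] step.IH[of "f k q"] f_comm[of x k q] by (simp add: wS)
    qed
    let ?k = "max m (max p (x p))"
    have "p \<in> A ?k" "x p \<in> A ?k" by (simp_all add: A_id)
    thus ?thesis using fin[of ?k p] h by simp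
  qed
  have diff: "(\<lambda>x. ginv (h a) (h b x)) \<notin> H" if eq: "\<And>k. k < n \<Longrightarrow> a k = b k" and ab: "\<not> a n" "b n" for a b n
  proof
    assume mem: "(\<lambda>x. ginv (h a) (h b x)) \<in> H"
    define u where "u = w a n"
    have ub: "w b n = u"
    proof -
      have "w b k = w a k" if "k \<le> n" for k using that
      proof (induction k)
        case (Suc k)
        thus ?case using eq[of k] by (simp add: wS)
      qed (simp add: w0)
      thus ?thesis by (simp add: u_def)
    qed
    have uG: "u \<in> Gr" using wG by (simp add: u_def)
    have wa: "w a (Suc n) = u" and wb: "w b (Suc n) = (\<lambda>x. u (f n x))" using ab ub by (simp_all add: wS u_def)
    define ta where "ta x = ginv u (h a x)" for x
    have ta: "ta (y1 n p) = y1 n (ta p)" for p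
      using tail_comm[OF y(2), of a n p] by (simp add: ta_def wa)
    have taG: "ta \<in> Gr" using Gr_comp[OF Gr_inv[OF uG] hG[of a]] by (simp add: ta_def[abs_def])
    define tb where "tb x = ginv (w b (Suc n)) (h b x)" for x
    have tb: "tb (y0 n p) = y0 n (tb p)" for p
      using tail_comm[OF y(1), of b n p] by (simp add: tb_def)
    have ha: "h a x = u (ta x)" for x using uG by (simp add: ta_def)
    have hb: "h b x = u (f n (tb x))" for x
      using Gr_f_inv[OF wG[of b "Suc n"], of "h b x"] unfolding tb_def[symmetric] by (simp add: wb)
    \<comment> \<open>After cancelling \<open>u\<close>, this is \<open>f n\<close> between two
      tails that commute with \<open>y1 n\<close> and \<open>y0 n\<close>. Like \<open>f n\<close>
      it conjugates \<open>y0 n\<close> to \<open>y1 n\<close>, so that its membership in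
      \<open>H\<close> would put \<open>y1 n\<close> there.\<close>
    define q where "q x = ginv (h a) (h b x)" for x
    have q: "ta (q x) = f n (tb x)" for x
    proof -
      have "u (ta (q x)) = u (f n (tb x))" using hG by (simp add: ha[symmetric] hb[symmetric] q_def)
      thus ?thesis by (rule injD[OF Gr_inj[OF uG]])
    qed
    have "ta (q (y0 n p)) = ta (y1 n (q p))" for p by (simp add: q tb y(5) ta)
    hence qy: "q (y0 n p) = y1 n (q p)" for p by (rule injD[OF Gr_inj[OF taG]])
    have qH: "q \<in> H" using mem by (simp add: q_def[abs_def])
    have "(\<lambda>x. q (y0 n (ginv q x))) \<in> H"
      by (rule subgrp_comp[OF H(1) qH subgrp_comp[OF H(1) y(3) subgrp_inv[OF H(1) qH]]])
    moreover have "q (y0 n (ginv q x)) = y1 n x" for x using subgrp_Gr[OF H(1) qH] by (simp add: qy)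
    ultimately show False using y(4) by simp
  qed
  have "(\<lambda>x. ginv (h a) (h b x)) \<notin> H" if ab: "a \<noteq> b" for a b
  proof -
    obtain k where k: "a k \<noteq> b k" using ab by blast
    define n where "n = (LEAST k. a k \<noteq> b k)"
    have n: "a n \<noteq> b n" unfolding n_def by (rule LeastI[of "\<lambda>k. a k \<noteq> b k", OF k])
    have eq: "a k = b k" if "k < n" for k using not_less_Least that unfolding n_def by blast
    show ?thesis
    proof (cases "b n")
      case True
      show ?thesis by (rule diff[OF eq]) (use True n in auto)
    next
      case False
      have no: "(\<lambda>x. ginv (h b) (h a x)) \<notin> H" by (rule diff[OF eq[symmetric]]) (use False n in auto)
      show ?thesis
      proof
        assume "(\<lambda>x. ginv (h a) (h b x)) \<in> H"
        hence "ginv (\<lambda>x. ginv (h a) (h b x)) \<in> H" by (rule subgrp_inv[OF H(1)])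
        moreover have "ginv (\<lambda>x. ginv (h a) (h b x)) = (\<lambda>x. ginv (h b) (h a x))"
          by (rule ginv_eqI[OF Gr_comp[OF Gr_inv[OF hG] hG]]) (simp add: hG)
        ultimately show False using no by simp
      qed
    qed
  qed
  thus False using H(2) hG unfolding small_index_def by blast
qed

section \<open>Supports of open subgroups\<close>

lemma move_away:
  assumes A: "finite A" "B \<subseteq> A" "finite X"
  shows "\<exists>g\<in>Gr. (\<forall>x\<in>B. g x = x) \<and> (\<forall>x\<in>A - B. g x \<notin> X)"
proof -
  obtain e where e: "emb e A srt R srt R" "\<forall>a\<in>B. e a = a" "e ` (A - B) \<inter> X = {}"
    using extension[OF A(1,2) valid_subset[OF valid_M subset_UNIV] emb_id A(3)] by blast
  obtain g where g: "g \<in> Gr" "\<forall>x\<in>A. g x = e x" using homogeneity[OF A(1) e(1)] by blast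
  show ?thesis by (rule bexI[OF _ g(1)]) (use g(2) e(2,3) A(2) in auto)
qed

text \<open>A fresh copy of \<open>A - B\<close> can look over \<open>B\<close> like
  \<open>A - B\<close> itself and over \<open>A\<close> like its image under \<open>g\<close>. The
  two demands on the copy overlap only over \<open>A \<inter> B\<close>, which \<open>g\<close>
  fixes pointwise, so they are consistent because \<open>g\<close> is an automorphism.\<close>

lemma generate_disjoint:
  assumes H: "subgrp H" and A: "finite A" "\<forall>g\<in>Gr. (\<forall>x\<in>A. g x = x) \<longrightarrow> g \<in> H"
    and B: "finite B" "\<forall>g\<in>Gr. (\<forall>x\<in>B. g x = x) \<longrightarrow> g \<in> H"
    and g: "g \<in> Gr" "\<forall>x\<in>A \<inter> B. g x = x" "\<forall>x\<in>A - B. g x \<notin> A"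
  shows "\<exists>h\<in>H. \<forall>a\<in>A. h a = g a"
proof -
  define P1 :: "(nat + nat) set" where "P1 = Inl ` (A \<union> B)"
  define P2 :: "(nat + nat) set" where "P2 = Inl ` B \<union> Inr ` (A - B)"
  define P3 :: "(nat + nat) set" where "P3 = Inl ` A \<union> Inr ` (A - B)"
  define P where "P = P1 \<union> P2 \<union> P3"
  define \<phi>2 :: "nat + nat \<Rightarrow> nat" where "\<phi>2 = case_sum id id"
  define \<phi>3 where "\<phi>3 = case_sum id g"
  define s where "s = case_sum srt srt"
  define Q where "Q t S \<longleftrightarrow> (if S \<subseteq> P1 then t \<in> S \<and> R (projl t) (projl ` S) else
     if S \<subseteq> P2 then t \<in> S \<and> R (\<phi>2 t) (\<phi>2 ` S) else
     if S \<subseteq> P3 then t \<in> S \<and> R (\<phi>3 t) (\<phi>3 ` S) else False)" for t S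
  have inj1: "inj_on projl P1" by (auto simp: P1_def inj_on_def)
  have inj2: "inj_on \<phi>2 P2" by (auto simp: P2_def \<phi>2_def inj_on_def)
  \<comment> \<open>The third block represents the copy by its image under \<open>g\<close>, which
    therefore must not meet \<open>A\<close>.\<close>
  have inj3: "inj_on \<phi>3 P3"
    using g(3) injD[OF Gr_inj[OF g(1)]] by (auto simp: P3_def \<phi>3_def inj_on_def)
  have finP: "finite P" using A(1) B(1) by (simp add: P_def P1_def P2_def P3_def)
  have s1: "srt (projl p) = s p" if "p \<in> P1" for p using that by (auto simp: P1_def s_def)
  have s2: "srt (\<phi>2 p) = s p" for p by (cases p) (auto simp: \<phi>2_def s_def)
  have s3: "srt (\<phi>3 p) = s p" for p by (cases p) (auto simp: \<phi>3_def s_def Gr_srt[OF g(1)])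
  have valP: "valid P s Q"
    unfolding Q_def
    by (intro valid_glue valid_empty inj1 inj2 inj3 s1 s2 s3) (auto simp: s_def srt_in split: sum.split)
  have emb1: "emb projl P1 s Q srt R"
    by (rule embI) (simp_all add: Q_def inj1 s1)
  have emb2: "emb \<phi>2 P2 s Q srt R"
  proof (rule embI)
    show "inj_on \<phi>2 P2" by (rule inj2)
    show "srt (\<phi>2 x) = s x" for x by (rule s2)
    fix S t assume S: "finite S" "S \<subseteq> P2" "t \<in> S"
    have "\<phi>2 p = projl p" if "p \<in> P1" for p using that by (auto simp: P1_def \<phi>2_def)
    hence "\<phi>2 ` S = projl ` S \<and> \<phi>2 t = projl t" if "S \<subseteq> P1"
      using that S(3) by (auto intro!: image_cong)
    thus "R (\<phi>2 t) (\<phi>2 ` S) = Q t S" using S by (auto simp: Q_def)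
  qed
  have emb3: "emb \<phi>3 P3 s Q srt R"
  proof (rule embI)
    show "inj_on \<phi>3 P3" by (rule inj3)
    show "srt (\<phi>3 x) = s x" for x by (rule s3)
    fix S t assume S: "finite S" "S \<subseteq> P3" "t \<in> S"
    show "R (\<phi>3 t) (\<phi>3 ` S) = Q t S"
    proof (cases "S \<subseteq> P1")
      case True
      have "\<phi>3 p = projl p" if "p \<in> P1" for p using that by (auto simp: P1_def \<phi>3_def)
      hence "\<phi>3 ` S = projl ` S \<and> \<phi>3 t = projl t" using True S(3) by (auto intro!: image_cong)
      thus ?thesis using True S(3) by (simp add: Q_def)
    next
      case F: False
      show ?thesis
      proof (cases "S \<subseteq> P2")
        case True
        have "\<phi>3 p = g (\<phi>2 p)" if "p \<in> S" for p
        proof -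
          have "p \<in> P2" "p \<in> P3" using that True S(2) by auto
          thus ?thesis using g(2) by (auto simp: P2_def P3_def \<phi>2_def \<phi>3_def)
        qed
        hence "\<phi>3 ` S = g ` \<phi>2 ` S \<and> \<phi>3 t = g (\<phi>2 t)" using S(3) by (auto simp: image_image)
        thus ?thesis using True F S(3) Gr_R[OF g(1)] by (simp add: Q_def)
      next
        case False
        thus ?thesis using F S by (simp add: Q_def)
      qed
    qed
  qed
  have P1P: "P1 \<subseteq> P" by (auto simp: P_def)
  obtain e where e: "emb e P s Q srt R" "\<forall>p\<in>P1. e p = projl p"
    using extension[OF finP P1P valP emb1, of "{}"] by auto
  have eInl: "e (Inl x) = x" if "x \<in> A \<union> B" for x using e(2) that by (simp add: P1_def)
  \<comment> \<open>\<open>u\<close> fixes \<open>B\<close> and moves \<open>A - B\<close> to the fresh copy \<open>e ` Inr ` (A - B)\<close>; \<open>v\<close> fixes \<open>A\<close> and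
     moves the fresh copy on to \<open>g ` (A - B)\<close>.\<close>
  have "emb (inv_into P2 \<phi>2) (\<phi>2 ` P2) srt R s Q" by (rule emb_inv_into[OF emb2])
  from emb_trans[OF this e(1)] have "emb (\<lambda>x. e (inv_into P2 \<phi>2 x)) (\<phi>2 ` P2) srt R srt R"
    using inv_into_into[of _ \<phi>2 P2] by (force simp: P_def)
  moreover have "finite (\<phi>2 ` P2)" using A(1) B(1) by (simp add: P2_def)
  ultimately obtain u where u: "u \<in> Gr" "\<forall>x\<in>\<phi>2 ` P2. u x = e (inv_into P2 \<phi>2 x)"
    using homogeneity by blast
  have u\<phi>: "u (\<phi>2 p) = e p" if "p \<in> P2" for p using u(2) that inj2 by simp
  have "emb (inv_into P e) (e ` P) srt R s Q" by (rule emb_inv_into[OF e(1)])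
  hence "emb (inv_into P e) (e ` P3) srt R s Q" by (rule emb_subset) (auto simp: P_def)
  from emb_trans[OF this emb3] have "emb (\<lambda>x. \<phi>3 (inv_into P e x)) (e ` P3) srt R srt R"
    using inv_into_f_f[OF emb_inj[OF e(1)]] by (force simp: P_def)
  moreover have "finite (e ` P3)" using A(1) by (simp add: P3_def)
  ultimately obtain v where v: "v \<in> Gr" "\<forall>x\<in>e ` P3. v x = \<phi>3 (inv_into P e x)"
    using homogeneity by blast
  have v\<phi>: "v (e p) = \<phi>3 p" if "p \<in> P3" for p
    using v(2) that inv_into_f_f[OF emb_inj[OF e(1)], of p] by (simp add: P_def)
  have "u x = x" if "x \<in> B" for x
    using u\<phi>[of "Inl x"] eInl[of x] that by (simp add: P2_def \<phi>2_def)
  hence uH: "u \<in> H" using B(2) u(1) by blast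
  have vA: "v x = x" if "x \<in> A" for x
    using v\<phi>[of "Inl x"] eInl[of x] that by (simp add: P3_def \<phi>3_def)
  hence vH: "v \<in> H" using A(2) v(1) by blast
  have "v (u a) = g a" if a: "a \<in> A" for a
  proof (cases "a \<in> B")
    case True
    hence "u a = a" using u\<phi>[of "Inl a"] eInl[of a] by (simp add: P2_def \<phi>2_def)
    thus ?thesis using vA[OF a] g(2) a True by simp
  next
    case False
    hence "u a = e (Inr a)" using u\<phi>[of "Inr a"] a by (simp add: P2_def \<phi>2_def)
    thus ?thesis using v\<phi>[of "Inr a"] a False by (simp add: P3_def \<phi>3_def)
  qed
  thus ?thesis by (intro bexI[OF _ subgrp_comp[OF H vH uH]] ballI)
qed

text \<open>Reduction to the disjoint case: some element of \<open>H\<close> acts on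
  \<open>A\<close> like an automorphism that takes \<open>A - B\<close> away from \<open>A\<close>
  and from the image of \<open>A\<close> under \<open>g\<close>. Once \<open>g\<close> is divided by
  it, \<open>A - B\<close> is moved off \<open>A\<close>; after a second division what is left fixes
  \<open>A\<close> pointwise.\<close>

lemma stabilizers_generate:
  assumes H: "subgrp H" and A: "finite A" "\<forall>g\<in>Gr. (\<forall>x\<in>A. g x = x) \<longrightarrow> g \<in> H"
    and B: "finite B" "\<forall>g\<in>Gr. (\<forall>x\<in>B. g x = x) \<longrightarrow> g \<in> H"
    and g: "g \<in> Gr" "\<forall>x\<in>A \<inter> B. g x = x"
  shows "g \<in> H"
proof -
  obtain g1 where g1: "g1 \<in> Gr" "\<forall>x\<in>A \<inter> B. g1 x = x" "\<forall>x\<in>A - A \<inter> B. g1 x \<notin> A \<union> g ` A"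
    using move_away[OF A(1), of "A \<inter> B" "A \<union> g ` A"] A(1) by auto
  have "\<forall>x\<in>A - B. g1 x \<notin> A" using g1(3) by auto
  from generate_disjoint[OF H A B g1(1,2) this]
  obtain h1 where h1: "h1 \<in> H" "\<forall>a\<in>A. h1 a = g1 a" by (elim bexE)
  have h1G: "h1 \<in> Gr" by (rule subgrp_Gr[OF H h1(1)])
  let ?g2 = "\<lambda>x. ginv h1 (g x)"
  have g2: "?g2 \<in> Gr" by (rule Gr_comp[OF Gr_inv[OF h1G] g(1)])
  have fix_AB: "?g2 x = x" if "x \<in> A \<inter> B" for x
  proof -
    have "h1 x = x" using h1(2) g1(2) that by simp
    hence "ginv h1 x = x" using h1G Gr_inv_f by metis
    thus ?thesis using g(2) that by simp
  qed
  have disj: "?g2 x \<notin> A" if x: "x \<in> A - B" for x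
  proof
    assume m: "?g2 x \<in> A"
    hence "h1 (?g2 x) = g1 (?g2 x)" using h1(2) by blast
    hence "g x = g1 (?g2 x)" using h1G by simp
    hence gx: "g1 (?g2 x) = g x" by (rule sym)
    have AB: "?g2 x \<in> A \<inter> B"
    proof (rule ccontr)
      assume "?g2 x \<notin> A \<inter> B"
      hence "g1 (?g2 x) \<notin> A \<union> g ` A" using g1(3) m by blast
      moreover have "g x \<in> g ` A" using x by blast
      ultimately show False unfolding gx by blast
    qed
    have "g1 (?g2 x) = ?g2 x" using g1(2) AB by blast
    hence "g x = ?g2 x" unfolding gx .
    moreover have "g (?g2 x) = ?g2 x" using g(2) AB by blast
    ultimately have "g x = g (?g2 x)" by simp
    hence "x = ?g2 x" by (rule injD[OF Gr_inj[OF g(1)]])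
    thus False using AB x by simp
  qed
  have "\<forall>x\<in>A \<inter> B. ?g2 x = x" using fix_AB by (intro ballI)
  moreover have "\<forall>x\<in>A - B. ?g2 x \<notin> A" using disj by (intro ballI)
  ultimately have "\<exists>h\<in>H. \<forall>a\<in>A. h a = ?g2 a" by (rule generate_disjoint[OF H A B g2])
  then  obtain h2 where h2: "h2 \<in> H" "\<forall>a\<in>A. h2 a = ?g2 a" by (elim bexE)
  have h2G: "h2 \<in> Gr" by (rule subgrp_Gr[OF H h2(1)])
  let ?k = "\<lambda>x. ginv h2 (?g2 x)"
  have "?k \<in> H"
  proof (rule A(2)[rule_format, OF Gr_comp[OF Gr_inv[OF h2G] g2]])
    fix x assume "x \<in> A"
    thus "?k x = x" using h2(2) Gr_inv_f[OF h2G, of x] by simp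
  qed
  from subgrp_comp[OF H h1(1) subgrp_comp[OF H h2(1) this]]
  show "g \<in> H" using h1G h2G by simp
qed

text \<open>Finite sets whose pointwise stabilizer lies in \<open>H\<close> are closed under
  intersection and under translation by \<open>H\<close>. For one of least size, the intersection
  with a translate cannot be smaller, so the translate is the set itself.\<close>

lemma strong_small_index:
  assumes H: "subgrp H" "small_index H"
  shows "\<exists>A. finite A \<and> (\<forall>g\<in>Gr. (\<forall>x\<in>A. g x = x) \<longrightarrow> g \<in> H) \<and> (\<forall>h\<in>H. h ` A = A)"
proof -
  let ?p = "\<lambda>A. finite A \<and> (\<forall>g\<in>Gr. (\<forall>x\<in>A. g x = x) \<longrightarrow> g \<in> H)"
  obtain A0 where "?p A0" using small_index_open[OF H] by blast
  then obtain A where A: "?p A" "\<And>B. ?p B \<Longrightarrow> card A \<le> card B"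
    using ex_has_least_nat[of ?p A0 card] by blast
  have "h ` A = A" if h: "h \<in> H" for h
  proof -
    have hG: "h \<in> Gr" by (rule subgrp_Gr[OF H(1) h])
    have hA: "g \<in> H" if g: "g \<in> Gr" "\<forall>x\<in>h ` A. g x = x" for g
    proof -
      let ?k = "\<lambda>x. ginv h (g (h x))"
      have kG: "?k \<in> Gr" by (rule Gr_comp[OF Gr_inv[OF hG] Gr_comp[OF g(1) hG]])
      have "\<forall>x\<in>A. ?k x = x" using g(2) hG by simp
      hence "?k \<in> H" by (rule mp[OF bspec[OF conjunct2[OF A(1)] kG]])
      from subgrp_comp[OF H(1) h subgrp_comp[OF H(1) this subgrp_inv[OF H(1) h]]]
      show ?thesis using hG by simp
    qed
    have "finite (h ` A)" "\<forall>g\<in>Gr. (\<forall>x\<in>h ` A. g x = x) \<longrightarrow> g \<in> H" using A(1) hA by blast+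
    from stabilizers_generate[OF H(1) conjunct1[OF A(1)] conjunct2[OF A(1)] this]
    have "?p (A \<inter> h ` A)" using A(1) by blast
    hence "card A \<le> card (A \<inter> h ` A)" by (rule A(2))
    hence "A \<inter> h ` A = A" using A(1) by (intro card_subset_eq) (auto intro: antisym card_mono)
    moreover have "card (h ` A) = card A" by (rule card_image[OF Gr_inj[OF hG]])
    ultimately show ?thesis using A(1) by (metis card_subset_eq finite_imageI inf.cobounded2)
  qed
  thus ?thesis using A(1) by blast
qed

end

section \<open>Categoricity of homogeneous structures\<close>

definition atoms :: "('f, 'r) lang \<Rightarrow> nat \<Rightarrow> ('f, 'r) fo_form set" where
  "atoms L n = {Eq (Var i) (Var j) | i j. i < n \<and> j < n} \<union>
     {Rel r (map Var is) | r is. rel_arity L r = Some (length is) \<and> set is \<subseteq> {..<n}}"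

definition qtp :: "('f, 'r) lang \<Rightarrow> ('f, 'r, 'a) struct \<Rightarrow> (nat \<Rightarrow> 'a) \<Rightarrow> nat \<Rightarrow> ('f, 'r) fo_form set" where
  "qtp L M e n = {\<phi> \<in> atoms L n. sat M e \<phi>}"

definition alls :: "nat \<Rightarrow> ('f, 'r) fo_form \<Rightarrow> ('f, 'r) fo_form" where
  "alls n \<phi> = foldr All [0..<n] \<phi>"

text \<open>The list is a chosen enumeration of the finitely many atoms. The fold starts from a
  tautology without free variables, as the syntax of formulas has no constant for truth.\<close>

definition type_form :: "('f, 'r) lang \<Rightarrow> nat \<Rightarrow> ('f, 'r) fo_form set \<Rightarrow> ('f, 'r) fo_form" where
  "type_form L n \<tau> = foldr (\<lambda>\<phi>. Conj (if \<phi> \<in> \<tau> then \<phi> else Neg \<phi>)) (SOME l. set l = atoms L n) (All 0 (Eq (Var 0) (Var 0)))"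

lemma finite_atoms:
  fixes L :: "('a, 'b) lang"
  assumes "finite (dom (rel_arity L))"
  shows "finite (atoms L n)"
proof -
  have "{Eq (Var i) (Var j) | i j. i < n \<and> j < n} \<subseteq> (\<lambda>(i, j). Eq (Var i) (Var j)) ` ({..<n} \<times> {..<n})" by auto
  hence "finite {Eq (Var i) (Var j) :: ('a, 'b) fo_form | i j. i < n \<and> j < n}"
    by (rule finite_subset) simp
  moreover have "{Rel r (map Var is) :: ('a, 'b) fo_form | r is. rel_arity L r = Some (length is) \<and> set is \<subseteq> {..<n}} \<subseteq>
     (\<Union>r\<in>dom (rel_arity L). (\<lambda>is. Rel r (map Var is)) ` {is. set is \<subseteq> {..<n} \<and> length is = the (rel_arity L r)})"
    by fastforce
  moreover have "finite (\<Union>r\<in>dom (rel_arity L). (\<lambda>is. Rel r (map Var is) :: ('a, 'b) fo_form) ` {is. set is \<subseteq> {..<n} \<and> length is = the (rel_arity L r)})"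
    using assms finite_lists_length_eq[of "{..<n}"] by (intro finite_UN_I finite_imageI) auto
  ultimately show ?thesis unfolding atoms_def by (meson finite_UnI finite_subset)
qed

lemma sat_type_form:
  assumes "finite (dom (rel_arity L))"
  shows "sat M e (type_form L n \<tau>) \<longleftrightarrow> (\<forall>\<phi>\<in>atoms L n. sat M e \<phi> \<longleftrightarrow> \<phi> \<in> \<tau>)"
proof -
  have "sat M e (foldr (\<lambda>\<phi>. Conj (if \<phi> \<in> \<tau> then \<phi> else Neg \<phi>)) l (All 0 (Eq (Var 0) (Var 0)))) \<longleftrightarrow>
     (\<forall>\<phi>\<in>set l. sat M e \<phi> \<longleftrightarrow> \<phi> \<in> \<tau>)" for l
    by (induction l) auto
  moreover have "set (SOME l. set l = atoms L n) = atoms L n"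
    using someI_ex[OF finite_list[OF finite_atoms[OF assms]]] .
  ultimately show ?thesis by (simp add: type_form_def)
qed

lemma sat_type_form_qtp:
  assumes "finite (dom (rel_arity L))" "\<tau> \<subseteq> atoms L n"
  shows "sat M e (type_form L n \<tau>) \<longleftrightarrow> qtp L M e n = \<tau>"
  using assms(2) by (auto simp: sat_type_form[OF assms(1)] qtp_def)

lemma atoms_wf: "\<phi> \<in> atoms L n \<Longrightarrow> wf_form L \<phi> \<and> fv_form \<phi> \<subseteq> {..<n}"
  by (auto simp: atoms_def list_all_iff)

lemma type_form_wf:
  assumes "finite (dom (rel_arity L))"
  shows "wf_form L (type_form L n \<tau>) \<and> fv_form (type_form L n \<tau>) \<subseteq> {..<n}"
proof -
  have "set l \<subseteq> atoms L n \<Longrightarrow> wf_form L (foldr (\<lambda>\<phi>. Conj (if \<phi> \<in> \<tau> then \<phi> else Neg \<phi>)) l (All 0 (Eq (Var 0) (Var 0)))) \<and>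
     fv_form (foldr (\<lambda>\<phi>. Conj (if \<phi> \<in> \<tau> then \<phi> else Neg \<phi>)) l (All 0 (Eq (Var 0) (Var 0)))) \<subseteq> {..<n}" for l
    by (induction l) (use atoms_wf in \<open>auto split: if_splits\<close>)
  moreover have "set (SOME l. set l = atoms L n) = atoms L n"
    using someI_ex[OF finite_list[OF finite_atoms[OF assms]]] .
  ultimately show ?thesis by (simp add: type_form_def)
qed

lemma alls_Suc: "alls (Suc n) \<phi> = alls n (All n \<phi>)"
  by (simp add: alls_def)

lemma alls_sentence:
  assumes "wf_form L \<phi>" "fv_form \<phi> \<subseteq> {..<n}"
  shows "alls n \<phi> \<in> sentences L"
  using assms
proof (induction n arbitrary: \<phi>)
  case 0
  thus ?case by (simp add: alls_def sentences_def)
next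
  case (Suc n)
  show ?case unfolding alls_Suc by (rule Suc.IH) (use Suc.prems in auto)
qed

lemma sat_alls:
  "sat M e (alls n \<phi>) \<longleftrightarrow> (\<forall>e'. (\<forall>i<n. e' i \<in> univ M) \<and> (\<forall>i\<ge>n. e' i = e i) \<longrightarrow> sat M e' \<phi>)"
proof (induction n arbitrary: \<phi>)
  case 0
  have "(\<forall>i. e' i = e i) \<longleftrightarrow> e' = e" for e' by auto
  thus ?case by (simp add: alls_def)
next
  case (Suc n)
  show ?case unfolding alls_Suc Suc.IH
  proof (intro iffI allI impI)
    fix e' assume h: "\<forall>e'. (\<forall>i<n. e' i \<in> univ M) \<and> (\<forall>i\<ge>n. e' i = e i) \<longrightarrow> sat M e' (All n \<phi>)"
      and e': "(\<forall>i<Suc n. e' i \<in> univ M) \<and> (\<forall>i\<ge>Suc n. e' i = e i)"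
    have "sat M (e'(n := e n)) (All n \<phi>)" using e' by (intro h[rule_format]) auto
    hence "\<forall>a\<in>univ M. sat M (e'(n := a)) \<phi>" by simp
    from bspec[OF this, of "e' n"] show "sat M e' \<phi>" using e' by simp
  next
    fix e' assume h: "\<forall>e'. (\<forall>i<Suc n. e' i \<in> univ M) \<and> (\<forall>i\<ge>Suc n. e' i = e i) \<longrightarrow> sat M e' \<phi>"
      and e': "(\<forall>i<n. e' i \<in> univ M) \<and> (\<forall>i\<ge>n. e' i = e i)"
    have "sat M (e'(n := a)) \<phi>" if "a \<in> univ M" for a
      using e' that by (intro h[rule_format]) (auto simp: less_Suc_eq)
    thus "sat M e' (All n \<phi>)" by simp
  qed
qed

lemma holds_alls:
  fixes M :: "('f, 'r, 'a) struct"
  shows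
  "holds M (alls n \<phi>) \<longleftrightarrow> (\<forall>e. range e \<subseteq> univ M \<longrightarrow> sat M e \<phi>)"
proof
  assume h: "holds M (alls n \<phi>)"
  show "\<forall>e. range e \<subseteq> univ M \<longrightarrow> sat M e \<phi>"
  proof (intro allI impI)
    fix e :: "nat \<Rightarrow> 'a" assume e: "range e \<subseteq> univ M"
    hence "sat M e (alls n \<phi>)" using h by (simp add: holds_def)
    thus "sat M e \<phi>" unfolding sat_alls by (elim allE[of _ e] mp) (use e in auto)
  qed
next
  assume h: "\<forall>e. range e \<subseteq> univ M \<longrightarrow> sat M e \<phi>"
  have "sat M e' \<phi>" if "range e \<subseteq> univ M" "\<forall>i<n. e' i \<in> univ M" "\<forall>i\<ge>n. e' i = e i" for e e' :: "nat \<Rightarrow> 'a"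
  proof (rule h[rule_format], rule subsetI)
    fix x assume "x \<in> range e'"
    then obtain i where "x = e' i" by blast
    thus "x \<in> univ M" using that by (cases "i < n") auto
  qed
  thus "holds M (alls n \<phi>)" unfolding holds_def sat_alls by simp
qed

lemma atoms_mono: "m \<le> n \<Longrightarrow> atoms L m \<subseteq> atoms L n"
  unfolding atoms_def by fastforce

lemma qtp_restrict: "m \<le> n \<Longrightarrow> qtp L M e n = qtp L M' e' n \<Longrightarrow> qtp L M e m = qtp L M' e' m"
  using atoms_mono[of m n L] unfolding qtp_def by blast

lemma qtp_cong: "(\<And>i. i < n \<Longrightarrow> e i = e' i) \<Longrightarrow> qtp L M e n = qtp L M e' n"
proof -
  assume h: "\<And>i. i < n \<Longrightarrow> e i = e' i"
  have "sat M e \<phi> = sat M e' \<phi>" if "\<phi> \<in> atoms L n" for \<phi>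
    using that unfolding atoms_def
  proof (elim UnE CollectE exE conjE)
    fix r "is" assume \<phi>: "\<phi> = Rel r (map Var is)" and "set is \<subseteq> {..<n}"
    hence "map (\<lambda>t. eval_term M e t) (map Var is) = map (\<lambda>t. eval_term M e' t) (map Var is)"
      using h by auto
    thus ?thesis unfolding \<phi> sat.simps by (simp only:)
  qed (simp add: h)
  thus ?thesis by (auto simp: qtp_def)
qed

lemma qtp_rel:
  assumes "qtp L N e n = qtp L N' e' n" "rel_arity L r = Some (length is)" "set is \<subseteq> {..<n}"
  shows "rel_int N r (map e is) \<longleftrightarrow> rel_int N' r (map e' is)"
proof -
  have "Rel r (map Var is) \<in> atoms L n" using assms(2,3) by (auto simp: atoms_def)
  hence "sat N e (Rel r (map Var is)) = sat N' e' (Rel r (map Var is))" using assms(1) unfolding qtp_def by blast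
  thus ?thesis by (simp add: comp_def)
qed

lemma qtp_eq:
  assumes "qtp L N e n = qtp L N' e' n" "i < n" "j < n"
  shows "e i = e j \<longleftrightarrow> e' i = e' j"
proof -
  have "Eq (Var i) (Var j) \<in> atoms L n" using assms(2,3) by (auto simp: atoms_def)
  hence "sat N e (Eq (Var i) (Var j)) = sat N' e' (Eq (Var i) (Var j))" using assms(1) unfolding qtp_def by blast
  thus ?thesis by simp
qed

lemma list_in_image:
  assumes "set xs \<subseteq> e ` {..<n}"
  obtains "is" where "xs = map e is" "set is \<subseteq> {..<n}" "length is = length xs"
proof -
  have "\<exists>is. xs = map e is \<and> set is \<subseteq> {..<n}"
    using assms
  proof (induction xs)
    case (Cons x xs)
    then obtain "is" i where "xs = map e is" "set is \<subseteq> {..<n}" "x = e i" "i < n" by auto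
    thus ?case by (intro exI[of _ "i # is"]) auto
  qed simp
  thus ?thesis using that by auto
qed

text \<open>In a finite relational language the quantifier-free types are described by formulas, so the
  theory of a homogeneous structure axiomatizes the one-point extension property.\<close>

theorem finite_relational_homogeneous_aleph0_categorical:
  fixes M :: "('f, 'r, nat) struct"
  assumes L: "fun_arity L = (\<lambda>_. None)" "finite (dom (rel_arity L))"
    and M: "is_struct L M" "infinite (univ M)" and hom: "homogeneous L M"
  shows "aleph0_categorical L M"
proof -
  have hom_ext: "\<exists>a\<in>univ M. qtp L M (e(n := a)) (Suc n) = qtp L M m (Suc n)"
    if m: "range m \<subseteq> univ M" and e: "range e \<subseteq> univ M" and q: "qtp L M m n = qtp L M e n" for m e n
  proof (cases "n = 0")
    \<comment> \<open>Universes of substructures are nonempty, so homogeneity says nothing about the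
      empty tuple; there the first entry of \<open>m\<close> serves directly.\<close>
    case True
    have "qtp L M (e(n := m 0)) (Suc n) = qtp L M m (Suc n)" using True by (intro qtp_cong) auto
    thus ?thesis using m by blast
  next
    case False
    let ?A = "m ` {..<n}" and ?B = "e ` {..<n}"
    define h where "h x = e (SOME i. i < n \<and> m i = x)" for x
    have hm: "h (m i) = e i" if "i < n" for i
    proof -
      have "(SOME j. j < n \<and> m j = m i) < n \<and> m (SOME j. j < n \<and> m j = m i) = m i"
        by (rule someI[of _ i]) (use that in simp)
      thus ?thesis using qtp_eq[OF q, of "SOME j. j < n \<and> m j = m i" i] that unfolding h_def by blast
    qed
    have sub: "substruct L M ?A" "substruct L M ?B"
      using m e False L(1) by (auto simp: substruct_def is_struct_def induced_def)
    have "struct_iso L (induced M ?A) (induced M ?B) h"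
      unfolding struct_iso_def
    proof (intro conjI allI impI)
      have "inj_on h ?A"
        using hm qtp_eq[OF q] by (auto simp: inj_on_def)
      moreover have "h ` ?A = ?B" using hm by (simp add: image_image)
      ultimately show "bij_betw h (univ (induced M ?A)) (univ (induced M ?B))"
        by (simp add: bij_betw_def induced_def)
    next
      fix r xs assume xs: "rel_arity L r = Some (length xs) \<and> set xs \<subseteq> univ (induced M ?A)"
      then obtain "is" where is': "xs = map m is" "set is \<subseteq> {..<n}" "length is = length xs"
        using list_in_image[of xs m n] by (auto simp: induced_def)
      have "map h xs = map e is" using hm is' by auto
      moreover have "rel_arity L r = Some (length is)" using xs is'(3) by simp
      ultimately show "rel_int (induced M ?A) r xs = rel_int (induced M ?B) r (map h xs)"
        using qtp_rel[OF q _ is'(2), of r] by (simp add: induced_def flip: is'(1))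
    qed (use L(1) in simp)
    then obtain g where g: "g \<in> carrier (Aut L M)" "\<forall>a\<in>?A. g a = h a"
      using hom[unfolded homogeneous_def] sub by blast
    hence iso: "struct_iso L M M g" by (simp add: Aut_def)
    have gi: "inj_on g (univ M)" and gM: "g (m i) \<in> univ M" for i
      using iso m by (auto simp: struct_iso_def bij_betw_def)
    have "qtp L M (e(n := g (m n))) (Suc n) = qtp L M (\<lambda>i. g (m i)) (Suc n)"
      by (rule qtp_cong) (use g(2) hm in \<open>auto simp: less_Suc_eq\<close>)
    also have "sat M (\<lambda>i. g (m i)) \<phi> = sat M m \<phi>" if "\<phi> \<in> atoms L (Suc n)" for \<phi>
    proof -
      have "rel_int M r (map (\<lambda>i. g (m i)) is) = rel_int M r (map m is)" if "rel_arity L r = Some (length is)" for r "is"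
      proof -
        have "rel_arity L r = Some (length (map m is)) \<and> set (map m is) \<subseteq> univ M" using that m by auto
        hence "rel_int M r (map m is) = rel_int M r (map g (map m is))" using iso unfolding struct_iso_def by blast
        thus ?thesis by (simp add: comp_def)
      qed
      moreover have "g (m i) = g (m j) \<longleftrightarrow> m i = m j" for i j
        using inj_on_eq_iff[OF gi, of "m i" "m j"] m by auto
      ultimately show ?thesis using that by (auto simp: atoms_def comp_def)
    qed
    hence "qtp L M (\<lambda>i. g (m i)) (Suc n) = qtp L M m (Suc n)" by (auto simp: qtp_def)
    finally show ?thesis using gM by blast
  qed
  define is_model where "is_model N \<longleftrightarrow> models L N (Th L M)" for N :: "('f, 'r, nat) struct"
  have sentence_transfer: "holds N \<phi>" if "is_model N" "\<phi> \<in> sentences L" "holds M \<phi>" for N and \<phi>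
    using that by (auto simp: is_model_def models_def Th_def)
  \<comment> \<open>If \<open>M\<close> omitted the type, the universal sentence saying so would
    pass to \<open>N\<close>.\<close>
  have realized: "\<exists>m. range m \<subseteq> univ M \<and> qtp L M m n = qtp L N e n"
    if N: "is_model N" and e: "range e \<subseteq> univ N" for N e n
  proof (rule ccontr)
    let ?\<tau> = "qtp L N e n"
    have \<tau>: "?\<tau> \<subseteq> atoms L n" by (auto simp: qtp_def)
    assume "\<not> (\<exists>m. range m \<subseteq> univ M \<and> qtp L M m n = ?\<tau>)"
    hence "holds M (alls n (Neg (type_form L n ?\<tau>)))"
      unfolding holds_alls sat.simps sat_type_form_qtp[OF L(2) \<tau>] by blast
    moreover have "alls n (Neg (type_form L n ?\<tau>)) \<in> sentences L"
      using type_form_wf[OF L(2), of n ?\<tau>] by (intro alls_sentence) auto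
    ultimately have "holds N (alls n (Neg (type_form L n ?\<tau>)))" using sentence_transfer[OF N] by blast
    thus False unfolding holds_alls sat.simps sat_type_form_qtp[OF L(2) \<tau>] using e by blast
  qed
  have extend: "\<exists>a\<in>univ N. qtp L N (e(n := a)) (Suc n) = qtp L M m (Suc n)"
    if N: "is_model N" and e: "range e \<subseteq> univ N" and m: "range m \<subseteq> univ M" and q: "qtp L M m n = qtp L N e n" for N e m n
  proof -
    let ?\<tau> = "qtp L M m n" and ?\<tau>' = "qtp L M m (Suc n)"
    have \<tau>: "?\<tau> \<subseteq> atoms L n" "?\<tau>' \<subseteq> atoms L (Suc n)" by (auto simp: qtp_def)
    \<comment> \<open>In the available connectives: a tuple of the smaller type extends by some
      point to the larger type.\<close>
    let ?\<phi> = "Neg (Conj (type_form L n ?\<tau>) (All n (Neg (type_form L (Suc n) ?\<tau>'))))"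
    have s: "sat N' e ?\<phi> \<longleftrightarrow> (qtp L N' e n = ?\<tau> \<longrightarrow> (\<exists>a\<in>univ N'. qtp L N' (e(n := a)) (Suc n) = ?\<tau>'))"
      for N' :: "('f, 'r, nat) struct" and e
      unfolding sat.simps sat_type_form_qtp[OF L(2) \<tau>(1)] sat_type_form_qtp[OF L(2) \<tau>(2)] by blast
    have "holds M (alls n ?\<phi>)" unfolding holds_alls s
    proof (intro allI impI)
      fix e' assume "range e' \<subseteq> univ M" "qtp L M e' n = ?\<tau>"
      thus "\<exists>a\<in>univ M. qtp L M (e'(n := a)) (Suc n) = ?\<tau>'" by (intro hom_ext m) auto
    qed
    moreover have "alls n ?\<phi> \<in> sentences L"
      using type_form_wf[OF L(2), of n ?\<tau>] type_form_wf[OF L(2), of "Suc n" ?\<tau>'] by (intro alls_sentence) auto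
    ultimately have "holds N (alls n ?\<phi>)" using sentence_transfer[OF N] by blast
    thus ?thesis using e q unfolding holds_alls s by simp
  qed
  have match: "\<exists>b\<in>univ N'. qtp L N (e(n := a)) (Suc n) = qtp L N' (e'(n := b)) (Suc n)"
    if N: "is_model N" "is_model N'" and e: "range e \<subseteq> univ N" "range e' \<subseteq> univ N'" and a: "a \<in> univ N"
      and q: "qtp L N e n = qtp L N' e' n" for N N' e e' a n
  proof -
    have "range (e(n := a)) \<subseteq> univ N" using e(1) a by (auto split: if_splits)
    then obtain m where m: "range m \<subseteq> univ M" "qtp L M m (Suc n) = qtp L N (e(n := a)) (Suc n)"
      using realized[OF N(1)] by blast
    have "qtp L M m n = qtp L N (e(n := a)) n" by (rule qtp_restrict[OF _ m(2)]) simp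
    also have "\<dots> = qtp L N e n" by (rule qtp_cong) simp
    finally have "qtp L M m n = qtp L N' e' n" using q by simp
    thus ?thesis using extend[OF N(2) e(2) m(1)] m(2) by metis
  qed
  have "\<exists>h. struct_iso L N N' h"
    if N: "is_model N" "is_model N'" for N N'
  proof -
    define P where "P A h \<longleftrightarrow> (\<exists>n e e'. range e \<subseteq> univ N \<and> range e' \<subseteq> univ N' \<and> A = e ` {..<n} \<and>
       (\<forall>i<n. h (e i) = e' i) \<and> qtp L N e n = qtp L N' e' n)" for A and h :: "nat \<Rightarrow> nat"
    obtain x0 x0' where x0: "x0 \<in> univ N" "x0' \<in> univ N'"
      using N by (auto simp: is_model_def models_def is_struct_def)
    have P0: "P {} (\<lambda>x. x)"
    proof -
      have e: "range (\<lambda>i::nat. x0) \<subseteq> univ N" "range (\<lambda>i::nat. x0') \<subseteq> univ N'" using x0 by auto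
      \<comment> \<open>The type of the empty tuple still records relations of arity 0; that
        \<open>N\<close> and \<open>N'\<close> agree on them is seen by comparing both with
        \<open>M\<close>.\<close>
      obtain m where m: "qtp L M m 0 = qtp L N (\<lambda>i. x0) 0" using realized[OF N(1) e(1)] by blast
      obtain m' where m': "qtp L M m' 0 = qtp L N' (\<lambda>i. x0') 0" using realized[OF N(2) e(2)] by blast
      have "qtp L M m 0 = qtp L M m' 0" by (rule qtp_cong) simp
      thus ?thesis unfolding P_def using e m m'
        by (intro exI[of _ 0] exI[of _ "\<lambda>i. x0"] exI[of _ "\<lambda>i. x0'"]) auto
    qed
    have PI: "P A h" if "range e \<subseteq> univ N" "range e' \<subseteq> univ N'" "A = e ` {..<n}" "\<And>i. i < n \<Longrightarrow> h (e i) = e' i"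
       "qtp L N e n = qtp L N' e' n" for A h n e e' using that unfolding P_def by blast
    have img: "(e(n := a)) ` {..<Suc n} = insert a (e ` {..<n})" for e :: "nat \<Rightarrow> nat" and n a
      by (auto simp: less_Suc_eq image_iff)
    have forth: "\<exists>A' h'. P A' h' \<and> A \<subseteq> A' \<and> (\<forall>a\<in>A. h' a = h a) \<and> x \<in> A'" if Ph: "P A h" and x: "x \<in> univ N" for A h x
    proof (cases "x \<in> A")
      case True
      thus ?thesis using Ph by blast
    next
      case False
      obtain n e e' where e: "range e \<subseteq> univ N" "range e' \<subseteq> univ N'" "A = e ` {..<n}"
        "\<And>i. i < n \<Longrightarrow> h (e i) = e' i" "qtp L N e n = qtp L N' e' n" using Ph unfolding P_def by blast
      obtain b where b: "b \<in> univ N'" "qtp L N (e(n := x)) (Suc n) = qtp L N' (e'(n := b)) (Suc n)"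
        using match[OF N e(1,2) x e(5)] by blast
      have "P (insert x A) (h(x := b))"
      proof (rule PI[OF _ _ _ _ b(2)])
        show "range (e(n := x)) \<subseteq> univ N" "range (e'(n := b)) \<subseteq> univ N'" using e(1,2) x b(1) by (auto split: if_splits)
        show "insert x A = (e(n := x)) ` {..<Suc n}" unfolding img e(3) ..
        show "(h(x := b)) ((e(n := x)) i) = (e'(n := b)) i" if "i < Suc n" for i
          using that False e(3,4) by (auto simp: less_Suc_eq)
      qed
      thus ?thesis using False by (intro exI[of _ "insert x A"] exI[of _ "h(x := b)"]) auto
    qed
    have backw: "\<exists>A' h'. P A' h' \<and> A \<subseteq> A' \<and> (\<forall>a\<in>A. h' a = h a) \<and> y \<in> h' ` A'" if Ph: "P A h" and y: "y \<in> univ N'" for A h y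
    proof (cases "y \<in> h ` A")
      case True
      thus ?thesis using Ph by blast
    next
      case False
      obtain n e e' where e: "range e \<subseteq> univ N" "range e' \<subseteq> univ N'" "A = e ` {..<n}"
        "\<And>i. i < n \<Longrightarrow> h (e i) = e' i" "qtp L N e n = qtp L N' e' n" using Ph unfolding P_def by blast
      obtain a where a: "a \<in> univ N" "qtp L N' (e'(n := y)) (Suc n) = qtp L N (e(n := a)) (Suc n)"
        using match[OF N(2,1) e(2,1) y e(5)[symmetric]] by blast
      \<comment> \<open>\<open>y\<close> differs from all earlier entries of \<open>e'\<close>, and
        the type records which entries are equal.\<close>
      have aA: "a \<notin> A"
      proof
        assume "a \<in> A"
        then obtain i where i: "i < n" "a = e i" using e(3) by auto
        have "(e'(n := y)) i = (e'(n := y)) n"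
          using qtp_eq[OF a(2), of i n] i by simp
        hence "y = h (e i)" using i(1) e(4)[OF i(1)] by simp
        thus False using False i \<open>a \<in> A\<close> by simp
      qed
      have "P (insert a A) (h(a := y))"
      proof (rule PI[OF _ _ _ _ a(2)[symmetric]])
        show "range (e(n := a)) \<subseteq> univ N" "range (e'(n := y)) \<subseteq> univ N'" using e(1,2) y a(1) by (auto split: if_splits)
        show "insert a A = (e(n := a)) ` {..<Suc n}" unfolding img e(3) ..
        show "(h(a := y)) ((e(n := a)) i) = (e'(n := y)) i" if "i < Suc n" for i
          using that aA e(3,4) by (auto simp: less_Suc_eq)
      qed
      thus ?thesis using aA by (intro exI[of _ "insert a A"] exI[of _ "h(a := y)"]) auto
    qed
    have Pinj: "A \<subseteq> univ N \<and> h ` A \<subseteq> univ N' \<and> inj_on h A" if Ph: "P A h" for A h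
    proof -
      obtain n e e' where e: "range e \<subseteq> univ N" "range e' \<subseteq> univ N'" "A = e ` {..<n}"
        "\<And>i. i < n \<Longrightarrow> h (e i) = e' i" "qtp L N e n = qtp L N' e' n" using Ph unfolding P_def by blast
      have "inj_on h A" using e(3,4) qtp_eq[OF e(5)] by (auto simp: inj_on_def)
      thus ?thesis using e by auto
    qed
    have "\<exists>f. bij_betw f (univ N) (univ N') \<and> (\<forall>x\<in>{}. f x = x) \<and>
      (\<forall>F. finite F \<and> F \<subseteq> univ N \<longrightarrow> (\<exists>A h. P A h \<and> F \<subseteq> A \<and> (\<forall>x\<in>A. f x = h x)))"
      by (rule back_and_forth[of "univ N" "univ N'" P "{}" "\<lambda>x. x", OF _ _ _ _ Pinj forth backw P0]) (use x0 in auto)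
    then obtain f where f: "bij_betw f (univ N) (univ N')"
      "\<forall>F. finite F \<and> F \<subseteq> univ N \<longrightarrow> (\<exists>A h. P A h \<and> F \<subseteq> A \<and> (\<forall>x\<in>A. f x = h x))" by blast
    have "struct_iso L N N' f"
      unfolding struct_iso_def
    proof (intro conjI allI impI)
      fix r xs assume xs: "rel_arity L r = Some (length xs) \<and> set xs \<subseteq> univ N"
      obtain A h where A: "P A h" "set xs \<subseteq> A" "\<forall>x\<in>A. f x = h x" using f(2) xs by (metis List.finite_set)
      obtain n e e' where e: "A = e ` {..<n}" "\<And>i. i < n \<Longrightarrow> h (e i) = e' i" "qtp L N e n = qtp L N' e' n"
        using A(1) unfolding P_def by blast
      obtain "is" where is': "xs = map e is" "set is \<subseteq> {..<n}" "length is = length xs"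
        using list_in_image[of xs e n] A(2) e(1) by auto
      have "map f xs = map e' is" using is' A(3) e(1,2) by auto
      moreover have "rel_arity L r = Some (length is)" using xs is'(3) by simp
      ultimately show "rel_int N r xs = rel_int N' r (map f xs)"
        using qtp_rel[OF e(3) _ is'(2), of r] by (simp flip: is'(1))
    qed (use L(1) f(1) in auto)
    thus ?thesis by blast
  qed
  moreover have "is_model M" using M(1) by (auto simp: is_model_def models_def Th_def)
  ultimately show ?thesis
    using M(2) unfolding aleph0_categorical_def aleph0_categorical_theory_def is_model_def by blast
qed

section \<open>Automorphisms of the automorphism group\<close>

lemma not_countable_nat_bool: "\<not> countable (UNIV :: (nat \<Rightarrow> bool) set)"
proof
  assume "countable (UNIV :: (nat \<Rightarrow> bool) set)"
  then obtain f :: "nat \<Rightarrow> nat \<Rightarrow> bool" where f: "range f = UNIV"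
    using uncountable_def[of "UNIV :: (nat \<Rightarrow> bool) set"] by auto
  obtain n where "f n = (\<lambda>k. \<not> f k k)" using f by (metis UNIV_I imageE)
  thus False by (metis (full_types))
qed

context sort_pattern begin

section \<open>Point stabilizers among the subgroups of small index\<close>

definition stab :: "nat set \<Rightarrow> (nat \<Rightarrow> nat) set" where
  "stab A = {g \<in> Gr. \<forall>a\<in>A. g a = a}"

lemma stab_subgrp: "subgrp (stab A)"
  unfolding subgrp_def
proof (intro conjI ballI)
  show "stab A \<subseteq> Gr" by (auto simp: stab_def)
  show "(\<lambda>x. x) \<in> stab A" by (simp add: stab_def Gr_id)
  show "(\<lambda>x. g (h x)) \<in> stab A" if "g \<in> stab A" "h \<in> stab A" for g h
    using that Gr_comp[of g h] by (simp add: stab_def)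
  show "ginv g \<in> stab A" if g: "g \<in> stab A" for g
  proof -
    have "ginv g a = a" if "a \<in> A" for a using g that Gr_inv_f[of g a] by (simp add: stab_def)
    thus ?thesis using g Gr_inv[of g] by (simp add: stab_def)
  qed
qed

lemma countable_index_small:
  assumes H: "subgrp H" and \<phi>: "countable (\<phi> ` Gr)"
    "\<And>g g'. g \<in> Gr \<Longrightarrow> g' \<in> Gr \<Longrightarrow> \<phi> g = \<phi> g' \<Longrightarrow> (\<lambda>x. ginv g (g' x)) \<in> H"
  shows "small_index H"
  unfolding small_index_def
proof
  assume "\<exists>h :: (nat \<Rightarrow> bool) \<Rightarrow> nat \<Rightarrow> nat. (\<forall>a. h a \<in> Gr) \<and> (\<forall>a b. a \<noteq> b \<longrightarrow> (\<lambda>x. ginv (h a) (h b x)) \<notin> H)"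
  then obtain h :: "(nat \<Rightarrow> bool) \<Rightarrow> nat \<Rightarrow> nat" where h: "\<forall>a. h a \<in> Gr" "\<forall>a b. a \<noteq> b \<longrightarrow> (\<lambda>x. ginv (h a) (h b x)) \<notin> H"
    by (elim exE conjE)
  have "inj (\<lambda>a. \<phi> (h a))"
  proof (rule injI, rule ccontr)
    fix a b assume e: "\<phi> (h a) = \<phi> (h b)" "a \<noteq> b"
    have "(\<lambda>x. ginv (h a) (h b x)) \<in> H" by (rule \<phi>(2)[OF _ _ e(1)]) (use h(1) in auto)
    thus False using h(2) e(2) by simp
  qed
  moreover have "countable (range (\<lambda>a. \<phi> (h a)))" by (rule countable_subset[OF _ \<phi>(1)]) (use h(1) in auto)
  ultimately show False using countable_image_inj_eq not_countable_nat_bool by blast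
qed

text \<open>A coset of the stabilizer is determined by the list of values on \<open>A\<close>, and
  there are only countably many lists of natural numbers.\<close>

lemma stab_small:
  assumes A: "finite A" shows "small_index (stab A)"
proof (rule countable_index_small[OF stab_subgrp, of "\<lambda>g. map g (sorted_list_of_set A)"])
  fix g g' assume g: "g \<in> Gr" "g' \<in> Gr" "map g (sorted_list_of_set A) = map g' (sorted_list_of_set A)"
  hence "g a = g' a" if "a \<in> A" for a using that A by simp
  hence "ginv g (g' a) = a" if "a \<in> A" for a using that Gr_inv_f[OF g(1), of a] by simp
  thus "(\<lambda>x. ginv g (g' x)) \<in> stab A" using Gr_comp[OF Gr_inv[OF g(1)] g(2)] by (simp add: stab_def)
qed simp

lemma no_algebraic_points:
  assumes "finite A" "finite X" "b \<notin> A"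
  shows "\<exists>g\<in>stab A. g b \<notin> X"
proof -
  obtain g where "g \<in> Gr" "\<forall>x\<in>A. g x = x" "\<forall>x\<in>insert b A - A. g x \<notin> X"
    using move_away[of "insert b A" A X] assms by auto
  thus ?thesis using assms(3) by (auto simp: stab_def)
qed

lemma stab_point_inj: "stab {a} \<subseteq> stab {b} \<Longrightarrow> a = b"
proof (rule ccontr)
  assume "stab {a} \<subseteq> stab {b}" "a \<noteq> b"
  moreover obtain g where "g \<in> stab {a}" "g b \<notin> {b}"
    using no_algebraic_points[of "{a}" "{b}" b] \<open>a \<noteq> b\<close> by auto
  ultimately show False by (auto simp: stab_def)
qed

lemma stab_point_proper: "stab {a} \<noteq> Gr"
proof -
  obtain g where "g \<in> stab {}" "g a \<notin> {a}" using no_algebraic_points[of "{}" "{a}" a] by auto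
  thus ?thesis by (auto simp: stab_def)
qed

lemma strong_small_index_stab:
  assumes "subgrp H" "small_index H"
  obtains A where "finite A" "stab A \<subseteq> H" "\<And>h. h \<in> H \<Longrightarrow> h ` A = A"
proof -
  obtain A where "finite A" "\<forall>g\<in>Gr. (\<forall>x\<in>A. g x = x) \<longrightarrow> g \<in> H" "\<forall>h\<in>H. h ` A = A"
    using strong_small_index[OF assms] by (elim exE conjE)
  thus ?thesis using that[of A] by (auto simp: stab_def)
qed

text \<open>Every element of \<open>H\<close> preserves a finite support of \<open>H\<close>,
  whereas the stabilizer of \<open>a\<close> can move any other point out of a given finite set. So
  the support is empty or the singleton of \<open>a\<close>.\<close>

lemma stab_point_maximal:
  assumes H: "subgrp H" "small_index H" "stab {a} \<subseteq> H"
  shows "H = stab {a} \<or> H = Gr"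
proof -
  obtain A where A: "finite A" "stab A \<subseteq> H" "\<And>h. h \<in> H \<Longrightarrow> h ` A = A"
    using strong_small_index_stab[OF H(1,2)] by blast
  have "A \<subseteq> {a}"
  proof
    fix b assume b: "b \<in> A"
    show "b \<in> {a}"
    proof (rule ccontr)
      assume "b \<notin> {a}"
      then obtain g where "g \<in> stab {a}" "g b \<notin> A" using no_algebraic_points[of "{a}" A b] A(1) by auto
      thus False using A(3)[of g] H(3) b by blast
    qed
  qed
  hence "A = {} \<or> A = {a}" by blast
  thus ?thesis
  proof
    assume "A = {}"
    thus ?thesis using A(2) H(1) by (auto simp: stab_def subgrp_def)
  next
    assume "A = {a}"
    hence "h \<in> stab {a}" if "h \<in> H" for h using A(3)[OF that] subgrp_Gr[OF H(1) that] by (simp add: stab_def)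
    thus ?thesis using H(3) by blast
  qed
qed

section \<open>Abstract automorphisms come from permutations of the points\<close>

definition is_aut :: "((nat \<Rightarrow> nat) \<Rightarrow> nat \<Rightarrow> nat) \<Rightarrow> bool" where
  "is_aut \<alpha> \<longleftrightarrow> bij_betw \<alpha> Gr Gr \<and> (\<forall>g\<in>Gr. \<forall>h\<in>Gr. \<alpha> (\<lambda>x. g (h x)) = (\<lambda>x. \<alpha> g (\<alpha> h x)))"

lemma is_aut_Gr: "is_aut \<alpha> \<Longrightarrow> g \<in> Gr \<Longrightarrow> \<alpha> g \<in> Gr"
  by (auto simp: is_aut_def bij_betw_def)

lemma is_aut_comp: "is_aut \<alpha> \<Longrightarrow> g \<in> Gr \<Longrightarrow> h \<in> Gr \<Longrightarrow> \<alpha> (\<lambda>x. g (h x)) = (\<lambda>x. \<alpha> g (\<alpha> h x))"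
  by (auto simp: is_aut_def)

lemma is_aut_inj: "is_aut \<alpha> \<Longrightarrow> g \<in> Gr \<Longrightarrow> h \<in> Gr \<Longrightarrow> \<alpha> g = \<alpha> h \<Longrightarrow> g = h"
  by (auto simp: is_aut_def bij_betw_def dest: inj_onD)

lemma is_aut_id:
  assumes \<alpha>: "is_aut \<alpha>" shows "\<alpha> (\<lambda>x. x) = (\<lambda>x. x)"
proof
  fix x
  have "\<alpha> (\<lambda>x. x) (\<alpha> (\<lambda>x. x) x) = \<alpha> (\<lambda>x. x) x" using is_aut_comp[OF \<alpha> Gr_id Gr_id] by (metis (no_types))
  thus "\<alpha> (\<lambda>x. x) x = x" by (rule injD[OF Gr_inj[OF is_aut_Gr[OF \<alpha> Gr_id]]])
qed

lemma is_aut_ginv: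
  assumes \<alpha>: "is_aut \<alpha>" and g: "g \<in> Gr" shows "\<alpha> (ginv g) = ginv (\<alpha> g)"
proof -
  have "\<alpha> (\<lambda>x. g (ginv g x)) = (\<lambda>x. \<alpha> g (\<alpha> (ginv g) x))" by (rule is_aut_comp[OF \<alpha> g Gr_inv[OF g]])
  hence "\<alpha> g (\<alpha> (ginv g) x) = x" for x using g is_aut_id[OF \<alpha>] by (simp add: fun_eq_iff)
  from ginv_eqI[OF is_aut_Gr[OF \<alpha> g] this] show ?thesis by (rule sym)
qed

lemma is_aut_inverse:
  assumes \<alpha>: "is_aut \<alpha>"
  shows "is_aut (inv_into Gr \<alpha>)" "g \<in> Gr \<Longrightarrow> \<alpha> (inv_into Gr \<alpha> g) = g" "g \<in> Gr \<Longrightarrow> inv_into Gr \<alpha> (\<alpha> g) = g"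
proof -
  have b: "bij_betw \<alpha> Gr Gr" using \<alpha> by (simp add: is_aut_def)
  show r: "\<alpha> (inv_into Gr \<alpha> g) = g" if "g \<in> Gr" for g using bij_betw_inv_into_right[OF b that] .
  show l: "inv_into Gr \<alpha> (\<alpha> g) = g" if "g \<in> Gr" for g using bij_betw_inv_into_left[OF b that] .
  have bi: "bij_betw (inv_into Gr \<alpha>) Gr Gr" by (rule bij_betw_inv_into[OF b])
  have mem: "inv_into Gr \<alpha> g \<in> Gr" if "g \<in> Gr" for g using bi that by (auto simp: bij_betw_def)
  show "is_aut (inv_into Gr \<alpha>)"
    unfolding is_aut_def
  proof (intro conjI ballI bi)
    fix g h assume gh: "g \<in> Gr" "h \<in> Gr"
    let ?i = "inv_into Gr \<alpha>"
    have "\<alpha> (\<lambda>x. ?i g (?i h x)) = (\<lambda>x. g (h x))" using is_aut_comp[OF \<alpha> mem[OF gh(1)] mem[OF gh(2)]] r gh by simp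
    thus "?i (\<lambda>x. g (h x)) = (\<lambda>x. ?i g (?i h x))" using l[OF Gr_comp[OF mem[OF gh(1)] mem[OF gh(2)]]] by simp
  qed
qed

lemma is_aut_subgrp:
  assumes \<alpha>: "is_aut \<alpha>" and H: "subgrp H"
  shows "subgrp (\<alpha> ` H)"
  unfolding subgrp_def
proof (intro conjI ballI)
  show "\<alpha> ` H \<subseteq> Gr" using is_aut_Gr[OF \<alpha>] subgrp_Gr[OF H] by blast
  show "(\<lambda>x. x) \<in> \<alpha> ` H"
  proof (rule image_eqI)
    show "(\<lambda>x. x) \<in> H" using H by (simp add: subgrp_def)
  qed (rule is_aut_id[OF \<alpha>, symmetric])
  show "(\<lambda>x. g (h x)) \<in> \<alpha> ` H" if gh: "g \<in> \<alpha> ` H" "h \<in> \<alpha> ` H" for g h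
  proof -
    obtain g' h' where g': "g' \<in> H" "g = \<alpha> g'" and h': "h' \<in> H" "h = \<alpha> h'" using gh by blast
    have "\<alpha> (\<lambda>x. g' (h' x)) = (\<lambda>x. g (h x))" unfolding g' h' by (rule is_aut_comp[OF \<alpha> subgrp_Gr[OF H g'(1)] subgrp_Gr[OF H h'(1)]])
    thus ?thesis using subgrp_comp[OF H g'(1) h'(1)] by (metis image_eqI)
  qed
  show "ginv g \<in> \<alpha> ` H" if gH: "g \<in> \<alpha> ` H" for g
  proof -
    obtain g' where g': "g' \<in> H" "g = \<alpha> g'" using gH by blast
    show ?thesis using is_aut_ginv[OF \<alpha> subgrp_Gr[OF H g'(1)]] subgrp_inv[OF H g'(1)] g'(2) by (metis image_eqI)
  qed
qed

lemma is_aut_small: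
  assumes \<alpha>: "is_aut \<alpha>" and H: "subgrp H" "small_index H"
  shows "small_index (\<alpha> ` H)"
  unfolding small_index_def
proof
  let ?i = "inv_into Gr \<alpha>"
  note i = is_aut_inverse[OF \<alpha>]
  assume "\<exists>h :: (nat \<Rightarrow> bool) \<Rightarrow> nat \<Rightarrow> nat. (\<forall>a. h a \<in> Gr) \<and> (\<forall>a b. a \<noteq> b \<longrightarrow> (\<lambda>x. ginv (h a) (h b x)) \<notin> \<alpha> ` H)"
  then obtain h :: "(nat \<Rightarrow> bool) \<Rightarrow> nat \<Rightarrow> nat" where h: "\<forall>a. h a \<in> Gr" "\<forall>a b. a \<noteq> b \<longrightarrow> (\<lambda>x. ginv (h a) (h b x)) \<notin> \<alpha> ` H"
    by (elim exE conjE)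
  define k where "k a = ?i (h a)" for a
  have hG: "h a \<in> Gr" and kG: "k a \<in> Gr" for a using h(1) is_aut_Gr[OF i(1)] by (simp_all add: k_def)
  have "(\<lambda>x. ginv (k a) (k b x)) \<notin> H" if ab: "a \<noteq> b" for a b
  proof
    assume mem: "(\<lambda>x. ginv (k a) (k b x)) \<in> H"
    have "\<alpha> (\<lambda>x. ginv (k a) (k b x)) = (\<lambda>x. \<alpha> (ginv (k a)) (\<alpha> (k b) x))" by (rule is_aut_comp[OF \<alpha> Gr_inv[OF kG] kG])
    also have "\<dots> = (\<lambda>x. ginv (h a) (h b x))" using is_aut_ginv[OF \<alpha> kG] i(2)[OF hG] by (simp add: k_def)
    finally show False using imageI[OF mem, of \<alpha>] h(2) ab by simp
  qed
  thus False using H(2) kG unfolding small_index_def by blast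
qed

text \<open>Point stabilizers are maximal among the proper subgroups of small index and, in contrast to
  the other maximal ones, have no proper subgroup of finite index.\<close>

lemma is_aut_point_stabilizer:
  assumes \<alpha>: "is_aut \<alpha>"
  shows "\<exists>b. \<alpha> ` stab {a} = stab {b}"
proof -
  let ?i = "inv_into Gr \<alpha>" and ?H = "\<alpha> ` stab {a}"
  note i = is_aut_inverse[OF \<alpha>]
  have H: "subgrp ?H" "small_index ?H"
    using is_aut_subgrp[OF \<alpha> stab_subgrp] is_aut_small[OF \<alpha> stab_subgrp stab_small] by auto
  obtain A where A: "finite A" "stab A \<subseteq> ?H" "\<And>h. h \<in> ?H \<Longrightarrow> h ` A = A"
    using strong_small_index_stab[OF H] by blast
  have stabGr: "g \<in> Gr" if "g \<in> stab B" for g B using that by (simp add: stab_def)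
  \<comment> \<open>This subgroup of the stabilizer of \<open>a\<close> has finite index in it,
    because through \<open>\<alpha>\<close> that stabilizer permutes the finite set
    \<open>A\<close>.\<close>
  let ?L = "?i ` stab A"
  have L: "subgrp ?L" "small_index ?L"
    using is_aut_subgrp[OF i(1) stab_subgrp] is_aut_small[OF i(1) stab_subgrp stab_small[OF A(1)]] by auto
  obtain B where B: "finite B" "stab B \<subseteq> ?L" "\<And>l. l \<in> ?L \<Longrightarrow> l ` B = B"
    using strong_small_index_stab[OF L] by blast
  have "B \<subseteq> {a}"
  proof
    fix c assume c: "c \<in> B"
    show "c \<in> {a}"
    proof (rule ccontr)
      assume ca: "c \<notin> {a}"
      define \<rho> where "\<rho> g = restrict (\<alpha> g) A" for g
      have "\<rho> ` stab {a} \<subseteq> A \<rightarrow>\<^sub>E A"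
      proof
        fix r assume "r \<in> \<rho> ` stab {a}"
        then obtain g where g: "g \<in> stab {a}" "r = \<rho> g" by blast
        have "\<alpha> g ` A = A" by (rule A(3)[OF imageI[OF g(1)]])
        thus "r \<in> A \<rightarrow>\<^sub>E A" unfolding g(2) \<rho>_def by auto
      qed
      hence fin: "finite (\<rho> ` stab {a})" using finite_PiE[OF A(1), of "\<lambda>_. A"] A(1) finite_subset by blast
      \<comment> \<open>Finitely many translates of \<open>B\<close>, one for each permutation of
        \<open>A\<close> that occurs. They would cover the orbit of \<open>c\<close> under the
        stabilizer of \<open>a\<close>, which is infinite as \<open>c\<close> differs from
        \<open>a\<close>.\<close>
      define X where "X = (\<Union>r\<in>\<rho> ` stab {a}. inv_into (stab {a}) \<rho> r ` B)"
      have "finite X" unfolding X_def using fin B(1) by blast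
      then obtain g where g: "g \<in> stab {a}" "g c \<notin> X" using no_algebraic_points[of "{a}" X c] ca by auto
      let ?g = "inv_into (stab {a}) \<rho> (\<rho> g)"
      have g': "?g \<in> stab {a}" "\<rho> ?g = \<rho> g"
        using inv_into_into[OF imageI[OF g(1)]] f_inv_into_f[OF imageI[OF g(1)]] by blast+
      note gG = stabGr[OF g(1)] and g'G = stabGr[OF g'(1)]
      let ?q = "\<lambda>x. ginv ?g (g x)"
      have qG: "?q \<in> Gr" by (rule Gr_comp[OF Gr_inv[OF g'G] gG])
      have \<alpha>q: "\<alpha> ?q = (\<lambda>x. ginv (\<alpha> ?g) (\<alpha> g x))"
        unfolding is_aut_ginv[OF \<alpha> g'G, symmetric] by (rule is_aut_comp[OF \<alpha> Gr_inv[OF g'G] gG])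
      have "\<alpha> ?q x = x" if "x \<in> A" for x
      proof -
        have "\<alpha> ?g x = \<alpha> g x" using fun_cong[OF g'(2), of x] that by (simp add: \<rho>_def)
        thus ?thesis unfolding \<alpha>q using Gr_inv_f[OF is_aut_Gr[OF \<alpha> g'G], of x] by simp
      qed
      hence "\<alpha> ?q \<in> stab A" using is_aut_Gr[OF \<alpha> qG] by (simp add: stab_def)
      hence "?i (\<alpha> ?q) \<in> ?L" by (rule imageI)
      hence "?q \<in> ?L" unfolding i(3)[OF qG] .
      hence "?q c \<in> B" using B(3) c by blast
      hence "?g (?q c) \<in> ?g ` B" by (rule imageI)
      hence "g c \<in> ?g ` B" using g'G by simp
      hence "g c \<in> X" unfolding X_def using g(1) by blast
      thus False using g(2) by simp
    qed
  qed
  hence "stab {a} \<subseteq> stab B" by (auto simp: stab_def)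
  hence "stab {a} \<subseteq> ?L" using B(2) by blast
  hence "\<alpha> ` stab {a} \<subseteq> \<alpha> ` ?L" by (rule image_mono)
  also have "\<alpha> ` ?L = stab A" using i(2) stabGr by (simp add: image_image)
  finally have HA: "?H = stab A" using A(2) by blast
  \<comment> \<open>The image lies in the stabilizer of \<open>b\<close>. Pulled back along
    \<open>\<alpha>\<close>, maximality of the stabilizer of \<open>a\<close> leaves only equality,
    since the stabilizer of \<open>b\<close> is proper.\<close>
  have point: "?H = stab {b}" if b: "b \<in> A" for b
  proof -
    have "?H \<subseteq> stab {b}" unfolding HA using b by (auto simp: stab_def)
    hence "?i ` ?H \<subseteq> ?i ` stab {b}" by (rule image_mono)
    moreover have "?i ` ?H = stab {a}" using i(3) stabGr by (simp add: image_image)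
    ultimately have "stab {a} \<subseteq> ?i ` stab {b}" by simp
    hence "?i ` stab {b} = stab {a} \<or> ?i ` stab {b} = Gr"
      by (intro stab_point_maximal is_aut_subgrp[OF i(1) stab_subgrp] is_aut_small[OF i(1) stab_subgrp stab_small]) auto
    moreover have \<alpha>i: "\<alpha> ` ?i ` stab {b} = stab {b}" using i(2) stabGr by (simp add: image_image)
    moreover have "\<alpha> ` Gr = Gr" using \<alpha> by (simp add: is_aut_def bij_betw_def)
    ultimately show ?thesis using stab_point_proper[of b] by metis
  qed
  have "A \<noteq> {}"
  proof
    assume "A = {}"
    hence "?H = Gr" using HA by (simp add: stab_def)
    hence "\<alpha> ` stab {a} = \<alpha> ` Gr" using \<alpha> by (simp add: is_aut_def bij_betw_def)
    hence "?i ` \<alpha> ` stab {a} = ?i ` \<alpha> ` Gr" by simp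
    hence "stab {a} = Gr" using i(3) stabGr by (simp add: image_image)
    thus False using stab_point_proper by blast
  qed
  thus ?thesis using point by blast
qed

text \<open>\<open>\<sigma> a\<close> is the point whose stabilizer is the image of the stabilizer
  of \<open>a\<close>. Conjugation moves stabilizers along with points, and stabilizers determine
  points, so \<open>\<sigma>\<close> intertwines \<open>g\<close> with
  \<open>\<alpha> g\<close>.\<close>

lemma is_aut_induced:
  assumes \<alpha>: "is_aut \<alpha>"
  shows "\<exists>\<sigma>. bij \<sigma> \<and> (\<forall>g\<in>Gr. \<forall>x. \<alpha> g (\<sigma> x) = \<sigma> (g x))"
proof -
  let ?i = "inv_into Gr \<alpha>"
  note i = is_aut_inverse[OF \<alpha>]
  have stabGr: "g \<in> Gr" if "g \<in> stab B" for g B using that by (simp add: stab_def)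
  obtain \<sigma> where \<sigma>: "\<And>a. \<alpha> ` stab {a} = stab {\<sigma> a}" using is_aut_point_stabilizer[OF \<alpha>] by metis
  obtain \<tau> where \<tau>: "\<And>a. ?i ` stab {a} = stab {\<tau> a}" using is_aut_point_stabilizer[OF i(1)] by metis
  have i\<alpha>: "?i ` \<alpha> ` stab B = stab B" and \<alpha>i: "\<alpha> ` ?i ` stab B = stab B" for B
    using i(2,3) stabGr by (simp_all add: image_image)
  have "\<tau> (\<sigma> a) = a" for a using i\<alpha>[of "{a}"] \<sigma> \<tau> stab_point_inj by (metis order_refl)
  moreover have "\<sigma> (\<tau> a) = a" for a using \<alpha>i[of "{a}"] \<sigma> \<tau> stab_point_inj by (metis order_refl)
  ultimately have "bij \<sigma>" by (rule o_bij[of \<tau> \<sigma>, unfolded comp_def id_def fun_eq_iff, OF allI allI])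
  moreover have "\<alpha> g (\<sigma> x) = \<sigma> (g x)" if g: "g \<in> Gr" for g x
  proof -
    have "stab {\<alpha> g (\<sigma> x)} \<subseteq> stab {\<sigma> (g x)}"
    proof
      fix h assume h: "h \<in> stab {\<alpha> g (\<sigma> x)}"
      define k where "k = ?i h"
      have k: "k \<in> Gr" "\<alpha> k = h" using is_aut_Gr[OF i(1)] i(2) stabGr[OF h] by (simp_all add: k_def)
      let ?c = "\<lambda>y. ginv g (k (g y))"
      have kg: "(\<lambda>y. k (g y)) \<in> Gr" by (rule Gr_comp[OF k(1) g])
      have c: "?c \<in> Gr" by (rule Gr_comp[OF Gr_inv[OF g] kg])
      have "\<alpha> ?c = (\<lambda>y. \<alpha> (ginv g) (\<alpha> (\<lambda>y. k (g y)) y))" by (rule is_aut_comp[OF \<alpha> Gr_inv[OF g] kg])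
      also have "\<dots> = (\<lambda>y. ginv (\<alpha> g) (h (\<alpha> g y)))"
        using is_aut_ginv[OF \<alpha> g] is_aut_comp[OF \<alpha> k(1) g] k(2) by simp
      finally have \<alpha>c: "\<alpha> ?c = (\<lambda>y. ginv (\<alpha> g) (h (\<alpha> g y)))" .
      have "\<alpha> ?c (\<sigma> x) = \<sigma> x" unfolding \<alpha>c using h is_aut_Gr[OF \<alpha> g] by (simp add: stab_def)
      hence "\<alpha> ?c \<in> stab {\<sigma> x}" using is_aut_Gr[OF \<alpha> c] by (simp add: stab_def)
      hence "\<alpha> ?c \<in> \<alpha> ` stab {x}" unfolding \<sigma> .
      then obtain c' where "c' \<in> stab {x}" "\<alpha> ?c = \<alpha> c'" by (elim imageE) 
      hence "?c \<in> stab {x}" using is_aut_inj[OF \<alpha> c stabGr] by metis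
      hence "ginv g (k (g x)) = x" by (simp add: stab_def)
      hence "k (g x) = g x" using Gr_f_inv[OF g, of "k (g x)"] by simp
      hence "k \<in> stab {g x}" using k(1) by (simp add: stab_def)
      hence "\<alpha> k \<in> \<alpha> ` stab {g x}" by (rule imageI)
      thus "h \<in> stab {\<sigma> (g x)}" unfolding k(2) \<sigma> .
    qed
    thus ?thesis by (rule stab_point_inj)
  qed
  ultimately show ?thesis by blast
qed

text \<open>No relation holds on fewer than \<open>N\<close> points, so the sorts are the only
  constraint there.\<close>

lemma emb_few:
  assumes "finite A" "card A < N" "inj_on h A" "\<And>x. x \<in> A \<Longrightarrow> srt (h x) = srt x"
  shows "emb h A srt R srt R"
proof (rule embI[OF assms(3)])
  show "srt (h x) = srt x" if "x \<in> A" for x using assms(4) that .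
  fix S t assume S: "finite S" "S \<subseteq> A" "t \<in> S"
  have c: "card S < N" using card_mono[OF assms(1) S(2)] assms(2) by simp
  have "card (h ` S) = card S" using inj_on_subset[OF assms(3) S(2)] by (rule card_image)
  thus "R (h t) (h ` S) = R t S" using c allowed_card[OF allowed_M] by fastforce
qed

lemma same_sort_iff: "srt x = srt y \<longleftrightarrow> (\<exists>g\<in>Gr. g x = y)"
proof
  assume e: "srt x = srt y"
  have "emb (\<lambda>_. y) {x} srt R srt R" by (rule emb_few) (use e N_ge2 in auto)
  from homogeneity[OF _ this] show "\<exists>g\<in>Gr. g x = y" by simp
next
  assume "\<exists>g\<in>Gr. g x = y"
  thus "srt x = srt y" using Gr_srt by metis
qed

lemma sort_surj: "v \<in> V \<Longrightarrow> \<exists>x. srt x = v"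
proof -
  assume v: "v \<in> V"
  have "valid {()} (\<lambda>_. v) (\<lambda>_ _. False)" by (rule valid_empty) (use v in auto)
  moreover have "emb (\<lambda>_. 0) {} (\<lambda>_::unit. v) (\<lambda>_ _. False) srt R" by (simp add: emb_def)
  ultimately obtain e where "emb e {()} (\<lambda>_. v) (\<lambda>_ _. False) srt R"
    using extension[of "{()}" "{}" "\<lambda>_. v" "\<lambda>_ _. False" "\<lambda>_. 0" "{}"] by auto
  thus ?thesis using emb_sort by (metis insertI1)
qed

section \<open>Permutations that normalize the automorphism group\<close>

definition normalizes :: "(nat \<Rightarrow> nat) \<Rightarrow> bool" where
  "normalizes \<sigma> \<longleftrightarrow> bij \<sigma> \<and> (\<forall>g\<in>Gr. \<exists>g'\<in>Gr. \<forall>x. g' (\<sigma> x) = \<sigma> (g x)) \<and> (\<forall>g'\<in>Gr. \<exists>g\<in>Gr. \<forall>x. g' (\<sigma> x) = \<sigma> (g x))"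

lemma normalizes_inv:
  assumes "normalizes \<sigma>" shows "normalizes (ginv \<sigma>)"
proof -
  have b: "bij \<sigma>" using assms by (simp add: normalizes_def)
  have l: "ginv \<sigma> (\<sigma> x) = x" and r: "\<sigma> (ginv \<sigma> x) = x" for x
    using b by (simp_all add: bij_is_inj bij_is_surj surj_f_inv_f)
  have "(\<forall>x. g' (\<sigma> x) = \<sigma> (g x)) \<longleftrightarrow> (\<forall>x. g (ginv \<sigma> x) = ginv \<sigma> (g' x))" for g g'
    by (metis l r)
  thus ?thesis using assms bij_imp_bij_inv[OF b] unfolding normalizes_def by auto
qed

lemma normalizes_sort:
  assumes "normalizes \<sigma>" "srt x = srt y" shows "srt (\<sigma> x) = srt (\<sigma> y)"
proof -
  obtain g where g: "g \<in> Gr" "g x = y" using assms(2) same_sort_iff by blast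
  then obtain g' where "g' \<in> Gr" "\<forall>x. g' (\<sigma> x) = \<sigma> (g x)" using assms(1) unfolding normalizes_def by blast
  thus ?thesis using g(2) Gr_srt by metis
qed

end

section \<open>Reconstructing the relation from the permutation group\<close>

locale rigid_pattern = sort_pattern +
  assumes pat_diag: "\<And>v u. v \<in> V \<Longrightarrow> u \<in> V \<Longrightarrow> pat v u = 3 \<longleftrightarrow> u = v"
begin

text \<open>If some relation holds on \<open>S\<close>, it holds for exactly two of the three points that are allowed
  for \<open>S\<close>; the remaining one is definable from the permutation group alone.\<close>

definition third :: "nat \<Rightarrow> nat set \<Rightarrow> bool" where
  "third x S \<longleftrightarrow> finite S \<and> card S = N \<and> x \<in> S \<and> (\<exists>y\<in>S. y \<noteq> x \<and> srt y = srt x) \<and> (\<forall>g\<in>Gr. g ` S = S \<longrightarrow> g x = x)"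

lemma allowed_sort_class:
  assumes "allowed s x S" shows "card {y\<in>S. s y = s x} = 3"
  using assms pat_diag[of "s x" "s x"] by (auto simp: allowed_def)

text \<open>Only the sort \<open>v\<close> itself occurs exactly three times in the pattern of
  \<open>v\<close>, so a set determines the sort of the points that may be chosen in it.\<close>

lemma allowed_same_sort:
  assumes "allowed s x S" "t \<in> S" shows "allowed s t S \<longleftrightarrow> s t = s x"
proof
  assume "allowed s t S"
  hence "card {y\<in>S. s y = s x} = pat (s t) (s x)" and V: "s t \<in> V" "s x \<in> V"
    using assms(1) by (auto simp: allowed_def)
  thus "s t = s x" using allowed_sort_class[OF assms(1)] pat_diag by metis
next
  assume "s t = s x"
  thus "allowed s t S" using assms by (simp add: allowed_def)
qed

text \<open>The number of chosen points is even, not zero, and at most the three points of the sort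
  in question.\<close>

lemma R_pair:
  assumes "R t S"
  shows "card {t. R t S} = 2" "{t. R t S} \<subseteq> {y\<in>S. srt y = srt t}" "card {y\<in>S. srt y = srt t} = 3" "finite S"
proof -
  note a = allowed_M[OF assms]
  show S: "finite S" using a by (simp add: allowed_def)
  show sub: "{t. R t S} \<subseteq> {y\<in>S. srt y = srt t}"
    using allowed_same_sort[OF a] allowed_M R_mem by blast
  show c3: "card {y\<in>S. srt y = srt t} = 3" by (rule allowed_sort_class[OF a])
  have "card {t. R t S} \<le> 3" using card_mono[OF _ sub] S c3 by simp
  moreover have "even (card {t. R t S})" by (rule valid_even[OF valid_M S]) simp
  moreover have "finite {t. R t S}" using finite_subset[OF sub] S by simp
  hence "card {t. R t S} \<noteq> 0" using assms by auto
  ultimately have "card {t. R t S} \<in> {1, 2, 3} \<and> even (card {t. R t S})" by auto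
  thus "card {t. R t S} = 2" by auto
qed

text \<open>If two of three points are chosen, automorphisms preserving \<open>S\<close> fix the
  remaining one. Conversely, a point that the relation does not tell apart from another point of its
  sort is moved by their transposition: smaller subsets carry no relation, so this is a partial
  automorphism, and homogeneity extends it.\<close>

lemma third_iff: "third x S \<longleftrightarrow> allowed srt x S \<and> (\<exists>t. R t S) \<and> \<not> R x S"
proof
  assume h: "allowed srt x S \<and> (\<exists>t. R t S) \<and> \<not> R x S"
  then obtain t where t: "R t S" by blast
  note p = R_pair[OF t]
  have xt: "srt x = srt t" using allowed_same_sort[OF allowed_M[OF t], of x] h allowed_mem[of srt x S] by blast
  have xS: "x \<in> S" using h allowed_mem[of srt x S] by simp
  let ?T = "{y\<in>S. srt y = srt t}"
  have "card (?T - {t. R t S}) = 1"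
    using p(1,3) finite_subset[OF p(2)] p(2,4) by (simp add: card_Diff_subset)
  moreover have "x \<in> ?T - {t. R t S}" using h xt xS by simp
  ultimately have T: "?T - {t. R t S} = {x}" by (metis card_1_singletonE singletonD)
  have "g x = x" if g: "g \<in> Gr" "g ` S = S" for g
  proof -
    have "\<not> R (g x) S" using Gr_R[OF g(1), of x S] g(2) h by simp
    moreover have "g x \<in> ?T" using g xS xt Gr_srt[OF g(1)] by auto
    ultimately show ?thesis using T by blast
  qed
  moreover have "t \<in> S" "t \<noteq> x" using R_mem[OF t] t h by auto
  ultimately show "third x S" unfolding third_def
    using h xt xS p(4) allowed_card[of srt x S] by auto
next
  assume h: "third x S"
  have diff: "R y S \<noteq> R x S" if y: "y \<in> S" "y \<noteq> x" "srt y = srt x" for y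
  proof
    assume e: "R y S = R x S"
    define \<tau> where "\<tau> z = (if z = x then y else if z = y then x else z)" for z
    have inv: "\<tau> (\<tau> z) = z" for z by (simp add: \<tau>_def)
    have inj: "inj_on \<tau> A" for A by (rule inj_on_inverseI[of _ \<tau>]) (rule inv)
    have \<tau>S: "\<tau> ` S = S"
    proof -
      have "\<tau> ` S \<subseteq> S" using h y by (auto simp: \<tau>_def third_def)
      thus ?thesis using h endo_inj_surj[OF _ _ inj] by (simp add: third_def)
    qed
    have "emb \<tau> S srt R srt R"
    proof (rule embI[OF inj])
      show s: "srt (\<tau> z) = srt z" for z using y(3) by (simp add: \<tau>_def)
      fix S' t assume S': "finite S'" "S' \<subseteq> S" "t \<in> S'"
      show "R (\<tau> t) (\<tau> ` S') = R t S'"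
      proof (cases "S' = S")
        case True
        thus ?thesis using e \<tau>S by (simp add: \<tau>_def)
      next
        case False
        hence "card S' < N" using h S' psubset_card_mono[of S S'] by (auto simp: third_def)
        hence "emb \<tau> S' srt R srt R" by (intro emb_few S' inj s)
        thus ?thesis by (rule emb_rel[OF _ S'(1) order_refl S'(3)])
      qed
    qed
    moreover have "finite S" using h by (simp add: third_def)
    ultimately obtain g where g: "g \<in> Gr" "\<forall>z\<in>S. g z = \<tau> z" using homogeneity by blast
    have "g ` S = \<tau> ` S" using g(2) by (intro image_cong) auto
    hence "g ` S = S" using \<tau>S by simp
    hence "g x = x" using h g(1) by (simp add: third_def)
    thus False using g(2) h y by (simp add: third_def \<tau>_def)
  qed
  \<comment> \<open>If \<open>x\<close> were chosen, the second chosen point would have the same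
    sort and would not be told apart from \<open>x\<close>.\<close>
  have nx: "\<not> R x S"
  proof
    assume rx: "R x S"
    have "\<not> {t. R t S} \<subseteq> {x}" using R_pair(1)[OF rx] card_mono[of "{x}" "{t. R t S}"] by auto
    then obtain y where y: "R y S" "y \<noteq> x" by blast
    thus False using diff[OF R_mem[OF y(1)] y(2)] R_pair(2)[OF rx] rx by blast
  qed
  obtain y where y: "y \<in> S" "y \<noteq> x" "srt y = srt x" using h by (auto simp: third_def)
  have ry: "R y S" using diff[OF y] nx by simp
  have "allowed srt x S" using allowed_same_sort[OF allowed_M[OF ry], of x] h y by (simp add: third_def)
  thus "allowed srt x S \<and> (\<exists>t. R t S) \<and> \<not> R x S" using ry nx by blast
qed

text \<open>The chosen points are exactly the companions of the exceptional point in its sort. This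
  expresses \<open>R\<close> by notions that every normalizing permutation respects.\<close>

lemma R_iff_third: "R t S \<longleftrightarrow> (\<exists>x. third x S \<and> t \<in> S \<and> t \<noteq> x \<and> srt t = srt x)"
proof
  assume t: "R t S"
  note p = R_pair[OF t]
  have "\<not> {y\<in>S. srt y = srt t} \<subseteq> {t. R t S}"
    using card_mono[of "{t. R t S}" "{y\<in>S. srt y = srt t}"] p finite_subset[OF p(2)] by auto
  then obtain x where x: "x \<in> S" "srt x = srt t" "\<not> R x S" by blast
  hence "third x S" unfolding third_iff using allowed_same_sort[OF allowed_M[OF t], of x] t by blast
  thus "\<exists>x. third x S \<and> t \<in> S \<and> t \<noteq> x \<and> srt t = srt x" using x t R_mem[OF t] by metis
next
  assume "\<exists>x. third x S \<and> t \<in> S \<and> t \<noteq> x \<and> srt t = srt x"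
  then obtain x where x: "third x S" "t \<in> S" "t \<noteq> x" "srt t = srt x" by blast
  then obtain y where y: "R y S" "allowed srt x S" "\<not> R x S" using third_iff by blast
  note p = R_pair[OF y(1)]
  have xy: "srt x = srt y" using allowed_same_sort[OF y(2) R_mem[OF y(1)]] allowed_M[OF y(1)] by simp
  show "R t S"
  proof (rule ccontr)
    assume nt: "\<not> R t S"
    have "{t, x} \<union> {t. R t S} \<subseteq> {z\<in>S. srt z = srt y}" using p(2) x xy allowed_mem[OF y(2)] by auto
    hence "card ({t, x} \<union> {t. R t S}) \<le> 3" using card_mono[of "{z\<in>S. srt z = srt y}"] p(3,4) by simp
    moreover have "card ({t, x} \<union> {t. R t S}) = 2 + 2"
      using nt y(3) x(3) p(1) finite_subset[OF p(2)] p(4) by (subst card_Un_disjoint) auto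
    ultimately show False by simp
  qed
qed

lemma normalizes_third:
  assumes n: "normalizes \<sigma>" and t: "third x S" shows "third (\<sigma> x) (\<sigma> ` S)"
proof -
  have inj: "inj \<sigma>" using n by (auto simp: normalizes_def bij_is_inj)
  obtain y where y: "y \<in> S" "y \<noteq> x" "srt y = srt x" using t by (auto simp: third_def)
  have "\<sigma> y \<in> \<sigma> ` S" "\<sigma> y \<noteq> \<sigma> x" "srt (\<sigma> y) = srt (\<sigma> x)"
    using y normalizes_sort[OF n y(3)] inj by (simp_all add: inj_eq)
  moreover have "g' (\<sigma> x) = \<sigma> x" if g': "g' \<in> Gr" "g' ` \<sigma> ` S = \<sigma> ` S" for g'
  proof -
    obtain g where g: "g \<in> Gr" "\<forall>x. g' (\<sigma> x) = \<sigma> (g x)" using n g'(1) unfolding normalizes_def by blast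
    have "\<sigma> ` g ` S = \<sigma> ` S" using g'(2) g(2) by (simp add: image_image)
    hence "g ` S = S" using inj by (simp add: inj_image_eq_iff)
    hence "g x = x" using t g(1) unfolding third_def by blast
    thus ?thesis using g(2) by simp
  qed
  moreover have "card (\<sigma> ` S) = card S" by (rule card_image[OF inj_on_subset[OF inj subset_UNIV]])
  ultimately show ?thesis using t unfolding third_def by blast
qed

lemma normalizes_third_iff:
  assumes n: "normalizes \<sigma>" shows "third (\<sigma> x) (\<sigma> ` S) \<longleftrightarrow> third x S"
proof
  assume "third (\<sigma> x) (\<sigma> ` S)"
  from normalizes_third[OF normalizes_inv[OF n] this] show "third x S"
    using n by (simp add: normalizes_def bij_is_inj image_image)
qed (rule normalizes_third[OF n])

lemma normalizes_sort_iff: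
  assumes n: "normalizes \<sigma>" shows "srt (\<sigma> x) = srt (\<sigma> y) \<longleftrightarrow> srt x = srt y"
proof
  assume "srt (\<sigma> x) = srt (\<sigma> y)"
  from normalizes_sort[OF normalizes_inv[OF n] this] show "srt x = srt y"
    using n by (simp add: normalizes_def bij_is_inj)
qed (rule normalizes_sort[OF n])

lemma normalizes_R:
  assumes n: "normalizes \<sigma>" shows "R (\<sigma> t) (\<sigma> ` S) = R t S"
proof -
  have b: "bij \<sigma>" using n by (simp add: normalizes_def)
  have "R (\<sigma> t) (\<sigma> ` S) \<longleftrightarrow> (\<exists>x. third (\<sigma> x) (\<sigma> ` S) \<and> \<sigma> t \<in> \<sigma> ` S \<and> \<sigma> t \<noteq> \<sigma> x \<and> srt (\<sigma> t) = srt (\<sigma> x))"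
  proof -
    have "(\<exists>x. p x) \<longleftrightarrow> (\<exists>x. p (\<sigma> x))" for p using bij_is_surj[OF b] by (metis surjD)
    thus ?thesis unfolding R_iff_third by simp
  qed
  also have "\<dots> \<longleftrightarrow> (\<exists>x. third x S \<and> t \<in> S \<and> t \<noteq> x \<and> srt t = srt x)"
    unfolding normalizes_third_iff[OF n] normalizes_sort_iff[OF n]
    using bij_is_inj[OF b] by (simp add: inj_image_mem_iff inj_eq)
  finally show ?thesis by (simp add: R_iff_third)
qed

lemma third_exists:
  assumes v: "v \<in> V" shows "\<exists>x S. third x S \<and> srt x = v"
proof -
  define P where "P = (SIGMA u:V. {..<pat v u})"
  \<comment> \<open>\<open>P\<close> realizes the pattern of \<open>v\<close>. Two of its three
    points of sort \<open>v\<close> are chosen, which leaves \<open>(v, 0)\<close> as the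
    exceptional one.\<close>
  define Q where "Q = (\<lambda>t S. S = P \<and> (t = (v, 1 :: nat) \<or> t = (v, 2)))"
  have finP: "finite P" using finite_V by (simp add: P_def)
  have pts: "(v, i) \<in> P" if "i < 3" for i using v pat_diag[OF v v] that by (simp add: P_def)
  have "{x\<in>P. fst x = u} = {u} \<times> {..<pat v u}" if "u \<in> V" for u using that by (auto simp: P_def)
  hence allowed: "allowed fst (v, i) P" if "i < 3" for i
    using finP pts[OF that] by (auto simp: allowed_def P_def card_cartesian_product_singleton)
  have val: "valid P fst Q"
    unfolding valid_def
  proof (intro conjI allI impI)
    show "fst ` P \<subseteq> V" by (auto simp: P_def)
    fix S assume "finite S \<and> S \<subseteq> P"
    show "allowed fst t S" if "Q t S" for t using that allowed by (auto simp: Q_def)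
    have "{t. Q t S} = (if S = P then {(v, 1), (v, 2)} else {})" by (auto simp: Q_def)
    thus "even (card {t. Q t S})" by simp
  qed
  obtain e where e: "emb e P fst Q srt R"
    using extension[OF finP empty_subsetI val, of "\<lambda>_. 0" "{}"] by (auto simp: emb_def)
  have "third (e (v, 0)) (e ` P)"
    unfolding third_iff
  proof (intro conjI exI)
    show "allowed srt (e (v, 0)) (e ` P)"
      using allowed_image[where s = fst and s' = srt and f = e, OF emb_inj[OF e] emb_sort[OF e] pts[of 0] finP] allowed[of 0] by simp
    show "R (e (v, 1)) (e ` P)" using emb_rel[OF e finP order_refl pts[of 1]] by (simp add: Q_def)
    show "\<not> R (e (v, 0)) (e ` P)" using emb_rel[OF e finP order_refl pts[of 0]] by (simp add: Q_def)
  qed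
  moreover have "srt (e (v, 0)) = v" using emb_sort[OF e pts[of 0]] by simp
  ultimately show ?thesis by blast
qed

text \<open>Sort classes are orbits, so \<open>\<sigma>\<close> permutes them by some
  \<open>\<pi>\<close>. It takes a set with an exceptional point of sort \<open>v\<close> to one
  with an exceptional point of sort \<open>\<pi> v\<close>, and counting the points of each sort in
  both sets compares the patterns.\<close>

lemma normalizes_twist:
  assumes n: "normalizes \<sigma>"
  shows "\<exists>\<pi>. twist \<pi> \<and> (\<forall>x. srt (\<sigma> x) = \<pi> (srt x))"
proof -
  have b: "bij \<sigma>" using n by (simp add: normalizes_def)
  define \<pi> where "\<pi> v = srt (\<sigma> (SOME x. srt x = v))" for v
  have \<pi>: "srt (\<sigma> x) = \<pi> (srt x)" for x
    unfolding \<pi>_def normalizes_sort_iff[OF n] by (rule someI[of "\<lambda>y. srt y = srt x", OF refl, symmetric])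
  have inj: "inj_on \<pi> V"
  proof (rule inj_onI)
    fix v u assume "v \<in> V" "u \<in> V" "\<pi> v = \<pi> u"
    then obtain x y where "srt x = v" "srt y = u" using sort_surj by meson
    thus "v = u" using \<open>\<pi> v = \<pi> u\<close> \<pi>[of x] \<pi>[of y] normalizes_sort_iff[OF n, of x y] by simp
  qed
  have V: "\<pi> v \<in> V" if "v \<in> V" for v using srt_in by (simp add: \<pi>_def)
  have "bij_betw \<pi> V V" using inj V endo_inj_surj[OF finite_V _ inj] by (auto simp: bij_betw_def)
  moreover have "pat (\<pi> v) (\<pi> u) = pat v u" if v: "v \<in> V" and u: "u \<in> V" for v u
  proof -
    obtain x S where x: "third x S" "srt x = v" using third_exists[OF v] by blast
    have 1: "card {y\<in>S. srt y = u} = pat v u" using x u by (auto simp: third_iff allowed_def)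
    have "allowed srt (\<sigma> x) (\<sigma> ` S)" using normalizes_third[OF n x(1)] by (simp add: third_iff)
    hence 2: "card {y\<in>\<sigma> ` S. srt y = \<pi> u} = pat (\<pi> v) (\<pi> u)" using x(2) \<pi>[of x] V[OF u] by (simp add: allowed_def)
    have "srt (\<sigma> y) = \<pi> u \<longleftrightarrow> srt y = u" for y using \<pi>[of y] inj_on_eq_iff[OF inj srt_in u] by simp
    hence "{y\<in>\<sigma> ` S. srt y = \<pi> u} = \<sigma> ` {y\<in>S. srt y = u}" by auto
    hence "card {y\<in>\<sigma> ` S. srt y = \<pi> u} = card {y\<in>S. srt y = u}"
      using card_image[OF inj_on_subset[OF bij_is_inj[OF b] subset_UNIV]] by metis
    thus ?thesis using 1 2 by simp
  qed
  ultimately show ?thesis using \<pi> unfolding twist_def by blast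
qed

lemma normalizes_Gr_iff:
  assumes n: "normalizes \<sigma>" shows "\<sigma> \<in> Gr \<longleftrightarrow> (\<forall>x. srt (\<sigma> x) = srt x)"
proof
  assume "\<forall>x. srt (\<sigma> x) = srt x"
  hence "emb \<sigma> UNIV srt R srt R" using n normalizes_R[OF n] by (auto simp: emb_def normalizes_def bij_is_inj)
  thus "\<sigma> \<in> Gr" using n by (simp add: Gr_def normalizes_def)
qed (simp add: Gr_srt)

lemma twist_normalizes:
  assumes \<pi>: "twist \<pi>"
  shows "\<exists>\<sigma>. normalizes \<sigma> \<and> (\<forall>x. srt (\<sigma> x) = \<pi> (srt x))"
proof -
  obtain \<sigma> where \<sigma>: "bij \<sigma>" "emb \<sigma> UNIV (\<lambda>x. \<pi> (srt x)) R srt R"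
    using twisted_homogeneity[OF \<pi>, of "{}" "\<lambda>x. x"] by (auto simp: emb_def)
  have l: "ginv \<sigma> (\<sigma> x) = x" and r: "\<sigma> (ginv \<sigma> x) = x" for x
    using \<sigma>(1) by (simp_all add: bij_is_inj bij_is_surj surj_f_inv_f)
  have s: "srt (\<sigma> x) = \<pi> (srt x)" for x using emb_sort[OF \<sigma>(2)] by simp
  have ii: "emb (ginv \<sigma>) UNIV srt R (\<lambda>x. \<pi> (srt x)) R" using emb_inv_into[OF \<sigma>(2)] \<sigma>(1) by (simp add: bij_is_surj)
  \<comment> \<open>Renaming sorts injectively on both sides does not change which maps are
    embeddings.\<close>
  have conv: "emb f A (\<lambda>x. \<pi> (srt x)) R (\<lambda>x. \<pi> (srt x)) R \<longleftrightarrow> emb f A srt R srt R" for f A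
  proof -
    have "\<pi> (srt a) = \<pi> (srt b) \<longleftrightarrow> srt a = srt b" for a b
      using \<pi> srt_in unfolding twist_def by (metis bij_betw_imp_inj_on inj_on_eq_iff)
    thus ?thesis by (auto simp: emb_def)
  qed
  have 1: "\<exists>g'\<in>Gr. \<forall>x. g' (\<sigma> x) = \<sigma> (g x)" if g: "g \<in> Gr" for g
  proof (rule bexI)
    show "\<forall>x. (\<lambda>x. \<sigma> (g (ginv \<sigma> x))) (\<sigma> x) = \<sigma> (g x)" by (simp add: l)
    have "emb g UNIV (\<lambda>x. \<pi> (srt x)) R (\<lambda>x. \<pi> (srt x)) R" using Gr_emb[OF g] by (simp add: conv)
    from emb_trans[OF emb_trans[OF ii this subset_UNIV] \<sigma>(2) subset_UNIV]
    show "(\<lambda>x. \<sigma> (g (ginv \<sigma> x))) \<in> Gr"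
      using bij_comp[OF bij_comp[OF bij_imp_bij_inv[OF \<sigma>(1)] Gr_bij[OF g]] \<sigma>(1)] by (simp add: Gr_def comp_def)
  qed
  have 2: "\<exists>g\<in>Gr. \<forall>x. g' (\<sigma> x) = \<sigma> (g x)" if g: "g' \<in> Gr" for g'
  proof (rule bexI)
    show "\<forall>x. g' (\<sigma> x) = \<sigma> ((\<lambda>x. ginv \<sigma> (g' (\<sigma> x))) x)" by (simp add: r)
    from emb_trans[OF emb_trans[OF \<sigma>(2) Gr_emb[OF g] subset_UNIV] ii subset_UNIV]
    show "(\<lambda>x. ginv \<sigma> (g' (\<sigma> x))) \<in> Gr"
      using bij_comp[OF bij_comp[OF \<sigma>(1) Gr_bij[OF g]] bij_imp_bij_inv[OF \<sigma>(1)]] by (simp add: Gr_def comp_def conv)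
  qed
  have "normalizes \<sigma>" using \<sigma>(1) 1 2 unfolding normalizes_def by blast
  thus ?thesis using s by blast
qed

end

section \<open>The outer automorphism group\<close>

context sort_pattern begin

section \<open>The structure in a finite relational language\<close>

definition Lng :: "(nat, nat) lang" where
  "Lng = \<lparr>fun_arity = \<lambda>_. None, rel_arity = \<lambda>r. if r = 0 then Some N else if r \<le> card V then Some 1 else None\<rparr>"

text \<open>The head of a tuple is the chosen point; of the remaining entries only the set matters.
  A tuple of length \<open>N\<close> with repetitions has fewer than \<open>N\<close> distinct
  entries, so \<open>R\<close> fails on it. The symbols from 1 to \<open>card V\<close> name the
  sorts.\<close>

definition Str :: "(nat, nat, nat) struct" where
  "Str = \<lparr>univ = UNIV, fun_int = \<lambda>_ _. 0,
     rel_int = \<lambda>r xs. if r = 0 then R (hd xs) (set xs) else srt (hd xs) = from_nat_into V (r - 1)\<rparr>"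

lemma Lng_simps [simp]:
  "fun_arity Lng f = None" "rel_arity Lng r = (if r = 0 then Some N else if r \<le> card V then Some 1 else None)"
  by (simp_all add: Lng_def)

lemma Str_simps [simp]:
  "univ Str = UNIV" "rel_int Str r xs = (if r = 0 then R (hd xs) (set xs) else srt (hd xs) = from_nat_into V (r - 1))"
  by (simp_all add: Str_def)

lemma is_struct_Str: "is_struct Lng Str"
  by (simp add: is_struct_def)

lemma struct_iso_iff_emb:
  "struct_iso Lng (induced Str A) (induced Str B) h \<longleftrightarrow> h ` A = B \<and> emb h A srt R srt R"
proof
  assume iso: "struct_iso Lng (induced Str A) (induced Str B) h"
  hence b: "inj_on h A" "h ` A = B" by (auto simp: struct_iso_def bij_betw_def induced_def)
  have rel: "rel_int Str r xs = rel_int Str r (map h xs)" if "rel_arity Lng r = Some (length xs)" "set xs \<subseteq> A" for r xs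
  proof -
    have "rel_arity Lng r = Some (length xs) \<and> set xs \<subseteq> univ (induced Str A)" using that by (simp add: induced_def)
    hence "rel_int (induced Str A) r xs = rel_int (induced Str B) r (map h xs)" using iso unfolding struct_iso_def by blast
    thus ?thesis by (simp add: induced_def)
  qed
  have "emb h A srt R srt R"
  proof (rule embI[OF b(1)])
    fix x assume x: "x \<in> A"
    have "srt x \<in> from_nat_into V ` {..<card V}"
      using bij_betw_from_nat_into_finite[OF finite_V] srt_in[of x] by (simp add: bij_betw_def)
    then obtain i where i: "i < card V" "from_nat_into V i = srt x" by auto
    show "srt (h x) = srt x" using rel[of "Suc i" "[x]"] i x by auto
  next
    fix S t assume S: "finite S" "S \<subseteq> A" "t \<in> S"
    have c: "card (h ` S) = card S" by (rule card_image[OF inj_on_subset[OF b(1) S(2)]])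
    show "R (h t) (h ` S) = R t S"
    proof (cases "card S = N")
      case True
      obtain ys where ys: "set ys = S - {t}" "distinct ys" using finite_distinct_list[of "S - {t}"] S(1) by auto
      have "length ys = card (S - {t})" using ys distinct_card by metis
      hence "length (t # ys) = N" using True S card_Suc_Diff1[OF S(1,3)] by simp
      moreover have "set (t # ys) = S" using ys S(3) by auto
      ultimately show ?thesis using rel[of 0 "t # ys"] S(2) by (auto simp del: set_simps simp: list.set_map[symmetric])
    next
      case False
      hence "\<not> R t S" "\<not> R (h t) (h ` S)" using c allowed_card[OF allowed_M] by metis+
      thus ?thesis by simp
    qed
  qed
  thus "h ` A = B \<and> emb h A srt R srt R" using b by simp
next
  assume h: "h ` A = B \<and> emb h A srt R srt R"
  note e = conjunct2[OF h]
  show "struct_iso Lng (induced Str A) (induced Str B) h"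
    unfolding struct_iso_def
  proof (intro conjI allI impI)
    show "bij_betw h (univ (induced Str A)) (univ (induced Str B))"
      using h emb_inj[OF e] by (simp add: bij_betw_def induced_def)
    fix r xs assume xs: "rel_arity Lng r = Some (length xs) \<and> set xs \<subseteq> univ (induced Str A)"
    hence ne: "xs \<noteq> []" using N_ge2 by (auto split: if_splits)
    have sub: "set xs \<subseteq> A" using xs by (simp add: induced_def)
    have hd: "hd (map h xs) = h (hd xs)" "hd xs \<in> set xs" using ne by (simp_all add: hd_map)
    show "rel_int (induced Str A) r xs = rel_int (induced Str B) r (map h xs)"
      using emb_rel[OF e _ sub hd(2)] emb_sort[OF e, of "hd xs"] sub hd by (auto simp: induced_def)
  qed simp
qed

lemma induced_UNIV: "induced Str UNIV = Str"
  by (simp add: induced_def Str_def)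

lemma struct_iso_Gr: "struct_iso Lng Str Str g \<longleftrightarrow> g \<in> Gr"
  using struct_iso_iff_emb[of UNIV UNIV g] emb_inj[of g UNIV srt R srt R]
  by (auto simp: induced_UNIV Gr_def bij_def)

lemma carrier_Aut [simp]: "carrier (Aut Lng Str) = Gr"
  by (auto simp: Aut_def struct_iso_Gr Bij_def Gr_def bij_betw_def bij_def)

lemma Gr_Bij: "g \<in> Gr \<Longrightarrow> g \<in> Bij UNIV"
  by (simp add: Bij_def Gr_bij)

lemma mult_Aut [simp]: "g \<in> Gr \<Longrightarrow> h \<in> Gr \<Longrightarrow> g \<otimes>\<^bsub>Aut Lng Str\<^esub> h = (\<lambda>x. g (h x))"
  by (simp add: Aut_def BijGroup_def Gr_Bij compose_def restrict_def)

lemma one_Aut [simp]: "\<one>\<^bsub>Aut Lng Str\<^esub> = (\<lambda>x. x)"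
  by (simp add: Aut_def BijGroup_def restrict_def)

lemma group_Aut: "group (Aut Lng Str)"
proof (rule groupI)
  fix x y z assume g: "x \<in> carrier (Aut Lng Str)" "y \<in> carrier (Aut Lng Str)" "z \<in> carrier (Aut Lng Str)"
  show "x \<otimes>\<^bsub>Aut Lng Str\<^esub> y \<in> carrier (Aut Lng Str)" using g Gr_comp by simp
  show "x \<otimes>\<^bsub>Aut Lng Str\<^esub> y \<otimes>\<^bsub>Aut Lng Str\<^esub> z = x \<otimes>\<^bsub>Aut Lng Str\<^esub> (y \<otimes>\<^bsub>Aut Lng Str\<^esub> z)"
    using g Gr_comp[of x y] Gr_comp[of y z] by simp
next
  show "\<one>\<^bsub>Aut Lng Str\<^esub> \<in> carrier (Aut Lng Str)" by (simp add: Gr_id)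
  fix x assume x: "x \<in> carrier (Aut Lng Str)"
  show "\<one>\<^bsub>Aut Lng Str\<^esub> \<otimes>\<^bsub>Aut Lng Str\<^esub> x = x" using x Gr_id by simp
  show "\<exists>y\<in>carrier (Aut Lng Str). y \<otimes>\<^bsub>Aut Lng Str\<^esub> x = \<one>\<^bsub>Aut Lng Str\<^esub>"
    using x Gr_inv[of x] by (intro bexI[of _ "ginv x"]) auto
qed

lemma inv_Aut [simp]: "g \<in> Gr \<Longrightarrow> inv\<^bsub>Aut Lng Str\<^esub> g = ginv g"
  by (rule group.inv_equality[OF group_Aut]) (simp_all add: Gr_inv)

lemma homogeneous_Str: "homogeneous Lng Str"
  unfolding homogeneous_def
proof (intro allI impI)
  fix A B h assume h: "finite A \<and> finite B \<and> substruct Lng Str A \<and> substruct Lng Str B \<and> struct_iso Lng (induced Str A) (induced Str B) h"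
  hence "finite A" "emb h A srt R srt R" by (simp_all add: struct_iso_iff_emb)
  thus "\<exists>g\<in>carrier (Aut Lng Str). \<forall>a\<in>A. g a = h a" by (simp add: homogeneity)
qed

lemma categorical_Str: "aleph0_categorical Lng Str"
proof (rule finite_relational_homogeneous_aleph0_categorical)
  show "fun_arity Lng = (\<lambda>_. None)" by (simp add: Lng_def)
  have "dom (rel_arity Lng) \<subseteq> {..card V}" by (auto simp: dom_def split: if_splits)
  thus "finite (dom (rel_arity Lng))" by (rule finite_subset) simp
qed (simp_all add: is_struct_Str homogeneous_Str)

lemma pointwise_stab_Str: "pointwise_stab Lng Str A = stab A"
  by (auto simp: pointwise_stab_def stab_def)

lemma no_algebraicity_Str: "no_algebraicity Lng Str"
  unfolding no_algebraicity_def
proof (intro allI impI)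
  fix A :: "nat set" assume A: "finite A \<and> A \<subseteq> univ Str"
  have orb: "orbit (Aut Lng Str\<lparr>carrier := pointwise_stab Lng Str A\<rparr>) (\<lambda>g. g) b = (\<lambda>g. g b) ` stab A" for b
    by (auto simp: orbit_def pointwise_stab_Str)
  have "finite ((\<lambda>g. g b) ` stab A) \<longleftrightarrow> b \<in> A" for b
  proof
    assume "finite ((\<lambda>g. g b) ` stab A)"
    thus "b \<in> A" using no_algebraic_points[of A "(\<lambda>g. g b) ` stab A" b] A by blast
  next
    assume "b \<in> A"
    hence "(\<lambda>g. g b) ` stab A \<subseteq> {b}" by (auto simp: stab_def)
    thus "finite ((\<lambda>g. g b) ` stab A)" by (rule finite_subset) simp
  qed
  thus "acl Lng Str A = A" unfolding acl_def orb by simp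
qed

lemma strong_small_index_Str: "strong_small_index_property Lng Str"
  unfolding strong_small_index_property_def
proof (intro allI impI, elim conjE)
  let ?G = "Aut Lng Str"
  fix H assume H: "subgroup H ?G" and ix: "rcosets\<^bsub>?G\<^esub> H \<prec> (UNIV :: nat set set)"
  have HG: "H \<subseteq> Gr" using subgroup.subset[OF H] by simp
  have sub: "subgrp H"
    unfolding subgrp_def
  proof (intro conjI ballI HG)
    show "(\<lambda>x. x) \<in> H" using subgroup.one_closed[OF H] by simp
    show "(\<lambda>x. g (h x)) \<in> H" if "g \<in> H" "h \<in> H" for g h
      using subgroup.m_closed[OF H that] that HG by (simp add: subset_iff)
    show "ginv g \<in> H" if "g \<in> H" for g
      using subgroup.m_inv_closed[OF H that] that HG by (simp add: subset_iff)
  qed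
  have "small_index H"
    unfolding small_index_def
  proof
    assume "\<exists>h :: (nat \<Rightarrow> bool) \<Rightarrow> nat \<Rightarrow> nat. (\<forall>a. h a \<in> Gr) \<and> (\<forall>a b. a \<noteq> b \<longrightarrow> (\<lambda>x. ginv (h a) (h b x)) \<notin> H)"
    then obtain h :: "(nat \<Rightarrow> bool) \<Rightarrow> nat \<Rightarrow> nat" where
      h: "\<forall>a. h a \<in> Gr" "\<forall>a b. a \<noteq> b \<longrightarrow> (\<lambda>x. ginv (h a) (h b x)) \<notin> H" by (elim exE conjE)
    have hG: "h a \<in> Gr" for a using h(1) by simp
    \<comment> \<open>Inverses turn the left cosets of \<open>small_index\<close> into right cosets,
      and sets of natural numbers stand for binary sequences.\<close>
    define c where "c S = H #>\<^bsub>?G\<^esub> ginv (h (\<lambda>n. n \<in> S))" for S :: "nat set"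
    have "inj c"
    proof (rule injI, rule ccontr)
      fix S T assume e: "c S = c T" "S \<noteq> T"
      let ?s = "h (\<lambda>n. n \<in> S)" and ?t = "h (\<lambda>n. n \<in> T)"
      have "ginv ?s = (\<lambda>x. x) \<otimes>\<^bsub>?G\<^esub> ginv ?s" by (simp add: Gr_id Gr_inv hG)
      moreover have "(\<lambda>x. x) \<in> H" using sub by (simp add: subgrp_def)
      ultimately have "ginv ?s \<in> c S" unfolding c_def r_coset_def by blast
      hence "ginv ?s \<in> c T" using e(1) by simp
      then obtain k where k: "k \<in> H" "ginv ?s = k \<otimes>\<^bsub>?G\<^esub> ginv ?t" unfolding c_def r_coset_def by blast
      hence "ginv ?s = (\<lambda>x. k (ginv ?t x))" using HG Gr_inv[OF hG] by (simp add: subset_iff)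
      hence "(\<lambda>x. ginv ?s (?t x)) = k" using hG by simp
      moreover have "(\<lambda>n. n \<in> S) \<noteq> (\<lambda>n. n \<in> T)" using e(2) by (auto simp: fun_eq_iff)
      ultimately show False using h(2) k(1) by metis
    qed
    moreover have "range c \<subseteq> rcosets\<^bsub>?G\<^esub> H"
      using Gr_inv[OF hG] by (auto simp: c_def RCOSETS_def)
    ultimately have "(UNIV :: nat set set) \<lesssim> rcosets\<^bsub>?G\<^esub> H" unfolding lepoll_def by blast
    thus False using ix unfolding lesspoll_def by (metis lepoll_antisym)
  qed
  then obtain A where A: "finite A" "stab A \<subseteq> H" "\<And>h. h \<in> H \<Longrightarrow> h ` A = A"
    using strong_small_index_stab[OF sub] by blast
  have "H \<subseteq> setwise_stab Lng Str A" using A(3) HG by (auto simp: setwise_stab_def)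
  thus "\<exists>A. finite A \<and> A \<subseteq> univ Str \<and> pointwise_stab Lng Str A \<subseteq> H \<and> H \<subseteq> setwise_stab Lng Str A"
    using A(1,2) by (intro exI[of _ A]) (simp add: pointwise_stab_Str)
qed

section \<open>Automorphisms of the group and normalizing permutations\<close>

definition implements :: "(nat \<Rightarrow> nat) \<Rightarrow> ((nat \<Rightarrow> nat) \<Rightarrow> nat \<Rightarrow> nat) \<Rightarrow> bool" where
  "implements \<sigma> \<alpha> \<longleftrightarrow> bij \<sigma> \<and> (\<forall>g\<in>Gr. \<forall>x. \<alpha> g (\<sigma> x) = \<sigma> (g x))"

text \<open>Two such permutations differ by one that commutes with all of \<open>Gr\<close>; as
  distinct points have distinct stabilizers, it is the identity.\<close>

lemma implements_unique:
  assumes "implements \<sigma> \<alpha>" "implements \<tau> \<alpha>" shows "\<sigma> = \<tau>"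
proof
  fix x
  obtain y where y: "\<tau> y = \<sigma> x" using assms(2) unfolding implements_def by (metis bij_pointE)
  have "stab {x} \<subseteq> stab {y}"
  proof
    fix g assume g: "g \<in> stab {x}"
    hence gG: "g \<in> Gr" and gx: "g x = x" by (simp_all add: stab_def)
    have "\<tau> (g y) = \<alpha> g (\<tau> y)" using assms(2) gG by (simp add: implements_def)
    also have "\<dots> = \<sigma> (g x)" using assms(1) gG y by (simp add: implements_def)
    also have "\<dots> = \<tau> y" using gx y by simp
    finally have "\<tau> (g y) = \<tau> y" .
    moreover have "inj \<tau>" using assms(2) by (simp add: implements_def bij_is_inj)
    ultimately have "g y = y" by (simp add: inj_eq)
    thus "g \<in> stab {y}" using gG by (simp add: stab_def)
  qed
  hence "x = y" by (rule stab_point_inj)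
  thus "\<sigma> x = \<tau> x" using y by simp
qed

lemma implements_eq:
  assumes "implements \<sigma> \<alpha>" "g \<in> Gr" shows "\<alpha> g = (\<lambda>x. \<sigma> (g (ginv \<sigma> x)))"
proof
  fix x
  have b: "bij \<sigma>" using assms(1) by (simp add: implements_def)
  have "\<alpha> g (\<sigma> (ginv \<sigma> x)) = \<sigma> (g (ginv \<sigma> x))" using assms by (simp add: implements_def)
  thus "\<alpha> g x = \<sigma> (g (ginv \<sigma> x))" using b by (simp add: bij_is_surj surj_f_inv_f)
qed

lemma auto_is_aut:
  assumes "\<alpha> \<in> auto (Aut Lng Str)" shows "is_aut \<alpha>"
  unfolding is_aut_def
proof (intro conjI ballI)
  show b: "bij_betw \<alpha> Gr Gr" using assms by (simp add: auto_def Bij_def)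
  fix g h assume gh: "g \<in> Gr" "h \<in> Gr"
  have "\<alpha> (g \<otimes>\<^bsub>Aut Lng Str\<^esub> h) = \<alpha> g \<otimes>\<^bsub>Aut Lng Str\<^esub> \<alpha> h"
    using assms gh hom_mult[of \<alpha> "Aut Lng Str" "Aut Lng Str" g h] by (simp add: auto_def)
  moreover have "\<alpha> g \<in> Gr" "\<alpha> h \<in> Gr" using b gh by (auto simp: bij_betw_def)
  ultimately show "\<alpha> (\<lambda>x. g (h x)) = (\<lambda>x. \<alpha> g (\<alpha> h x))" using gh by simp
qed

lemma implements_normalizes:
  assumes "is_aut \<alpha>" "implements \<sigma> \<alpha>" shows "normalizes \<sigma>"
  unfolding normalizes_def
proof (intro conjI ballI)
  show "bij \<sigma>" using assms(2) by (simp add: implements_def)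
  show "\<exists>g'\<in>Gr. \<forall>x. g' (\<sigma> x) = \<sigma> (g x)" if "g \<in> Gr" for g
    using is_aut_Gr[OF assms(1) that] assms(2) that unfolding implements_def by blast
  show "\<exists>g\<in>Gr. \<forall>x. g' (\<sigma> x) = \<sigma> (g x)" if "g' \<in> Gr" for g'
  proof -
    note i = is_aut_inverse[OF assms(1)]
    have "inv_into Gr \<alpha> g' \<in> Gr" by (rule is_aut_Gr[OF i(1) that])
    moreover from this have "\<forall>x. \<alpha> (inv_into Gr \<alpha> g') (\<sigma> x) = \<sigma> (inv_into Gr \<alpha> g' x)"
      using assms(2) by (simp add: implements_def)
    ultimately show ?thesis unfolding i(2)[OF that] by blast
  qed
qed

lemma normalizes_implements:
  assumes n: "normalizes \<sigma>"
  shows "\<exists>\<alpha>\<in>auto (Aut Lng Str). implements \<sigma> \<alpha>"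
proof -
  have b: "bij \<sigma>" using n by (simp add: normalizes_def)
  have l: "ginv \<sigma> (\<sigma> x) = x" and r: "\<sigma> (ginv \<sigma> x) = x" for x
    using b by (simp_all add: bij_is_inj bij_is_surj surj_f_inv_f)
  have cG: "(\<lambda>x. \<sigma> (g (ginv \<sigma> x))) \<in> Gr" if g: "g \<in> Gr" for g
  proof -
    obtain g' where g': "g' \<in> Gr" "\<forall>x. g' (\<sigma> x) = \<sigma> (g x)" using n g unfolding normalizes_def by blast
    have "g' x = \<sigma> (g (ginv \<sigma> x))" for x using g'(2)[rule_format, of "ginv \<sigma> x"] r by simp
    hence "(\<lambda>x. \<sigma> (g (ginv \<sigma> x))) = g'" by auto
    thus ?thesis using g'(1) by simp
  qed
  define \<alpha> where "\<alpha> = (\<lambda>g\<in>Gr. \<lambda>x. \<sigma> (g (ginv \<sigma> x)))"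
  have \<alpha>: "\<alpha> g = (\<lambda>x. \<sigma> (g (ginv \<sigma> x)))" if "g \<in> Gr" for g using that by (simp add: \<alpha>_def)
  have imp: "implements \<sigma> \<alpha>" using b l \<alpha> by (simp add: implements_def)
  have "inj_on \<alpha> Gr"
  proof (rule inj_onI)
    fix g h assume gh: "g \<in> Gr" "h \<in> Gr" "\<alpha> g = \<alpha> h"
    have "\<sigma> (g x) = \<sigma> (h x)" for x using fun_cong[OF gh(3), of "\<sigma> x"] \<alpha> gh(1,2) l by simp
    thus "g = h" using bij_is_inj[OF b] by (auto simp: inj_eq)
  qed
  moreover have "\<alpha> ` Gr = Gr"
  proof (intro equalityI subsetI)
    fix g' assume g': "g' \<in> Gr"
    then obtain g where g: "g \<in> Gr" "\<forall>x. g' (\<sigma> x) = \<sigma> (g x)" using n unfolding normalizes_def by blast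
    have "g' x = \<alpha> g x" for x using g(2)[rule_format, of "ginv \<sigma> x"] r \<alpha>[OF g(1)] by simp
    hence "g' = \<alpha> g" by auto
    thus "g' \<in> \<alpha> ` Gr" using g(1) by blast
  qed (use cG \<alpha> in auto)
  ultimately have "\<alpha> \<in> Bij Gr" by (simp add: Bij_def bij_betw_def \<alpha>_def)
  moreover have "\<alpha> \<in> hom (Aut Lng Str) (Aut Lng Str)"
  proof (rule homI)
    show "\<alpha> g \<in> carrier (Aut Lng Str)" if "g \<in> carrier (Aut Lng Str)" for g using that cG \<alpha> by simp
    show "\<alpha> (g \<otimes>\<^bsub>Aut Lng Str\<^esub> h) = \<alpha> g \<otimes>\<^bsub>Aut Lng Str\<^esub> \<alpha> h"
      if "g \<in> carrier (Aut Lng Str)" "h \<in> carrier (Aut Lng Str)" for g h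
      using that cG[of g] cG[of h] Gr_comp[of g h] by (simp add: \<alpha> l)
  qed
  ultimately show ?thesis using imp by (auto simp: auto_def)
qed

end

context rigid_pattern begin

text \<open>Each automorphism is implemented by a unique permutation, which permutes the sorts like
  a unique element of \<open>K\<close>; this defines a homomorphism onto \<open>K\<close>. Its value
  is trivial exactly when the permutation preserves all sorts, hence lies in \<open>Gr\<close>, and
  then the automorphism is inner.\<close>

lemma Out_iso:
  fixes K :: "('g, 'm) monoid_scheme"
  assumes K: "group K"
    and tw: "\<And>k. k \<in> carrier K \<Longrightarrow> twist (act k)"
    and act: "\<And>k l v. k \<in> carrier K \<Longrightarrow> l \<in> carrier K \<Longrightarrow> v \<in> V \<Longrightarrow> act (k \<otimes>\<^bsub>K\<^esub> l) v = act k (act l v)"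
    and onto: "\<And>\<pi>. twist \<pi> \<Longrightarrow> \<exists>k\<in>carrier K. \<forall>v\<in>V. \<pi> v = act k v"
    and faithful: "\<And>k l. k \<in> carrier K \<Longrightarrow> l \<in> carrier K \<Longrightarrow> (\<And>v. v \<in> V \<Longrightarrow> act k v = act l v) \<Longrightarrow> k = l"
  shows "K \<cong> Out (Aut Lng Str)"
proof -
  interpret K: group K by (rule K)
  let ?A = "Aut Lng Str" and ?AA = "AutoGroup (Aut Lng Str)"
  have cAA: "carrier ?AA = auto ?A" by (simp add: AutoGroup_def)
  have grAA: "group ?AA" by (rule group.AutoGroup[OF group_Aut])
  define label where "label \<alpha> k \<longleftrightarrow> k \<in> carrier K \<and> (\<exists>\<sigma>. implements \<sigma> \<alpha> \<and> (\<forall>x. srt (\<sigma> x) = act k (srt x)))" for \<alpha> k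
  have label_ex: "\<exists>k. label \<alpha> k" if \<alpha>: "\<alpha> \<in> auto ?A" for \<alpha>
  proof -
    note a = auto_is_aut[OF \<alpha>]
    obtain \<sigma> where \<sigma>: "implements \<sigma> \<alpha>" using is_aut_induced[OF a] by (auto simp: implements_def)
    obtain \<pi> where \<pi>: "twist \<pi>" "\<forall>x. srt (\<sigma> x) = \<pi> (srt x)" using normalizes_twist[OF implements_normalizes[OF a \<sigma>]] by blast
    obtain k where "k \<in> carrier K" "\<forall>v\<in>V. \<pi> v = act k v" using onto[OF \<pi>(1)] by blast
    thus ?thesis using \<sigma> \<pi>(2) srt_in unfolding label_def by (intro exI[of _ k] conjI exI[of _ \<sigma>]) auto
  qed
  have label_unique: "k = l" if kl: "label \<alpha> k" "label \<alpha> l" for \<alpha> k l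
  proof (rule faithful)
    show "k \<in> carrier K" "l \<in> carrier K" using kl by (auto simp: label_def)
    fix v assume "v \<in> V"
    then obtain x where x: "srt x = v" using sort_surj by blast
    obtain \<sigma> \<tau> where "implements \<sigma> \<alpha>" "\<forall>x. srt (\<sigma> x) = act k (srt x)" "implements \<tau> \<alpha>" "\<forall>x. srt (\<tau> x) = act l (srt x)"
      using kl unfolding label_def by blast
    thus "act k v = act l v" using implements_unique[of \<sigma> \<alpha> \<tau>] x by metis
  qed
  define \<kappa> where "\<kappa> \<alpha> = (THE k. label \<alpha> k)" for \<alpha>
  have \<kappa>_eq: "\<kappa> \<alpha> = k" if "label \<alpha> k" for \<alpha> k
    unfolding \<kappa>_def using that label_unique[OF _ that] by (rule the_equality)
  have \<kappa>: "label \<alpha> (\<kappa> \<alpha>)" if "\<alpha> \<in> auto ?A" for \<alpha>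
    using label_ex[OF that] \<kappa>_eq by metis
  have auto_ext: "\<alpha> = (\<lambda>g\<in>Gr. \<alpha> g)" if "\<alpha> \<in> auto ?A" for \<alpha>
  proof -
    have "\<alpha> \<in> extensional Gr" using that by (simp add: auto_def Bij_def)
    thus ?thesis by (simp add: extensional_restrict)
  qed
  have "\<kappa> \<in> hom ?AA K"
  proof (rule homI)
    show "\<kappa> \<alpha> \<in> carrier K" if "\<alpha> \<in> carrier ?AA" for \<alpha> using \<kappa> that by (simp add: cAA label_def)
    fix \<alpha> \<beta> assume ab: "\<alpha> \<in> carrier ?AA" "\<beta> \<in> carrier ?AA"
    hence a: "\<alpha> \<in> auto ?A" "\<beta> \<in> auto ?A" by (simp_all add: cAA)
    hence "\<alpha> \<in> Bij Gr" "\<beta> \<in> Bij Gr" by (simp_all add: auto_def)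
    hence m: "\<alpha> \<otimes>\<^bsub>?AA\<^esub> \<beta> = compose Gr \<alpha> \<beta>" by (simp add: AutoGroup_def BijGroup_def)
    obtain \<sigma> where \<sigma>: "implements \<sigma> \<alpha>" "\<forall>x. srt (\<sigma> x) = act (\<kappa> \<alpha>) (srt x)" "\<kappa> \<alpha> \<in> carrier K"
      using \<kappa>[OF a(1)] unfolding label_def by blast
    obtain \<tau> where \<tau>: "implements \<tau> \<beta>" "\<forall>x. srt (\<tau> x) = act (\<kappa> \<beta>) (srt x)" "\<kappa> \<beta> \<in> carrier K"
      using \<kappa>[OF a(2)] unfolding label_def by blast
    have "implements (\<lambda>x. \<sigma> (\<tau> x)) (compose Gr \<alpha> \<beta>)"
      unfolding implements_def
    proof (intro conjI ballI allI)
      show "bij (\<lambda>x. \<sigma> (\<tau> x))" using \<sigma>(1) \<tau>(1) bij_comp[of \<tau> \<sigma>] by (simp add: implements_def comp_def)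
      fix g x assume g: "g \<in> Gr"
      hence "\<beta> g \<in> Gr" using is_aut_Gr[OF auto_is_aut[OF a(2)]] by simp
      thus "compose Gr \<alpha> \<beta> g (\<sigma> (\<tau> x)) = \<sigma> (\<tau> (g x))"
        using g \<sigma>(1) \<tau>(1) by (simp add: compose_def implements_def)
    qed
    moreover have "srt (\<sigma> (\<tau> x)) = act (\<kappa> \<alpha> \<otimes>\<^bsub>K\<^esub> \<kappa> \<beta>) (srt x)" for x
      using \<sigma>(2) \<tau>(2) act[OF \<sigma>(3) \<tau>(3) srt_in[of x]] by simp
    ultimately have "label (compose Gr \<alpha> \<beta>) (\<kappa> \<alpha> \<otimes>\<^bsub>K\<^esub> \<kappa> \<beta>)"
      unfolding label_def using \<sigma>(3) \<tau>(3) by (intro conjI K.m_closed exI[of _ "\<lambda>x. \<sigma> (\<tau> x)"]) auto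
    thus "\<kappa> (\<alpha> \<otimes>\<^bsub>?AA\<^esub> \<beta>) = \<kappa> \<alpha> \<otimes>\<^bsub>K\<^esub> \<kappa> \<beta>" unfolding m by (rule \<kappa>_eq)
  qed
  then interpret h: group_hom ?AA K \<kappa>
    unfolding group_hom_def group_hom_axioms_def using grAA K by blast
  have "\<kappa> ` carrier ?AA = carrier K"
  proof (intro equalityI subsetI)
    fix k assume k: "k \<in> carrier K"
    obtain \<sigma> where \<sigma>: "normalizes \<sigma>" "\<forall>x. srt (\<sigma> x) = act k (srt x)" using twist_normalizes[OF tw[OF k]] by blast
    obtain \<alpha> where \<alpha>: "\<alpha> \<in> auto ?A" "implements \<sigma> \<alpha>" using normalizes_implements[OF \<sigma>(1)] by blast
    have "label \<alpha> k" using k \<sigma>(2) \<alpha>(2) unfolding label_def by blast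
    hence "\<kappa> \<alpha> = k" by (rule \<kappa>_eq)
    thus "k \<in> \<kappa> ` carrier ?AA" using \<alpha>(1) cAA by blast
  qed auto
  hence "?AA Mod (kernel ?AA K \<kappa>) \<cong> K" by (rule h.FactGroup_iso)
  moreover have "kernel ?AA K \<kappa> = Inn ?A"
  proof (intro equalityI subsetI)
    \<comment> \<open>The action of the identity is idempotent by \<open>act\<close> and injective
      by \<open>tw\<close>.\<close>
    have act1: "act \<one>\<^bsub>K\<^esub> v = v" if v: "v \<in> V" for v
    proof -
      have b: "bij_betw (act \<one>\<^bsub>K\<^esub>) V V" using tw[OF K.one_closed] by (simp add: twist_def)
      have "act \<one>\<^bsub>K\<^esub> v \<in> V" using bij_betwE[OF b] v by blast
      moreover have "act \<one>\<^bsub>K\<^esub> (act \<one>\<^bsub>K\<^esub> v) = act \<one>\<^bsub>K\<^esub> v" using act[of "\<one>\<^bsub>K\<^esub>" "\<one>\<^bsub>K\<^esub>" v] v by simp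
      ultimately show ?thesis using inj_onD[OF bij_betw_imp_inj_on[OF b]] v by blast
    qed
    {
      fix \<alpha> assume "\<alpha> \<in> kernel ?AA K \<kappa>"
      hence \<alpha>: "\<alpha> \<in> auto ?A" "\<kappa> \<alpha> = \<one>\<^bsub>K\<^esub>" by (simp_all add: kernel_def cAA)
      obtain \<sigma> where \<sigma>: "implements \<sigma> \<alpha>" "\<forall>x. srt (\<sigma> x) = act \<one>\<^bsub>K\<^esub> (srt x)"
        using \<kappa>[OF \<alpha>(1)] unfolding \<alpha>(2) label_def by blast
      have "\<sigma> \<in> Gr" using normalizes_Gr_iff[OF implements_normalizes[OF auto_is_aut[OF \<alpha>(1)] \<sigma>(1)]] \<sigma>(2) act1 srt_in by simp
      moreover have "\<alpha> = (\<lambda>g\<in>carrier ?A. \<sigma> \<otimes>\<^bsub>?A\<^esub> g \<otimes>\<^bsub>?A\<^esub> inv\<^bsub>?A\<^esub> \<sigma>)"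
      proof -
        have "\<alpha> g = \<sigma> \<otimes>\<^bsub>?A\<^esub> g \<otimes>\<^bsub>?A\<^esub> inv\<^bsub>?A\<^esub> \<sigma>" if "g \<in> Gr" for g
          using implements_eq[OF \<sigma>(1) that] that \<open>\<sigma> \<in> Gr\<close> Gr_comp[OF \<open>\<sigma> \<in> Gr\<close> that] Gr_inv[OF \<open>\<sigma> \<in> Gr\<close>] by simp
        hence "(\<lambda>g\<in>Gr. \<alpha> g) = (\<lambda>g\<in>carrier ?A. \<sigma> \<otimes>\<^bsub>?A\<^esub> g \<otimes>\<^bsub>?A\<^esub> inv\<^bsub>?A\<^esub> \<sigma>)"
          by (auto simp: restrict_def)
        thus ?thesis using auto_ext[OF \<alpha>(1)] by simp
      qed
      ultimately show "\<alpha> \<in> Inn ?A" unfolding Inn_def by auto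
    }
    {
      fix \<alpha> assume "\<alpha> \<in> Inn ?A"
      then obtain \<sigma> where \<sigma>: "\<sigma> \<in> Gr" "\<alpha> = (\<lambda>g\<in>carrier ?A. \<sigma> \<otimes>\<^bsub>?A\<^esub> g \<otimes>\<^bsub>?A\<^esub> inv\<^bsub>?A\<^esub> \<sigma>)"
        unfolding Inn_def by auto
      have \<alpha>g: "\<alpha> g = (\<lambda>x. \<sigma> (g (ginv \<sigma> x)))" if "g \<in> Gr" for g
        using that \<sigma> Gr_comp[OF \<sigma>(1) that] Gr_inv[OF \<sigma>(1)] by simp
      have n: "normalizes \<sigma>"
        unfolding normalizes_def
      proof (intro conjI ballI)
        show "bij \<sigma>" by (rule Gr_bij[OF \<sigma>(1)])
        show "\<exists>g'\<in>Gr. \<forall>x. g' (\<sigma> x) = \<sigma> (g x)" if "g \<in> Gr" for g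
          by (rule bexI[OF _ Gr_comp[OF \<sigma>(1) Gr_comp[OF that Gr_inv[OF \<sigma>(1)]]]]) (simp add: \<sigma>(1))
        show "\<exists>g\<in>Gr. \<forall>x. g' (\<sigma> x) = \<sigma> (g x)" if "g' \<in> Gr" for g'
          by (rule bexI[OF _ Gr_comp[OF Gr_inv[OF \<sigma>(1)] Gr_comp[OF that \<sigma>(1)]]]) (simp add: \<sigma>(1))
      qed
      obtain \<beta> where \<beta>: "\<beta> \<in> auto ?A" "implements \<sigma> \<beta>" using normalizes_implements[OF n] by blast
      have "\<alpha> = \<beta>"
      proof -
        have "\<alpha> = (\<lambda>g\<in>Gr. \<alpha> g)" unfolding \<sigma>(2) by (auto simp: restrict_def)
        also have "\<dots> = (\<lambda>g\<in>Gr. \<beta> g)" using \<alpha>g implements_eq[OF \<beta>(2)] by (auto simp: restrict_def)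
        also have "\<dots> = \<beta>" using auto_ext[OF \<beta>(1)] by simp
        finally show ?thesis .
      qed
      moreover have "label \<beta> \<one>\<^bsub>K\<^esub>"
        unfolding label_def using \<beta>(2) Gr_srt[OF \<sigma>(1)] act1[OF srt_in] by (intro conjI exI[of _ \<sigma>]) auto
      ultimately show "\<alpha> \<in> kernel ?AA K \<kappa>" using \<kappa>_eq \<beta>(1) by (simp add: kernel_def cAA)
    }
  qed
  ultimately have iso: "Out ?A \<cong> K" by (simp add: Out_def)
  have "Inn ?A \<lhd> ?AA" using h.normal_kernel \<open>kernel ?AA K \<kappa> = Inn ?A\<close> by simp
  hence "group (Out ?A)" unfolding Out_def by (rule normal.factorgroup_is_group)
  thus ?thesis using iso by (rule group.iso_sym)
qed

end

theorem theorem1p3: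
  fixes K :: "('k, 'm) monoid_scheme"
  assumes "group K" and "finite (carrier K)"
  shows "\<exists>(L :: (nat, nat) lang) (M :: (nat, nat, nat) struct).
    is_struct L M \<and> countable (univ M) \<and>
    aleph0_categorical L M \<and>
    homogeneous L M \<and>
    strong_small_index_property L M \<and>
    no_algebraicity L M \<and>
    K \<cong> Out (Aut L M)"
proof -
  interpret K: group K by (rule assms(1))
  obtain f :: "'k \<Rightarrow> nat" where f: "inj_on f (carrier K)" using finite_imp_inj_to_nat_seg[OF assms(2)] by blast
  define E where "E k = (if k = \<one>\<^bsub>K\<^esub> then 3 else f k + 4)" for k
  have E: "inj_on E (carrier K)" using f by (auto simp: E_def inj_on_def)
  \<comment> \<open>Only the quotient of \<open>v\<close> and \<open>u\<close> matters, so left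
    translations are symmetries of the pattern; injectivity of \<open>E\<close> excludes any
    others.\<close>
  define pat where "pat v u = E (inv\<^bsub>K\<^esub> v \<otimes>\<^bsub>K\<^esub> u)" for v u
  have E3: "E k = 3 \<longleftrightarrow> k = \<one>\<^bsub>K\<^esub>" for k by (simp add: E_def)
  have sum: "sum (pat v) (carrier K) = sum E (carrier K)" if v: "v \<in> carrier K" for v
    unfolding pat_def
  proof (rule sum.reindex_bij_witness[where i = "\<lambda>k. v \<otimes>\<^bsub>K\<^esub> k" and j = "\<lambda>u. inv\<^bsub>K\<^esub> v \<otimes>\<^bsub>K\<^esub> u"])
  qed (use v in \<open>simp_all add: K.m_assoc[symmetric]\<close>)
  interpret rigid_pattern "carrier K" pat "sum E (carrier K)"
  proof
    show "finite (carrier K)" by (rule assms(2))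
    show "carrier K \<noteq> {}" using K.one_closed by blast
    show "sum (pat v) (carrier K) = sum E (carrier K)" if "v \<in> carrier K" for v by (rule sum[OF that])
    have "E \<one>\<^bsub>K\<^esub> \<le> sum E (carrier K)" using assms(2) by (intro member_le_sum) auto
    thus "2 \<le> sum E (carrier K)" by (simp add: E_def)
    show "pat v u = 3 \<longleftrightarrow> u = v" if "v \<in> carrier K" "u \<in> carrier K" for v u
      unfolding pat_def E3 using that by (metis K.inv_equality K.inv_inv K.inv_closed K.l_inv)
  qed
  have inv_mult: "inv\<^bsub>K\<^esub> (k \<otimes>\<^bsub>K\<^esub> v) \<otimes>\<^bsub>K\<^esub> (k \<otimes>\<^bsub>K\<^esub> u) = inv\<^bsub>K\<^esub> v \<otimes>\<^bsub>K\<^esub> u"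
    if "k \<in> carrier K" "v \<in> carrier K" "u \<in> carrier K" for k v u
  proof -
    have "inv\<^bsub>K\<^esub> k \<otimes>\<^bsub>K\<^esub> (k \<otimes>\<^bsub>K\<^esub> u) = u" using that by (simp add: K.m_assoc[symmetric])
    thus ?thesis using that by (simp add: K.inv_mult_group K.m_assoc)
  qed
  have "K \<cong> Out (Aut Lng Str)"
  proof (rule Out_iso[OF assms(1), where act = "\<lambda>k v. k \<otimes>\<^bsub>K\<^esub> v"])
    fix k assume k: "k \<in> carrier K"
    have "bij_betw (\<lambda>v. k \<otimes>\<^bsub>K\<^esub> v) (carrier K) (carrier K)"
      by (rule bij_betw_byWitness[where f' = "\<lambda>v. inv\<^bsub>K\<^esub> k \<otimes>\<^bsub>K\<^esub> v"]) (use k in \<open>auto simp: K.m_assoc[symmetric]\<close>)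
    thus "twist (\<lambda>v. k \<otimes>\<^bsub>K\<^esub> v)" using inv_mult[OF k] by (simp add: twist_def pat_def)
  next
    fix \<pi> assume \<pi>: "twist \<pi>"
    hence V: "\<pi> v \<in> carrier K" if "v \<in> carrier K" for v using that by (auto simp: twist_def bij_betw_def)
    \<comment> \<open>The row of the identity already determines \<open>\<pi>\<close> from its value
      there.\<close>
    have "\<pi> u = \<pi> \<one>\<^bsub>K\<^esub> \<otimes>\<^bsub>K\<^esub> u" if u: "u \<in> carrier K" for u
    proof -
      have "E (inv\<^bsub>K\<^esub> \<pi> \<one>\<^bsub>K\<^esub> \<otimes>\<^bsub>K\<^esub> \<pi> u) = E (inv\<^bsub>K\<^esub> \<one>\<^bsub>K\<^esub> \<otimes>\<^bsub>K\<^esub> u)"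
        using \<pi> u K.one_closed unfolding twist_def pat_def by blast
      hence "inv\<^bsub>K\<^esub> \<pi> \<one>\<^bsub>K\<^esub> \<otimes>\<^bsub>K\<^esub> \<pi> u = u" using inj_onD[OF E] u V by simp
      thus ?thesis using K.inv_solve_left u V by (metis K.one_closed)
    qed
    thus "\<exists>k\<in>carrier K. \<forall>v\<in>carrier K. \<pi> v = k \<otimes>\<^bsub>K\<^esub> v" using V by blast
  next
    fix k l assume "k \<in> carrier K" "l \<in> carrier K" "\<And>v. v \<in> carrier K \<Longrightarrow> k \<otimes>\<^bsub>K\<^esub> v = l \<otimes>\<^bsub>K\<^esub> v"
    thus "k = l" using K.r_one K.one_closed by metis
  qed (simp add: K.m_assoc)
  thus ?thesis
    using is_struct_Str categorical_Str homogeneous_Str strong_small_index_Str no_algebraicity_Str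
    by (intro exI[of _ Lng] exI[of _ Str] conjI) simp_all
qed

end
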